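(* Let $1/2<\pi<1$ and $\delta>0$, and let $\{G(n),\ n=0,1,2,\dots\}$ be the random sequence of directed graphs with attachment and deletion with parameters $(\pi,\delta)$ defined in the context, with $p_k(n)=N_k(n)/v_n$ the fraction of vertices of $G(n)$ having in-degree $k$. Then the following hold. (i) For each fixed $k=0,1,2,\ldots$ the limit $p_k=\lim_{n\to\infty}\mathbb{E}[p_k(n)]$ exists, and $(p_k,\ k=0,1,2,\ldots)$ is a probability mass function on the nonnegative integers. In fact, there are constants $\kappa>0$ and $C>0$ such that $$\sum_{k=0}^{\infty}\bigl|p_k-\mathbb{E}[p_k(n)]\bigr|\leq C n^{-\kappa}\quad\text{for all } n\ge 1.$$ (ii) For any $\epsilon>0$ there exist $C>0$ and $N$ such that for all $n\geq N$ and all $k=0,1,2,\ldots$, $$\mathbb{P}\bigl(|p_k(n)-p_k|>\epsilon\bigr)\leq C\exp\left\{-C^{-1}\min(\epsilon,\epsilon^2)\,\frac{n}{(\log n)^2}\right\}.$$ (iii) The limiting probabilities satisfy, with the convention $p_{-1}=0$, the recursion $$[\alpha_2(k+1)+\beta_2]\,p_{k+1}+[\alpha_1 k+\beta_1]\,p_k+[\alpha_0(k-1)+\beta_0]\,p_{k-1}=-\mathbf{1}_{\{k=0\}},\qquad k=0,1,2,\ldots,$$ where $$\alpha_0=\frac{\pi}{2\pi-1+\delta\pi},\quad \beta_0=\frac{\delta\pi}{2\pi-1+\delta\pi},\quad \alpha_1=-\frac{\pi}{2\pi-1+\delta\pi}-\frac{1-\pi}{2\pi-1},\quad \beta_1=-\frac{\delta\pi}{2\pi-1+\delta\pi}-1,\quad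 \alpha_2=\frac{1-\pi}{2\pi-1},\quad \beta_2=0.$$
   Context: Model. Here $\pi$ is a model parameter (a probability), not the number $3.14\ldots$; the parameters are $1/2<\pi<1$ and $\delta>0$. A random sequence of directed graphs $\{G(n),\ n=0,1,2,\dots\}$ (loops allowed) is constructed as a Markov chain. $V_n$ and $E_n$ denote the vertex set and edge set of $G(n)$, $v_n=|V_n|$, $e_n=|E_n|$, and for $u\in V_n$, $d_n(u)$ is the in-degree of $u$ in $G(n)$ (a loop at $u$ contributes $1$ to its in-degree). The initial graph $G(0)$ consists of two vertices connected by a single directed edge from one to the other. For $n\ge 0$, given $G(n)$, the graph $G(n+1)$ is obtained as follows. - Addition: with probability $\pi$ if $e_n>0$, or with probability $1$ if $e_n=0$, a new vertex $w\notin V_n$ is introduced together with one directed outgoing edge $(w,u)$, where $u$ is chosen at random: $u\in V_n$ is chosen with probability $\frac{d_n(u)+\delta}{e_n+\delta v_n+\delta}$, and $u=w$ (a loop) is chosen with probability $\frac{\delta}{e_n+\delta v_n+\delta}$. Then $V_{n+1}=V_n\cup\{w\}$ and $E_{n+1}=E_n\cup\{(w,u)\}$. - Deletion: if $e_n>0$, then with the remaining probability $1-\pi$ an edge chosen uniformly at random from $E_n$ is removed, giving $E_{n+1}$, and $V_{n+1}=V_n$. For $n\ge 0$ and $k=0,1,2,\ldots$, $N_k(n)=\sum_{v\in V_n}\mathbf{1}_{\{d_n(v)=k\}}$ is the number of vertices with in-degree $k$ in $G(n)$, and $p_k(n)=N_k(n)/v_n$. *)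

theory Defs
  imports "HOL-Probability.Probability" "Graph_Theory.Digraph" "Graph_Theory.Pair_Digraph"
begin

(* In the model every vertex is the tail of at most one edge ever created, so parallel edges cannot
   occur and an edge is determined by its endpoints. *)
type_synonym graph = "nat pair_pre_digraph"

definition initial_graph :: graph where
  "initial_graph = \<lparr>pverts = {0, 1}, parcs = {(1, 0)}\<rparr>"

abbreviation num_verts :: "graph \<Rightarrow> nat" where
  "num_verts G \<equiv> card (pverts G)"

abbreviation num_edges :: "graph \<Rightarrow> nat" where
  "num_edges G \<equiv> card (parcs G)"

abbreviation indeg :: "graph \<Rightarrow> nat \<Rightarrow> nat" where
  "indeg G u \<equiv> in_degree (with_proj G) u"

(* The label of the new vertex is irrelevant; the least unused number makes it definite. *)
definition new_vertex :: "graph \<Rightarrow> nat" where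
  "new_vertex G = (LEAST w. w \<notin> pverts G)"

definition target_weight :: "real \<Rightarrow> graph \<Rightarrow> nat \<Rightarrow> real" where
  "target_weight \<delta> G u =
     (if u \<in> pverts G
      then (real (indeg G u) + \<delta>) / (real (num_edges G) + \<delta> * real (num_verts G) + \<delta>)
      else if u = new_vertex G
      then \<delta> / (real (num_edges G) + \<delta> * real (num_verts G) + \<delta>)
      else 0)"

(* A probability mass function for finite graphs, see pmf_target_pmf below. *)
definition target_pmf :: "real \<Rightarrow> graph \<Rightarrow> nat pmf" where
  "target_pmf \<delta> G = embed_pmf (target_weight \<delta> G)"

definition attach :: "graph \<Rightarrow> nat \<Rightarrow> graph" where
  "attach G u =
     \<lparr>pverts = insert (new_vertex G) (pverts G), parcs = insert (new_vertex G, u) (parcs G)\<rparr>"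

definition remove_edge :: "graph \<Rightarrow> nat \<times> nat \<Rightarrow> graph" where
  "remove_edge G e = \<lparr>pverts = pverts G, parcs = parcs G - {e}\<rparr>"

definition step :: "real \<Rightarrow> real \<Rightarrow> graph \<Rightarrow> graph pmf" where
  "step \<pi> \<delta> G =
     bernoulli_pmf (if num_edges G > 0 then \<pi> else 1) \<bind>
       (\<lambda>add. if add then map_pmf (attach G) (target_pmf \<delta> G)
              else map_pmf (remove_edge G) (pmf_of_set (parcs G)))"

(* Time-homogeneous Markov chain on the discrete state space UNIV, with transition kernel K and
   deterministic initial state s0. *)
definition markov_chain ::
  "'a measure \<Rightarrow> ('s \<Rightarrow> 's pmf) \<Rightarrow> 's \<Rightarrow> (nat \<Rightarrow> 'a \<Rightarrow> 's) \<Rightarrow> bool" where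
  "markov_chain M K s0 X \<longleftrightarrow>
     prob_space M \<and>
     (\<forall>n. X n \<in> measurable M (count_space UNIV)) \<and>
     (AE \<omega> in M. X 0 \<omega> = s0) \<and>
     (\<forall>n s. \<P>(\<omega> in M. \<forall>i\<le>n. X i \<omega> = s i) > 0 \<longrightarrow>
        \<P>(\<omega> in M. X (Suc n) \<omega> = s (Suc n) \<bar> \<forall>i\<le>n. X i \<omega> = s i) = pmf (K (s n)) (s (Suc n)))"

definition attachment_deletion_process ::
  "'a measure \<Rightarrow> real \<Rightarrow> real \<Rightarrow> (nat \<Rightarrow> 'a \<Rightarrow> graph) \<Rightarrow> bool" where
  "attachment_deletion_process M \<pi> \<delta> G \<longleftrightarrow> markov_chain M (step \<pi> \<delta>) initial_graph G"

definition deg_count :: "nat \<Rightarrow> graph \<Rightarrow> nat" where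
  "deg_count k G = card {v \<in> pverts G. indeg G v = k}"

definition deg_frac :: "nat \<Rightarrow> graph \<Rightarrow> real" where
  "deg_frac k G = real (deg_count k G) / real (num_verts G)"

lemma new_vertex_notin:
  assumes "finite (pverts G)"
  shows "new_vertex G \<notin> pverts G"
  unfolding new_vertex_def by (rule LeastI_ex) (use assms ex_new_if_finite in blast)

lemma sum_indeg:
  assumes "pair_fin_digraph G"
  shows "(\<Sum>u\<in>pverts G. indeg G u) = num_edges G"
proof -
  interpret pair_fin_digraph G by fact
  have "(\<Sum>u\<in>pverts G. indeg G u) = card (\<Union>u\<in>pverts G. in_arcs (with_proj G) u)"
    unfolding in_degree_def
    by (rule card_UN_disjoint[symmetric])
       (auto simp: in_arcs_def pair_finite_verts intro: finite_subset[OF _ pair_finite_arcs])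
  also have "(\<Union>u\<in>pverts G. in_arcs (with_proj G) u) = parcs G"
    by (auto simp: in_arcs_def dest: arc_snd_in_verts)
  finally show ?thesis .
qed

lemma pmf_target_pmf:
  assumes G: "pair_fin_digraph G" and "\<delta> > 0"
  shows "pmf (target_pmf \<delta> G) u = target_weight \<delta> G u"
proof -
  interpret pair_fin_digraph G by fact
  let ?w = "new_vertex G" and ?V = "pverts G"
  let ?D = "real (num_edges G) + \<delta> * real (num_verts G) + \<delta>"
  have D: "?D > 0"
    using \<open>\<delta> > 0\<close> by (simp add: add_nonneg_pos)
  have nonneg: "target_weight \<delta> G x \<ge> 0" for x
    unfolding target_weight_def using D \<open>\<delta> > 0\<close> by auto
  have w: "?w \<notin> ?V"
    by (rule new_vertex_notin[OF pair_finite_verts])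
  have "(\<Sum>x\<in>?V. target_weight \<delta> G x) = (\<Sum>x\<in>?V. (real (indeg G x) + \<delta>) / ?D)"
    by (intro sum.cong) (auto simp: target_weight_def)
  also have "\<dots> = (real (\<Sum>x\<in>?V. indeg G x) + \<delta> * real (num_verts G)) / ?D"
    by (simp add: sum_divide_distrib[symmetric] sum.distrib mult.commute)
  finally have "(\<Sum>x\<in>insert ?w ?V. target_weight \<delta> G x) =
      \<delta> / ?D + (real (num_edges G) + \<delta> * real (num_verts G)) / ?D"
    using w by (simp add: pair_finite_verts target_weight_def[of _ _ ?w] sum_indeg[OF G])
  also have "\<dots> = 1"
    using D by (simp add: add_divide_distrib[symmetric])
  finally have sum: "(\<Sum>x\<in>insert ?w ?V. target_weight \<delta> G x) = 1" .
  have "(\<integral>\<^sup>+x. ennreal (target_weight \<delta> G x) \<partial>count_space UNIV) =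
      (\<Sum>x\<in>insert ?w ?V. ennreal (target_weight \<delta> G x))"
    by (rule nn_integral_count_space'[where A = "insert ?w ?V"])
       (auto simp: pair_finite_verts target_weight_def)
  also have "\<dots> = 1"
    by (subst sum_ennreal) (simp_all only: nonneg sum ennreal_1)
  finally show ?thesis
    unfolding target_pmf_def by (intro pmf_embed_pmf nonneg)
qed

end

theory Submission
  imports Defs
begin

text \<open>
  Everything concerns the law of \<open>G n\<close> at a single time, which is an explicit finitely supported pmf.
  For a function \<open>f\<close> of the degree, let \<open>S f\<close> be the sum of \<open>f\<close> over the in-degrees of all vertices. Up to
  the fluctuations of the number of vertices, which performs a random walk reflected when no edge is
  left, one step of the chain changes the mean of \<open>S f\<close> to that of \<open>S (f + Q f / n)\<close> plus
  \<open>\<pi> * f 0\<close>, where \<open>Q\<close> generates a linear birth-death process on the degrees. The limit \<open>p\<close> is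
  the stationary law of this process restarted from 0 at rate one, so that \<open>\<pi> * n * p f\<close> obeys the same
  recursion without error. As \<open>f \<mapsto> f + Q f / n\<close> contracts the sup norm on degrees of order \<open>n\<close>
  (beyond them \<open>f\<close> is frozen and its decay controls the error), the difference between \<open>S f\<close> and
  \<open>\<pi> * n * p f\<close> is controlled by induction on the time, simultaneously for all \<open>f\<close>: its
  mean for the rate of convergence, and its exponential moments, through Hoeffding's lemma, for the
  concentration.
\<close>

subsection \<open>Markov chains and their one-time laws\<close>

text \<open>Each step, addition or deletion, raises \<open>2 * num_verts - num_edges\<close> by
  exactly one. So the number of vertices alone fixes both random denominators of the model, and the
  single walk \<open>dev\<close> carries all their fluctuations. Replacing \<open>num_verts\<close>
  by \<open>\<pi> * n\<close> turns them into multiples \<open>2 * \<pi> - 1\<close> and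
  \<open>2 * \<pi> - 1 + \<delta> * \<pi>\<close> of \<open>n\<close>, which is where the
  coefficients of the recursion come from.

  Test functions are therefore required to satisfy \<open>\<bar>f k\<bar> \<le> A / (k + 1)\<close>,
  and carrying such a function back from time \<open>n\<close> to time \<open>m\<close> inflates
  \<open>A\<close> by about \<open>(n / m) ^ B\<close>, where \<open>B\<close> is an integer above
  the death coefficient. Going back to a bounded time would be too costly. The induction starts
  instead at a time \<open>m\<close> where the trivial bound \<open>4 * m\<close> on the excess is
  affordable: a power of \<open>n\<close> below one for the mean, a small fraction of
  \<open>n\<close> for the concentration.\<close>

primrec chain_law :: "('s \<Rightarrow> 's pmf) \<Rightarrow> 's \<Rightarrow> nat \<Rightarrow> 's pmf" where
  "chain_law K s 0 = return_pmf s"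
| "chain_law K s (Suc n) = chain_law K s n \<bind> K"

text \<open>Paths are lists with the most recent state first.\<close>

primrec path_law :: "('s \<Rightarrow> 's pmf) \<Rightarrow> 's \<Rightarrow> nat \<Rightarrow> 's list pmf" where
  "path_law K s 0 = return_pmf [s]"
| "path_law K s (Suc n) = path_law K s n \<bind> (\<lambda>l. map_pmf (\<lambda>x. x # l) (K (hd l)))"

lemma map_hd_path_law: "map_pmf hd (path_law K s n) = chain_law K s n"
proof (induction n)
  case (Suc n)
  have "map_pmf hd (path_law K s (Suc n)) = path_law K s n \<bind> (\<lambda>l. K (hd l))"
    by (simp add: map_bind_pmf pmf.map_comp o_def pmf.map_ident)
  also have "\<dots> = map_pmf hd (path_law K s n) \<bind> K"
    by (simp add: bind_map_pmf)
  finally show ?case using Suc by simp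
qed simp

lemma length_path_law: "l \<in> set_pmf (path_law K s n) \<Longrightarrow> length l = Suc n"
  by (induction n arbitrary: l) auto

lemma pmf_path_law_Suc:
  "pmf (path_law K s (Suc n)) (x # l) = pmf (path_law K s n) l * pmf (K (hd l)) x"
proof -
  have *: "pmf (map_pmf (\<lambda>x. x # l') (K (hd l'))) (x # l) = indicator {l} l' * pmf (K (hd l)) x" for l'
  proof (cases "l' = l")
    case True
    then show ?thesis
      using pmf_map_inj'[of "\<lambda>x. x # l" "K (hd l)" x] by (simp add: inj_def)
  next
    case False
    then have "x # l \<notin> set_pmf (map_pmf (\<lambda>x. x # l') (K (hd l')))" by auto
    with False show ?thesis by (simp add: pmf_eq_0_set_pmf)
  qed
  have "pmf (path_law K s (Suc n)) (x # l)
      = (\<integral>l'. indicator {l} l' * pmf (K (hd l)) x \<partial>path_law K s n)"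
    by (simp only: path_law.simps pmf_bind *)
  also have "\<dots> = pmf (path_law K s n) l * pmf (K (hd l)) x"
    by (simp add: measure_pmf_single)
  finally show ?thesis .
qed

text \<open>The chain is defined by conditioning on the whole past, so laws of paths have to be
  found before laws of single states. Induction on the length; if the past has probability zero the
  conditional probability is unknown, but both sides vanish.\<close>

lemma markov_chain_path_prob:
  assumes X: "markov_chain M K s0 X" and l: "length l = Suc n"
  shows "measure M {\<omega> \<in> space M. \<forall>i\<le>n. X i \<omega> = rev l ! i} = pmf (path_law K s0 n) l"
  using l
proof (induction n arbitrary: l)
  case 0
  interpret prob_space M using X by (simp add: markov_chain_def)
  have [measurable]: "X 0 \<in> measurable M (count_space UNIV)" and ae: "AE \<omega> in M. X 0 \<omega> = s0"
    using X by (simp_all add: markov_chain_def)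
  from 0 obtain x where l: "l = [x]" by (auto simp: length_Suc_conv)
  show ?case
  proof (cases "x = s0")
    case True
    have "prob {\<omega> \<in> space M. X 0 \<omega> = s0} = 1"
      using ae by (subst prob_Collect_eq_1) auto
    with l True show ?thesis by simp
  next
    case False
    have "prob {\<omega> \<in> space M. X 0 \<omega> = x} = 0"
      using ae False by (subst prob_Collect_eq_0) (auto elim!: eventually_mono)
    with l False show ?thesis by (simp add: indicator_def)
  qed
next
  case (Suc n)
  interpret prob_space M using X by (simp add: markov_chain_def)
  have [measurable]: "X i \<in> measurable M (count_space UNIV)" for i
    using X by (simp add: markov_chain_def)
  from Suc.prems obtain x l' where l: "l = x # l'" and l': "length l' = Suc n"
    by (auto simp: length_Suc_conv)
  define t where "t i = (rev l' @ [x]) ! i" for i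
  have t: "t i = rev l' ! i" if "i \<le> n" for i
    using that l' by (simp add: t_def nth_append)
  have tS: "t (Suc n) = x" using l' by (simp add: t_def nth_append)
  have tn: "t n = hd l'" using l' t[of n]
    by (cases l') (auto simp: nth_append)
  let ?A = "{\<omega> \<in> space M. \<forall>i\<le>n. X i \<omega> = t i}"
  let ?B = "{\<omega> \<in> space M. X (Suc n) \<omega> = t (Suc n) \<and> (\<forall>i\<le>n. X i \<omega> = t i)}"
  have eq: "{\<omega> \<in> space M. \<forall>i\<le>Suc n. X i \<omega> = rev l ! i} = ?B"
    by (auto simp: l t_def le_Suc_eq)
  have A: "prob ?A = pmf (path_law K s0 n) l'"
    using Suc.IH[OF l'] by (simp add: t cong: conj_cong imp_cong)
  have "prob ?B = prob ?A * pmf (K (t n)) (t (Suc n))"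
  proof (cases "prob ?A > 0")
    case True
    then have "cond_prob M (\<lambda>\<omega>. X (Suc n) \<omega> = t (Suc n)) (\<lambda>\<omega>. \<forall>i\<le>n. X i \<omega> = t i)
        = pmf (K (t n)) (t (Suc n))"
      using X unfolding markov_chain_def by blast
    with True show ?thesis by (simp add: cond_prob_def field_simps)
  next
    case False
    then have "prob ?A = 0" by (simp add: zero_less_measure_iff)
    moreover have "prob ?B \<le> prob ?A" by (intro finite_measure_mono) auto
    ultimately show ?thesis by (simp add: measure_le_0_iff)
  qed
  with A show ?case
    unfolding eq by (simp add: l pmf_path_law_Suc tS tn del: path_law.simps)
qed

text \<open>\<open>path_law\<close> has countable support and total mass one, so the disjoint events
  of following one of its paths cover the space almost surely, and an event about \<open>X n\<close>
  splits along them. No countability of the state type is involved.\<close>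

lemma markov_chain_distr:
  assumes X: "markov_chain M K s0 X"
  shows "distr M (count_space UNIV) (X n) = measure_pmf (chain_law K s0 n)"
proof -
  interpret prob_space M using X by (simp add: markov_chain_def)
  have [measurable]: "X i \<in> measurable M (count_space UNIV)" for i
    using X by (simp add: markov_chain_def)
  let ?T = "path_law K s0 n"
  define E where "E l = {\<omega> \<in> space M. \<forall>i\<le>n. X i \<omega> = rev l ! i}" for l
  have E[measurable]: "E l \<in> sets M" for l unfolding E_def by measurable
  have disj: "disjoint_family_on E (set_pmf ?T)"
    unfolding disjoint_family_on_def
  proof (intro ballI impI)
    fix l l' assume l: "l \<in> set_pmf ?T" "l' \<in> set_pmf ?T" "l \<noteq> l'"
    then have "rev l \<noteq> rev l'" "length (rev l) = Suc n" "length (rev l') = Suc n"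
      by (auto dest: length_path_law)
    then obtain i where "i \<le> n" "rev l ! i \<noteq> rev l' ! i"
      by (metis less_Suc_eq_le nth_equalityI)
    then show "E l \<inter> E l' = {}" by (auto simp: E_def)
  qed
  have hd: "X n \<omega> = hd l" if "\<omega> \<in> E l" "l \<in> set_pmf ?T" for \<omega> l
    using that length_path_law[OF that(2)] by (cases l) (auto simp: E_def nth_append)
  have cnt: "emeasure M (\<Union>l\<in>S. E l) = emeasure ?T S" if S: "S \<subseteq> set_pmf ?T" for S
  proof -
    have S': "countable S" using S countable_set_pmf countable_subset by blast
    have "emeasure M (\<Union>l\<in>S. E l) = (\<integral>\<^sup>+l. emeasure M (E l) \<partial>count_space S)"
      using S' disj S by (intro emeasure_UN_countable) (auto intro: disjoint_family_on_mono)
    also have "\<dots> = (\<integral>\<^sup>+l. ennreal (pmf ?T l) \<partial>count_space S)"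
      using S by (intro nn_integral_cong)
        (auto simp: emeasure_eq_measure E_def markov_chain_path_prob[OF X length_path_law] subsetD)
    also have "\<dots> = emeasure ?T S" by (rule nn_integral_pmf)
    finally show ?thesis .
  qed
  have "emeasure M (X n -` A \<inter> space M) = emeasure (chain_law K s0 n) A" for A
  proof -
    let ?S = "set_pmf ?T"
    let ?U = "\<Union>l\<in>?S. E l"
    have U[measurable]: "?U \<in> sets M" by (intro sets.countable_UN') auto
    have "emeasure M ?U = 1"
      using cnt[of ?S] by (simp add: emeasure_pmf)
    then have AE: "AE \<omega> in M. \<omega> \<in> ?U"
      by (subst AE_in_set_eq_1) (auto simp: emeasure_eq_measure)
    have eq: "(X n -` A \<inter> space M) \<inter> ?U = (\<Union>l\<in>?S \<inter> {l. hd l \<in> A}. E l)"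
      using hd by (auto simp: E_def)
    have "emeasure M (X n -` A \<inter> space M) = emeasure M ((X n -` A \<inter> space M) \<inter> ?U)"
      using AE by (intro emeasure_eq_AE) (auto elim!: eventually_mono)
    also have "\<dots> = emeasure ?T (?S \<inter> {l. hd l \<in> A})" unfolding eq by (rule cnt) auto
    also have "\<dots> = emeasure ?T (hd -` A)"
      by (rule emeasure_eq_AE) (auto simp: AE_measure_pmf_iff)
    also have "\<dots> = emeasure (chain_law K s0 n) A"
      by (simp add: map_hd_path_law[symmetric])
    finally show ?thesis .
  qed
  then show ?thesis by (intro measure_eqI) (auto simp: emeasure_distr)
qed

lemma markov_chain_expectation:
  fixes f :: "'s \<Rightarrow> real"
  assumes X: "markov_chain M K s0 X"
  shows "prob_space.expectation M (\<lambda>\<omega>. f (X n \<omega>)) = measure_pmf.expectation (chain_law K s0 n) f"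
  using X by (simp add: markov_chain_distr[OF X, symmetric] integral_distr markov_chain_def)

lemma markov_chain_prob:
  assumes X: "markov_chain M K s0 X"
  shows "\<P>(\<omega> in M. P (X n \<omega>)) = measure_pmf.prob (chain_law K s0 n) {s. P s}"
proof -
  have "X n \<in> measurable M (count_space UNIV)" using X by (simp add: markov_chain_def)
  then have "measure (distr M (count_space UNIV) (X n)) {s. P s} = \<P>(\<omega> in M. P (X n \<omega>))"
    by (subst measure_distr) (auto intro!: arg_cong[where f = "measure M"])
  then show ?thesis by (simp add: markov_chain_distr[OF X])
qed

lemma expectation_bind_pmf_finite:
  fixes f :: "'b \<Rightarrow> real"
  assumes "finite (set_pmf p)" "\<And>x. x \<in> set_pmf p \<Longrightarrow> finite (set_pmf (K x))"
  shows "measure_pmf.expectation (p \<bind> K) f =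
    measure_pmf.expectation p (\<lambda>x. measure_pmf.expectation (K x) f)"
proof -
  have "measure_pmf.expectation (p \<bind> K) f =
      (\<Sum>a\<in>set_pmf p. pmf p a *\<^sub>R measure_pmf.expectation (K a) f)"
    using assms by (intro pmf_expectation_bind) auto
  also have "\<dots> = measure_pmf.expectation p (\<lambda>x. measure_pmf.expectation (K x) f)"
    using assms by (subst integral_measure_pmf[of "set_pmf p"]) auto
  finally show ?thesis .
qed

subsection \<open>Degrees and the law of the graph\<close>

text \<open>The \<open>S f\<close> of the overview. A constant \<open>f\<close>, \<open>real\<close>
  and an indicator give the numbers of vertices, of edges and of vertices of one degree.\<close>

definition deg_sum :: "(nat \<Rightarrow> real) \<Rightarrow> graph \<Rightarrow> real" where
  "deg_sum f G = (\<Sum>u\<in>pverts G. f (indeg G u))"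

lemma deg_sum_add: "deg_sum (\<lambda>k. f k + g k) G = deg_sum f G + deg_sum g G"
  by (simp add: deg_sum_def sum.distrib)

lemma deg_sum_diff: "deg_sum (\<lambda>k. f k - g k) G = deg_sum f G - deg_sum g G"
  by (simp add: deg_sum_def sum_subtractf)

lemma deg_sum_cmult: "deg_sum (\<lambda>k. c * f k) G = c * deg_sum f G"
  by (simp add: deg_sum_def sum_distrib_left)

lemma deg_sum_const: "deg_sum (\<lambda>k. c) G = c * num_verts G"
  by (simp add: deg_sum_def)

lemma deg_sum_mono: "(\<And>k. f k \<le> g k) \<Longrightarrow> deg_sum f G \<le> deg_sum g G"
  by (simp add: deg_sum_def sum_mono)

lemma abs_deg_sum_le: "\<bar>deg_sum f G\<bar> \<le> deg_sum (\<lambda>k. \<bar>f k\<bar>) G"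
  by (simp add: deg_sum_def sum_abs)

lemma deg_sum_of_nat: "pair_fin_digraph G \<Longrightarrow> deg_sum real G = num_edges G"
  by (simp add: deg_sum_def sum_indeg[symmetric])

lemma deg_sum_indicator: "pair_fin_digraph G \<Longrightarrow> deg_sum (indicator {k}) G = deg_count k G"
  by (simp add: deg_sum_def deg_count_def indicator_def pair_fin_digraph.pair_finite_verts
      sum.If_cases Int_def)

section \<open>Effect of one addition or deletion on the degrees\<close>

lemma pverts_attach: "pverts (attach G u) = insert (new_vertex G) (pverts G)"
  by (simp add: attach_def)

lemma pverts_remove_edge: "pverts (remove_edge G e) = pverts G"
  by (simp add: remove_edge_def)

lemma indeg_eq: "indeg G u = card {e \<in> parcs G. snd e = u}"
  by (simp add: in_degree_def in_arcs_def)

lemma indeg_new_vertex: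
  assumes "pair_fin_digraph G"
  shows "indeg G (new_vertex G) = 0"
proof -
  interpret pair_fin_digraph G by fact
  have "{e \<in> parcs G. snd e = new_vertex G} = {}"
    using new_vertex_notin[OF pair_finite_verts] arc_snd_in_verts by fastforce
  then show ?thesis by (simp add: indeg_eq)
qed

lemma new_vertex_arc_notin:
  assumes "pair_fin_digraph G"
  shows "(new_vertex G, u) \<notin> parcs G"
proof -
  interpret pair_fin_digraph G by fact
  show ?thesis using new_vertex_notin[OF pair_finite_verts] arc_fst_in_verts by fastforce
qed

lemma indeg_attach:
  assumes "pair_fin_digraph G"
  shows "indeg (attach G u) x = indeg G x + (if x = u then 1 else 0)"
proof -
  interpret pair_fin_digraph G by fact
  have "{e \<in> parcs (attach G u). snd e = x} =
      (if x = u then insert (new_vertex G, u) {e \<in> parcs G. snd e = x} else {e \<in> parcs G. snd e = x})"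
    by (auto simp: attach_def)
  then show ?thesis
    using new_vertex_arc_notin[OF assms, of u] by (simp add: indeg_eq pair_finite_arcs)
qed

text \<open>The truncated subtraction is exact, since the head of an existing edge has in-degree at
  least one.\<close>

lemma indeg_remove_edge:
  assumes "pair_fin_digraph G" "e \<in> parcs G"
  shows "indeg (remove_edge G e) x = indeg G x - (if x = snd e then 1 else 0)"
proof -
  interpret pair_fin_digraph G by fact
  have "{e' \<in> parcs (remove_edge G e). snd e' = x} =
      (if x = snd e then {e \<in> parcs G. snd e = x} - {e} else {e \<in> parcs G. snd e = x})"
    by (auto simp: remove_edge_def)
  then show ?thesis
    using assms(2) by (simp add: indeg_eq pair_finite_arcs)
qed

lemma attach_pair_fin_digraph:
  assumes "pair_fin_digraph G" "u \<in> insert (new_vertex G) (pverts G)"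
  shows "pair_fin_digraph (attach G u)"
proof -
  interpret pair_fin_digraph G by fact
  show ?thesis
    using assms(2) by unfold_locales
      (auto simp: attach_def pair_finite_verts pair_finite_arcs dest: in_arcsD1 in_arcsD2)
qed

lemma remove_edge_pair_fin_digraph:
  assumes "pair_fin_digraph G"
  shows "pair_fin_digraph (remove_edge G e)"
proof -
  interpret pair_fin_digraph G by fact
  show ?thesis
    by unfold_locales
      (auto simp: remove_edge_def pair_finite_verts pair_finite_arcs dest: in_arcsD1 in_arcsD2)
qed

lemma num_attach:
  assumes "pair_fin_digraph G"
  shows "num_verts (attach G u) = Suc (num_verts G)" "num_edges (attach G u) = Suc (num_edges G)"
proof -
  interpret pair_fin_digraph G by fact
  show "num_verts (attach G u) = Suc (num_verts G)" "num_edges (attach G u) = Suc (num_edges G)"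
    using new_vertex_notin[OF pair_finite_verts] new_vertex_arc_notin[OF assms, of u]
    by (simp_all add: attach_def pair_finite_verts pair_finite_arcs)
qed

lemma num_remove_edge:
  assumes "pair_fin_digraph G" "e \<in> parcs G"
  shows "num_verts (remove_edge G e) = num_verts G" "Suc (num_edges (remove_edge G e)) = num_edges G"
proof -
  interpret pair_fin_digraph G by fact
  show "num_verts (remove_edge G e) = num_verts G" "Suc (num_edges (remove_edge G e)) = num_edges G"
    using assms(2) by (simp_all add: remove_edge_def card.remove[OF pair_finite_arcs] del: card_Diff_insert)
qed

text \<open>The new vertex enters with in-degree 0 and contributes \<open>f 0\<close>; its edge then
  raises the degree of \<open>u\<close>. The formula covers the loop as well, because the new vertex
  has \<open>indeg\<close> 0 already in \<open>G\<close>.\<close>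

lemma deg_sum_attach:
  assumes "pair_fin_digraph G" "u \<in> insert (new_vertex G) (pverts G)"
  shows "deg_sum f (attach G u) = deg_sum f G + f 0 + (f (Suc (indeg G u)) - f (indeg G u))"
proof -
  interpret pair_fin_digraph G by fact
  let ?w = "new_vertex G"
  have "deg_sum f (attach G u) =
      (\<Sum>x\<in>insert ?w (pverts G). f (indeg G x) + (if x = u then f (Suc (indeg G u)) - f (indeg G u) else 0))"
    unfolding deg_sum_def by (intro sum.cong) (auto simp: pverts_attach indeg_attach[OF assms(1)])
  also have "\<dots> = (\<Sum>x\<in>insert ?w (pverts G). f (indeg G x)) + (f (Suc (indeg G u)) - f (indeg G u))"
    using assms(2) by (subst sum.distrib, subst sum.delta) (auto simp: pair_finite_verts)
  also have "(\<Sum>x\<in>insert ?w (pverts G). f (indeg G x)) = f 0 + deg_sum f G"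
    using new_vertex_notin[OF pair_finite_verts]
    by (simp add: pair_finite_verts deg_sum_def indeg_new_vertex[OF assms(1)])
  finally show ?thesis by simp
qed

lemma deg_sum_remove_edge:
  assumes "pair_fin_digraph G" "e \<in> parcs G"
  shows "deg_sum f (remove_edge G e) =
    deg_sum f G + (f (indeg G (snd e) - 1) - f (indeg G (snd e)))"
proof -
  interpret pair_fin_digraph G by fact
  let ?u = "snd e"
  have "deg_sum f (remove_edge G e) =
      (\<Sum>x\<in>pverts G. f (indeg G x) + (if x = ?u then f (indeg G ?u - 1) - f (indeg G ?u) else 0))"
    unfolding deg_sum_def by (intro sum.cong) (auto simp: pverts_remove_edge indeg_remove_edge[OF assms])
  also have "\<dots> = deg_sum f G + (f (indeg G ?u - 1) - f (indeg G ?u))"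
    using arc_snd_in_verts[OF assms(2)]
    by (subst sum.distrib, subst sum.delta) (auto simp: pair_finite_verts deg_sum_def)
  finally show ?thesis .
qed

text \<open>A uniformly chosen edge has its head at a vertex with probability proportional to the
  in-degree: the source of the linear death rate.\<close>

lemma sum_arcs_by_head:
  fixes h :: "nat \<Rightarrow> real"
  assumes "pair_fin_digraph G"
  shows "(\<Sum>e\<in>parcs G. h (snd e)) = (\<Sum>u\<in>pverts G. real (indeg G u) * h u)"
proof -
  interpret pair_fin_digraph G by fact
  have "(\<Sum>e\<in>parcs G. h (snd e)) = (\<Sum>u\<in>pverts G. \<Sum>e | e \<in> parcs G \<and> snd e = u. h (snd e))"
    using in_arcsD2
    by (intro sum.group[symmetric]) (auto simp: pair_finite_verts pair_finite_arcs)
  also have "\<dots> = (\<Sum>u\<in>pverts G. real (indeg G u) * h u)"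
    by (intro sum.cong) (simp_all add: indeg_eq)
  finally show ?thesis .
qed

section \<open>Expectations over one step of the chain\<close>

locale attachment_deletion =
  fixes \<pi> \<delta> :: real
  assumes pi_gt_half: "1 / 2 < \<pi>" and pi_less_one: "\<pi> < 1" and delta_pos: "\<delta> > 0"
begin

definition total_weight :: "graph \<Rightarrow> real" where
  "total_weight G = real (num_edges G) + \<delta> * real (num_verts G) + \<delta>"

lemma total_weight_pos: "total_weight G > 0"
  using delta_pos by (simp add: total_weight_def add_nonneg_pos)

lemma set_target_pmf:
  assumes "pair_fin_digraph G"
  shows "set_pmf (target_pmf \<delta> G) \<subseteq> insert (new_vertex G) (pverts G)"
  using pmf_target_pmf[OF assms delta_pos] by (auto simp: set_pmf_eq target_weight_def)

text \<open>The summand \<open>\<delta> * h 0\<close> is the loop at the new vertex, which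
  \<open>deg_sum\<close> over the old vertices does not see. Later it is estimated as an error
  term.\<close>

lemma expectation_target_pmf:
  assumes "pair_fin_digraph G"
  shows "measure_pmf.expectation (target_pmf \<delta> G) (\<lambda>u. c + h (indeg G u)) =
    c + (deg_sum (\<lambda>k. (real k + \<delta>) * h k) G + \<delta> * h 0) / total_weight G"
proof -
  interpret pair_fin_digraph G by fact
  let ?w = "new_vertex G" and ?T = "target_pmf \<delta> G"
  have fin: "finite (set_pmf ?T)"
    using set_target_pmf[OF assms] by (rule finite_subset) (simp add: pair_finite_verts)
  have "measure_pmf.expectation ?T (\<lambda>u. c + h (indeg G u)) =
      c + measure_pmf.expectation ?T (\<lambda>u. h (indeg G u))"
    by (subst Bochner_Integration.integral_add) (auto intro: integrable_measure_pmf_finite fin)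
  also have "measure_pmf.expectation ?T (\<lambda>u. h (indeg G u)) =
      (\<Sum>u\<in>insert ?w (pverts G). h (indeg G u) * target_weight \<delta> G u)"
    using set_target_pmf[OF assms]
    by (subst integral_measure_pmf_real[of "insert ?w (pverts G)"])
      (auto simp: pair_finite_verts pmf_target_pmf[OF assms delta_pos])
  also have "\<dots> = h 0 * \<delta> / total_weight G +
      (\<Sum>u\<in>pverts G. (real (indeg G u) + \<delta>) * h (indeg G u) / total_weight G)"
    using new_vertex_notin[OF pair_finite_verts]
    by (simp add: pair_finite_verts indeg_new_vertex[OF assms] target_weight_def total_weight_def mult.commute)
  also have "\<dots> = (deg_sum (\<lambda>k. (real k + \<delta>) * h k) G + \<delta> * h 0) / total_weight G"
    by (simp add: deg_sum_def sum_divide_distrib add_divide_distrib mult.commute)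
  finally show ?thesis .
qed

lemma set_step:
  assumes "pair_fin_digraph G"
  shows "set_pmf (step \<pi> \<delta> G) \<subseteq> attach G ` insert (new_vertex G) (pverts G) \<union> remove_edge G ` parcs G"
proof -
  interpret pair_fin_digraph G by fact
  have T: "u = new_vertex G \<or> u \<in> pverts G" if "u \<in> set_pmf (target_pmf \<delta> G)" for u
    using set_target_pmf[OF assms] that by auto
  show ?thesis
  proof (cases "num_edges G > 0")
    case True
    then have "parcs G \<noteq> {}" by auto
    then have "set_pmf (pmf_of_set (parcs G)) = parcs G" by (simp add: pair_finite_arcs)
    with True show ?thesis
      by (auto simp: step_def split: if_splits dest!: T)
  next
    case False
    \<comment> \<open>Without edges \<open>pmf_of_set (parcs G)\<close> is a choice from the empty
      set and carries no information, so the deletion branch must be removed by showing that the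
      coin is deterministic.\<close>
    then have "bernoulli_pmf (if num_edges G > 0 then \<pi> else 1) = return_pmf True"
      by (intro pmf_eqI) (simp split: bool.splits add: indicator_def pmf_bernoulli_True)
    with False show ?thesis
      by (auto simp: step_def bind_return_pmf dest!: T)
  qed
qed

lemma finite_set_step:
  assumes "pair_fin_digraph G"
  shows "finite (set_pmf (step \<pi> \<delta> G))"
proof -
  interpret pair_fin_digraph G by fact
  show ?thesis
    by (rule finite_subset[OF set_step[OF assms]]) (simp add: pair_finite_verts pair_finite_arcs)
qed

lemma step_cases [consumes 2, case_names attach remove]:
  assumes "pair_fin_digraph G" "G' \<in> set_pmf (step \<pi> \<delta> G)"
  obtains u where "u \<in> insert (new_vertex G) (pverts G)" "G' = attach G u"
    | e where "e \<in> parcs G" "G' = remove_edge G e"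
  using set_step[OF assms(1)] assms(2) by blast

lemma expectation_step:
  fixes h :: "graph \<Rightarrow> real"
  assumes "pair_fin_digraph G"
  shows "measure_pmf.expectation (step \<pi> \<delta> G) h =
    (if num_edges G > 0
     then \<pi> * measure_pmf.expectation (target_pmf \<delta> G) (\<lambda>u. h (attach G u))
       + (1 - \<pi>) * ((\<Sum>e\<in>parcs G. h (remove_edge G e)) / num_edges G)
     else measure_pmf.expectation (target_pmf \<delta> G) (\<lambda>u. h (attach G u)))"
proof -
  interpret pair_fin_digraph G by fact
  have fin: "finite (set_pmf (target_pmf \<delta> G))"
    using set_target_pmf[OF assms] by (rule finite_subset) (simp add: pair_finite_verts)
  show ?thesis
  proof (cases "num_edges G > 0")
    case True
    then have ne: "parcs G \<noteq> {}" by auto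
    have fin': "finite (set_pmf (pmf_of_set (parcs G)))" using ne by (simp add: pair_finite_arcs)
    show ?thesis
      unfolding step_def using True ne pi_gt_half pi_less_one fin fin'
      by (subst expectation_bind_pmf_finite) (auto simp: integral_pmf_of_set pair_finite_arcs)
  next
    case False
    then have "bernoulli_pmf (if num_edges G > 0 then \<pi> else 1) = return_pmf True"
      by (intro pmf_eqI) (simp split: bool.splits add: indicator_def pmf_bernoulli_True)
    with False show ?thesis by (simp add: step_def bind_return_pmf)
  qed
qed

text \<open>\<open>P\<close> is the mean change caused by an addition, \<open>D\<close> the one
  caused by a deletion. Up to the loop term both are sums of differences of \<open>f\<close> with
  linear weights, over a random denominator; they are the future birth and death parts of
  \<open>Q\<close>.\<close>

lemma expectation_step_deg_sum:
  assumes "pair_fin_digraph G"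
  shows "measure_pmf.expectation (step \<pi> \<delta> G) (deg_sum f) =
    (let P = f 0 + (deg_sum (\<lambda>k. (real k + \<delta>) * (f (Suc k) - f k)) G + \<delta> * (f 1 - f 0)) / total_weight G;
         D = deg_sum (\<lambda>k. real k * (f (k - 1) - f k)) G / num_edges G
     in deg_sum f G + (if num_edges G > 0 then \<pi> * P + (1 - \<pi>) * D else P))"
proof -
  interpret pair_fin_digraph G by fact
  define P where "P = f 0 + (deg_sum (\<lambda>k. (real k + \<delta>) * (f (Suc k) - f k)) G + \<delta> * (f 1 - f 0)) / total_weight G"
  define D where "D = deg_sum (\<lambda>k. real k * (f (k - 1) - f k)) G / num_edges G"
  have "measure_pmf.expectation (target_pmf \<delta> G) (\<lambda>u. deg_sum f (attach G u)) =
      measure_pmf.expectation (target_pmf \<delta> G)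
        (\<lambda>u. (deg_sum f G + f 0) + (f (Suc (indeg G u)) - f (indeg G u)))"
    using set_target_pmf[OF assms]
    by (intro integral_cong_AE) (auto simp: AE_measure_pmf_iff deg_sum_attach[OF assms])
  also have "\<dots> = deg_sum f G + P"
    unfolding P_def by (subst expectation_target_pmf[OF assms]) simp
  finally have 1: "measure_pmf.expectation (target_pmf \<delta> G) (\<lambda>u. deg_sum f (attach G u)) = deg_sum f G + P" .
  have 2: "(\<Sum>e\<in>parcs G. deg_sum f (remove_edge G e)) / num_edges G = deg_sum f G + D"
    if "num_edges G > 0"
  proof -
    have "(\<Sum>e\<in>parcs G. deg_sum f (remove_edge G e)) =
        (\<Sum>e\<in>parcs G. deg_sum f G + (f (indeg G (snd e) - 1) - f (indeg G (snd e))))"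
      by (intro sum.cong) (auto simp: deg_sum_remove_edge[OF assms])
    also have "\<dots> = num_edges G * deg_sum f G + deg_sum (\<lambda>k. real k * (f (k - 1) - f k)) G"
      by (subst sum.distrib, subst sum_arcs_by_head[OF assms, where h = "\<lambda>u. f (indeg G u - 1) - f (indeg G u)"])
        (simp add: deg_sum_def)
    finally have "(\<Sum>e\<in>parcs G. deg_sum f (remove_edge G e)) / num_edges G =
        num_edges G * deg_sum f G / num_edges G + D"
      by (simp only: D_def add_divide_distrib)
    moreover have "real (num_edges G) \<noteq> 0" using that by linarith
    ultimately show ?thesis
      by (simp only: nonzero_mult_div_cancel_left not_False_eq_True)
  qed
  show ?thesis
    unfolding expectation_step[OF assms] P_def[symmetric] D_def[symmetric] Let_def 1
    using 2 by (auto simp: algebra_simps)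
qed

section \<open>The law at time n and the deterministic constraints on its support\<close>

definition law :: "nat \<Rightarrow> graph pmf" where
  "law = chain_law (step \<pi> \<delta>) initial_graph"

lemma law_0: "law 0 = return_pmf initial_graph"
  and law_Suc: "law (Suc n) = law n \<bind> step \<pi> \<delta>"
  by (simp_all add: law_def)

text \<open>After \<open>x\<close> additions and \<open>y\<close> deletions there are
  \<open>2 + x\<close> vertices and \<open>1 + x - y\<close> edges, with \<open>n = x + y\<close>;
  eliminating \<open>x\<close> and \<open>y\<close> gives the equation. The strict inequality bounds
  the mean degree by one.\<close>

definition admissible :: "nat \<Rightarrow> graph \<Rightarrow> bool" where
  "admissible n G \<longleftrightarrow> pair_fin_digraph G \<and> num_edges G + n + 3 = 2 * num_verts G \<and>
     num_edges G < num_verts G"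

lemma admissible_step:
  assumes "admissible n G" "G' \<in> set_pmf (step \<pi> \<delta> G)"
  shows "admissible (Suc n) G'"
proof -
  have G: "pair_fin_digraph G" using assms(1) by (simp add: admissible_def)
  show ?thesis
    using G assms(2)
  proof (cases rule: step_cases)
    case (attach u)
    then show ?thesis
      using assms(1) attach_pair_fin_digraph[OF G] num_attach[OF G, of u] by (auto simp: admissible_def)
  next
    case (remove e)
    then show ?thesis
      using assms(1) remove_edge_pair_fin_digraph[OF G, of e] num_remove_edge[OF G, of e]
      by (auto simp: admissible_def)
  qed
qed

lemma admissible_law: "G \<in> set_pmf (law n) \<Longrightarrow> admissible n G"
proof (induction n arbitrary: G)
  case 0
  then have "G = initial_graph" by (simp add: law_0)
  moreover have "pair_fin_digraph initial_graph"
    by unfold_locales (auto simp: initial_graph_def)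
  ultimately show ?case by (simp add: admissible_def) (simp add: initial_graph_def)
next
  case (Suc n)
  then show ?case by (auto simp: law_Suc intro: admissible_step)
qed

lemma finite_law: "finite (set_pmf (law n))"
proof (induction n)
  case (Suc n)
  then show ?case
    by (auto simp: law_Suc intro!: finite_set_step dest!: admissible_law simp: admissible_def)
qed (simp add: law_0)

lemma integrable_law [simp, intro]: "integrable (measure_pmf (law n)) (h :: graph \<Rightarrow> real)"
  by (intro integrable_measure_pmf_finite finite_law)

lemma expectation_law_Suc:
  fixes h :: "graph \<Rightarrow> real"
  shows "measure_pmf.expectation (law (Suc n)) h =
    measure_pmf.expectation (law n) (\<lambda>G. measure_pmf.expectation (step \<pi> \<delta> G) h)"
  unfolding law_Suc
  by (intro expectation_bind_pmf_finite finite_law finite_set_step) (auto dest: admissible_law simp: admissible_def)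

lemma expectation_law_mono:
  fixes h h' :: "graph \<Rightarrow> real"
  assumes "\<And>G. admissible n G \<Longrightarrow> h G \<le> h' G"
  shows "measure_pmf.expectation (law n) h \<le> measure_pmf.expectation (law n) h'"
  using assms admissible_law by (intro integral_mono_AE) (auto simp: AE_measure_pmf_iff)

end

subsection \<open>The restarted birth-death process\<close>

text \<open>A process on degrees with birth rate \<open>a * (k + \<delta>)\<close> and death rate
  \<open>b * k\<close>, restarted from 0 at rate one. \<open>a_less\<close> says that the mean grows
  more slowly than restarts occur, so the stationary law has a finite mean.\<close>

locale birth_death_renewal =
  fixes a b \<delta> :: real
  assumes a_pos: "a > 0" and b_pos: "b > 0" and delta_pos: "\<delta> > 0" and a_less: "a - b < 1"
begin

definition rate :: "nat \<Rightarrow> real" where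
  "rate k = a * (real k + \<delta>) + b * real k"

lemma rate_nonneg: "rate k \<ge> 0"
  using a_pos b_pos delta_pos by (simp add: rate_def)

text \<open>Iteration from zero towards the minimal nonnegative solution of the balance equations.
  Probabilistically, \<open>approx i k\<close> is the mean time spent in \<open>k\<close> during the
  first \<open>i\<close> sojourns after a restart; as restarts have rate one, the limit needs no
  normalisation.\<close>

primrec approx :: "nat \<Rightarrow> nat \<Rightarrow> real" where
  "approx 0 = (\<lambda>k. 0)"
| "approx (Suc i) = (\<lambda>k. ((if k = 0 then 1 else a * (real k - 1 + \<delta>) * approx i (k - 1))
     + b * (real k + 1) * approx i (k + 1)) / (1 + rate k))"

lemma birth_nonneg: "k \<noteq> 0 \<Longrightarrow> a * (real k - 1 + \<delta>) \<ge> 0"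
  using a_pos delta_pos by (cases k) auto

lemma death_nonneg: "b * (real k + 1) \<ge> 0"
  using b_pos by simp

declare approx.simps(2) [simp del]

lemma approx_Suc: "approx (Suc i) k * (1 + rate k) =
  (if k = 0 then 1 else a * (real k - 1 + \<delta>) * approx i (k - 1)) + b * (real k + 1) * approx i (k + 1)"
  using rate_nonneg[of k] by (simp add: approx.simps(2))

lemma approx_nonneg: "approx i k \<ge> 0"
proof (induction i arbitrary: k)
  case (Suc i)
  have "0 \<le> (if k = 0 then 1 else a * (real k - 1 + \<delta>) * approx i (k - 1))"
    using Suc birth_nonneg[of k] by simp
  moreover have "0 \<le> b * (real k + 1) * approx i (k + 1)"
    using Suc death_nonneg[of k] by simp
  ultimately show ?case using rate_nonneg[of k] by (simp add: approx.simps(2))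
qed simp

lemma approx_mono: "approx i k \<le> approx (Suc i) k"
proof (induction i arbitrary: k)
  case 0
  show ?case using approx_nonneg[of "Suc 0" k] by (simp only: approx.simps(1))
next
  case (Suc i)
  have "(if k = 0 then 1 else a * (real k - 1 + \<delta>) * approx i (k - 1)) \<le>
      (if k = 0 then 1 else a * (real k - 1 + \<delta>) * approx (Suc i) (k - 1))"
    using Suc[of "k - 1"] birth_nonneg[of k] by (cases "k = 0") (simp_all add: mult_left_mono)
  moreover have "b * (real k + 1) * approx i (k + 1) \<le> b * (real k + 1) * approx (Suc i) (k + 1)"
    using Suc[of "k + 1"] death_nonneg[of k] by (rule mult_left_mono)
  ultimately have "approx (Suc i) k * (1 + rate k) \<le> approx (Suc (Suc i)) k * (1 + rate k)"
    unfolding approx_Suc by (rule add_mono)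
  with rate_nonneg[of k] show ?case by simp
qed

lemma approx_eq_0: "i \<le> k \<Longrightarrow> approx i k = 0"
  by (induction i arbitrary: k) (auto simp: approx.simps(2))

text \<open>Summation by parts, moving the jumps onto the weight \<open>w\<close>. Since
  \<open>approx i\<close> vanishes from \<open>i\<close> on, the condition \<open>i \<le> n\<close>
  removes all boundary terms. The weights 1 and \<open>real\<close> give the mass and the
  mean.\<close>

lemma sum_approx:
  assumes "i \<le> n"
  shows "(\<Sum>k<Suc n. w k * approx (Suc i) k * (1 + rate k)) =
    w 0 + (\<Sum>k<Suc n. approx i k * (a * (real k + \<delta>) * w (Suc k) + b * real k * w (k - 1)))"
proof -
  have "(\<Sum>k<Suc n. w k * approx (Suc i) k * (1 + rate k)) =
      (\<Sum>k<Suc n. w k * (if k = 0 then 1 else a * (real k - 1 + \<delta>) * approx i (k - 1)))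
      + (\<Sum>k<Suc n. w k * (b * (real k + 1) * approx i (k + 1)))"
    by (simp only: sum.distrib[symmetric] distrib_left[symmetric] approx_Suc mult.assoc[of "w _"])
  also have "(\<Sum>k<Suc n. w k * (if k = 0 then 1 else a * (real k - 1 + \<delta>) * approx i (k - 1))) =
      w 0 + (\<Sum>k<n. approx i k * (a * (real k + \<delta>) * w (Suc k)))"
    by (subst sum.lessThan_Suc_shift) (simp add: mult_ac)
  also have "(\<Sum>k<n. approx i k * (a * (real k + \<delta>) * w (Suc k))) =
      (\<Sum>k<Suc n. approx i k * (a * (real k + \<delta>) * w (Suc k)))"
    using approx_eq_0[OF assms] by simp
  also have "(\<Sum>k<Suc n. w k * (b * (real k + 1) * approx i (k + 1))) =
      (\<Sum>k<n. w k * (b * (real k + 1) * approx i (Suc k)))"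
    using approx_eq_0[of i "Suc n"] assms by simp
  also have "\<dots> = (\<Sum>k<Suc n. approx i k * (b * real k * w (k - 1)))"
    by (subst sum.lessThan_Suc_shift) (simp add: mult_ac add_ac)
  finally show ?thesis
    by (simp add: sum.distrib distrib_left add_ac del: sum.lessThan_Suc)
qed

text \<open>With weight 1, monotonicity in \<open>i\<close> bounds the sum of
  \<open>approx * rate\<close> on the right by the one on the left, and these finite sums
  cancel.\<close>

lemma sum_approx_le_1: "(\<Sum>k<n. approx i k) \<le> 1"
proof (cases i)
  case (Suc i')
  let ?N = "Suc (max n i)"
  have "(\<Sum>k<?N. approx i k * (1 + rate k)) = 1 + (\<Sum>k<?N. approx i' k * rate k)"
    using sum_approx[of i' "max n i" "\<lambda>_. 1"] Suc by (simp add: rate_def del: approx.simps sum.lessThan_Suc)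
  also have "\<dots> \<le> 1 + (\<Sum>k<?N. approx i k * rate k)"
    using approx_mono[of i'] rate_nonneg by (auto simp: Suc simp del: approx.simps sum.lessThan_Suc intro!: sum_mono mult_right_mono)
  finally have "(\<Sum>k<?N. approx i k) \<le> 1"
    by (simp add: distrib_left sum.distrib del: sum.lessThan_Suc approx.simps)
  moreover have "(\<Sum>k<n. approx i k) \<le> (\<Sum>k<?N. approx i k)"
    using approx_nonneg by (intro sum_mono2) auto
  ultimately show ?thesis by linarith
qed simp

text \<open>The fixed point of \<open>x \<mapsto> max 0 (a - b) * x + a * \<delta>\<close>, the map
  that bounds the mean after one more iteration. The maximum keeps this map monotone if
  \<open>a < b\<close>.\<close>

definition mean_bound :: real where
  "mean_bound = a * \<delta> / (1 - max 0 (a - b))"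

text \<open>With weight \<open>real\<close> the quadratic terms \<open>k * rate k\<close> cancel by
  monotonicity as for the mass; what is left is the drift
  \<open>(a - b) * k + a * \<delta>\<close>.\<close>

lemma sum_approx_mean_le: "(\<Sum>k<n. real k * approx i k) \<le> mean_bound"
proof (induction i arbitrary: n)
  case 0
  then show ?case using a_pos a_less delta_pos by (simp add: mean_bound_def)
next
  case (Suc i)
  let ?N = "Suc (max n i)" and ?m = "max 0 (a - b)"
  have "(\<Sum>k<?N. real k * approx (Suc i) k * (1 + rate k)) =
      (\<Sum>k<?N. approx i k * (a * (real k + \<delta>) * real (Suc k) + b * real k * real (k - 1)))"
    using sum_approx[of i "max n i" real] by (simp del: approx.simps sum.lessThan_Suc)
  also have "\<dots> = (\<Sum>k<?N. real k * approx i k * rate k + ((a - b) * (real k * approx i k) + a * \<delta> * approx i k))"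
  proof (intro sum.cong refl)
    fix k
    show "approx i k * (a * (real k + \<delta>) * real (Suc k) + b * real k * real (k - 1)) =
        real k * approx i k * rate k + ((a - b) * (real k * approx i k) + a * \<delta> * approx i k)"
      by (cases k) (simp_all add: rate_def algebra_simps)
  qed
  also have "\<dots> \<le> (\<Sum>k<?N. real k * approx (Suc i) k * rate k + (?m * (real k * approx i k) + a * \<delta> * approx i k))"
    using approx_mono[of i] rate_nonneg approx_nonneg[of i] a_pos delta_pos
    by (intro sum_mono add_mono mult_right_mono mult_left_mono) (auto simp del: approx.simps)
  also have "\<dots> = (\<Sum>k<?N. real k * approx (Suc i) k * rate k)
      + (?m * (\<Sum>k<?N. real k * approx i k) + a * \<delta> * (\<Sum>k<?N. approx i k))"
    by (simp only: sum.distrib sum_distrib_left)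
  also have "?m * (\<Sum>k<?N. real k * approx i k) + a * \<delta> * (\<Sum>k<?N. approx i k) \<le> ?m * mean_bound + a * \<delta> * 1"
    using Suc.IH sum_approx_le_1[of i] a_pos delta_pos by (intro add_mono mult_left_mono) (auto simp del: sum.lessThan_Suc)
  also have "?m * mean_bound + a * \<delta> * 1 = mean_bound"
    using a_less by (simp add: mean_bound_def field_simps)
  finally have "(\<Sum>k<?N. real k * approx (Suc i) k) \<le> mean_bound"
    by (simp add: distrib_left sum.distrib del: sum.lessThan_Suc approx.simps)
  moreover have "(\<Sum>k<n. real k * approx (Suc i) k) \<le> (\<Sum>k<?N. real k * approx (Suc i) k)"
    using approx_nonneg[of "Suc i"] by (intro sum_mono2) (auto simp del: approx.simps)
  ultimately show ?case by linarith
qed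

text \<open>The approximations increase and are bounded by one, so they converge, and the recursion
  passes to the limit. A limit of subprobabilities could lose mass; the finite mean excludes
  this.\<close>

lemma stationary_exists:
  obtains p :: "nat pmf" where
    "\<And>k. pmf p k * (1 + rate k) =
      (if k = 0 then 1 else a * (real k - 1 + \<delta>) * pmf p (k - 1)) + b * (real k + 1) * pmf p (k + 1)"
    "summable (\<lambda>k. real k * pmf p k)"
proof -
  have bound: "approx i k \<le> 1" for i k
  proof -
    have "approx i k \<le> (\<Sum>k<Suc k. approx i k)"
      using approx_nonneg by (intro member_le_sum) auto
    with sum_approx_le_1[of i "Suc k"] show ?thesis by linarith
  qed
  have "\<exists>l. (\<lambda>i. approx i k) \<longlonglongrightarrow> l" for k
  proof (rule Bseq_monoseq_convergent[unfolded convergent_def])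
    show "Bseq (\<lambda>i. approx i k)"
      using bound approx_nonneg by (intro BseqI'[where K = 1]) auto
    show "monoseq (\<lambda>i. approx i k)"
      using approx_mono by (intro incseq_imp_monoseq incseq_SucI)
  qed
  then obtain q where q: "\<And>k. (\<lambda>i. approx i k) \<longlonglongrightarrow> q k" by metis
  have q_nonneg: "q k \<ge> 0" for k
    using q by (rule LIMSEQ_le_const) (use approx_nonneg in auto)
  have rec: "q k * (1 + rate k) =
      (if k = 0 then 1 else a * (real k - 1 + \<delta>) * q (k - 1)) + b * (real k + 1) * q (k + 1)" for k
  proof (rule LIMSEQ_unique)
    show "(\<lambda>i. approx (Suc i) k * (1 + rate k)) \<longlonglongrightarrow> q k * (1 + rate k)"
      using LIMSEQ_Suc[OF q] by (rule tendsto_mult_right)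
    show "(\<lambda>i. approx (Suc i) k * (1 + rate k)) \<longlonglongrightarrow>
        (if k = 0 then 1 else a * (real k - 1 + \<delta>) * q (k - 1)) + b * (real k + 1) * q (k + 1)"
      unfolding approx_Suc using q by (cases "k = 0") (auto intro!: tendsto_intros)
  qed
  have sum_le: "(\<Sum>k<n. q k) \<le> 1" for n
    using tendsto_sum[OF q] by (rule LIMSEQ_le_const2) (use sum_approx_le_1 in auto)
  have mean_le: "(\<Sum>k<n. real k * q k) \<le> mean_bound" for n
    using tendsto_sum[OF tendsto_mult_left[OF q]] by (rule LIMSEQ_le_const2) (use sum_approx_mean_le in auto)
  have summable: "summable q"
    using q_nonneg sum_le by (intro bounded_imp_summable[where B = 1]) (auto simp: lessThan_Suc_atMost[symmetric] simp del: sum.lessThan_Suc)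
  have summable_mean: "summable (\<lambda>k. real k * q k)"
    using q_nonneg mean_le by (intro bounded_imp_summable[where B = mean_bound]) (auto simp: lessThan_Suc_atMost[symmetric] simp del: sum.lessThan_Suc)
  \<comment> \<open>Flow balance across the cut between \<open>n\<close> and \<open>n + 1\<close>:
    the mass missing up to \<open>n\<close> is the net upward flow. It tends to zero because
    \<open>k * q k\<close> is summable.\<close>
  have "(\<Sum>k<Suc n. q k) = 1 - (a * (real n * q n) + a * \<delta> * q n) + b * (real (Suc n) * q (Suc n))" for n
  proof (induction n)
    case 0
    show ?case using rec[of 0] by (simp add: rate_def algebra_simps)
  next
    case (Suc n)
    show ?case using Suc rec[of "Suc n"] by (simp add: rate_def algebra_simps)
  qed
  moreover have "(\<lambda>n. 1 - (a * (real n * q n) + a * \<delta> * q n) + b * (real (Suc n) * q (Suc n)))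
      \<longlonglongrightarrow> 1 - (a * 0 + a * \<delta> * 0) + b * 0"
    by (intro tendsto_intros summable_LIMSEQ_zero[OF summable] summable_LIMSEQ_zero[OF summable_mean]
        LIMSEQ_Suc[OF summable_LIMSEQ_zero[OF summable_mean]])
  ultimately have "(\<lambda>n. \<Sum>k<Suc n. q k) \<longlonglongrightarrow> 1" by simp
  then have sums: "q sums 1" unfolding sums_def by (subst (asm) filterlim_sequentially_Suc)
  have "(\<integral>\<^sup>+k. ennreal (q k) \<partial>count_space UNIV) = 1"
    using sums q_nonneg by (simp add: nn_integral_count_space_nat suminf_ennreal_eq sums_unique[symmetric])
  then have "pmf (embed_pmf q) k = q k" for k
    by (intro pmf_embed_pmf q_nonneg)
  then show thesis using that[of "embed_pmf q"] rec summable_mean by simp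
qed

text \<open>The \<open>Q\<close> of the overview. At \<open>k = 0\<close> the truncated
  \<open>k - 1\<close> is harmless, since its coefficient is zero.\<close>

definition gen :: "(nat \<Rightarrow> real) \<Rightarrow> nat \<Rightarrow> real" where
  "gen f k = a * (real k + \<delta>) * (f (Suc k) - f k) + b * real k * (f (k - 1) - f k)"

text \<open>The balance equations in weak form, by summation by parts; finite support disposes of
  boundary terms. The term \<open>f 0\<close> comes from the restarts.\<close>

lemma expectation_gen:
  assumes p: "\<And>k. pmf p k * (1 + rate k) =
      (if k = 0 then 1 else a * (real k - 1 + \<delta>) * pmf p (k - 1)) + b * (real k + 1) * pmf p (k + 1)"
    and f: "\<And>k. k \<ge> N \<Longrightarrow> f k = 0"
  shows "measure_pmf.expectation p (gen f) = measure_pmf.expectation p f - f 0"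
proof -
  \<comment> \<open>A death moves down by one, so \<open>gen f\<close> may be nonzero still at
    \<open>N\<close>: the sum has to include that index.\<close>
  have "measure_pmf.expectation p (gen f) = (\<Sum>k<Suc N. gen f k * pmf p k)"
    using f by (intro integral_measure_pmf_real) (auto simp: gen_def not_less_eq_eq[symmetric] intro: ccontr)
  also have "\<dots> = (\<Sum>k<Suc N. f (Suc k) * (a * (real k + \<delta>) * pmf p k))
      + (\<Sum>k<Suc N. f (k - 1) * (b * real k * pmf p k)) - (\<Sum>k<Suc N. f k * (rate k * pmf p k))"
    by (simp add: sum.distrib[symmetric] sum_subtractf[symmetric] del: sum.lessThan_Suc)
      (intro sum.cong, auto simp: gen_def rate_def algebra_simps)
  also have "(\<Sum>k<Suc N. f (Suc k) * (a * (real k + \<delta>) * pmf p k)) =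
      (\<Sum>k<Suc N. f k * (if k = 0 then 0 else a * (real k - 1 + \<delta>) * pmf p (k - 1)))"
    by (subst (2) sum.lessThan_Suc_shift) (simp add: f)
  also have "(\<Sum>k<Suc N. f (k - 1) * (b * real k * pmf p k)) =
      (\<Sum>k<Suc N. f k * (b * (real k + 1) * pmf p (Suc k)))"
    by (subst sum.lessThan_Suc_shift) (simp add: f add.commute)
  also have "(\<Sum>k<Suc N. f k * (if k = 0 then 0 else a * (real k - 1 + \<delta>) * pmf p (k - 1)))
      + (\<Sum>k<Suc N. f k * (b * (real k + 1) * pmf p (Suc k))) - (\<Sum>k<Suc N. f k * (rate k * pmf p k))
      = (\<Sum>k<Suc N. f k * pmf p k - (if k = 0 then f 0 else 0))"
    unfolding sum.distrib[symmetric] sum_subtractf[symmetric]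
  proof (intro sum.cong refl)
    fix k
    show "f k * (if k = 0 then 0 else a * (real k - 1 + \<delta>) * pmf p (k - 1))
        + f k * (b * (real k + 1) * pmf p (Suc k)) - f k * (rate k * pmf p k)
      = f k * pmf p k - (if k = 0 then f 0 else 0)"
    proof -
      have "(if k = 0 then 0 else a * (real k - 1 + \<delta>) * pmf p (k - 1)) + b * (real k + 1) * pmf p (Suc k)
          - rate k * pmf p k = pmf p k - (if k = 0 then 1 else 0)"
        using p[of k] by (auto simp: algebra_simps)
      from arg_cong[OF this, of "\<lambda>x. f k * x"] show ?thesis
        by (auto simp: algebra_simps)
    qed
  qed
  also have "\<dots> = (\<Sum>k<Suc N. f k * pmf p k) - f 0"
    by (simp add: sum_subtractf sum.delta del: sum.lessThan_Suc)
  also have "(\<Sum>k<Suc N. f k * pmf p k) = measure_pmf.expectation p f"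
    using f by (intro integral_measure_pmf_real[symmetric]) (auto intro: ccontr)
  finally show ?thesis .
qed

end

subsection \<open>The discretised evolution of test functions\<close>

lemma integrable_pmf_nat_real:
  fixes p :: "nat pmf"
  assumes "summable (\<lambda>k. real k * pmf p k)"
  shows "integrable (measure_pmf p) real"
proof -
  have "integrable (count_space UNIV) (\<lambda>k. pmf p k * real k)"
    using assms by (simp add: integrable_count_space_nat_iff mult.commute)
  then show ?thesis
    by (simp add: measure_pmf_eq_density integrable_density)
qed

text \<open>Hoeffding's lemma with the mean kept in the exponent and for \<open>\<theta>\<close> of
  either sign; a negative \<open>\<theta>\<close> is treated by passing to
  \<open>- h\<close>.\<close>

lemma expectation_exp_le_pmf:
  fixes h :: "'a \<Rightarrow> real"
  assumes fin: "finite (set_pmf q)" and h: "\<And>x. x \<in> set_pmf q \<Longrightarrow> h x \<in> {c..d}"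
  shows "measure_pmf.expectation q (\<lambda>x. exp (\<theta> * h x)) \<le>
    exp (\<theta> * measure_pmf.expectation q h + \<theta>\<^sup>2 * (d - c)\<^sup>2 / 8)"
proof -
  have pos: "measure_pmf.expectation q (\<lambda>x. exp (l * g x)) \<le>
      exp (l * measure_pmf.expectation q g + l\<^sup>2 * (d' - c')\<^sup>2 / 8)"
    if l: "l > 0" and g: "\<And>x. x \<in> set_pmf q \<Longrightarrow> g x \<in> {c'..d'}" for l c' d' and g :: "'a \<Rightarrow> real"
  proof -
    interpret interval_bounded_random_variable "measure_pmf q" g c' d'
      by unfold_locales (auto simp: AE_measure_pmf_iff g[simplified])
    let ?\<mu> = "measure_pmf.expectation q g"
    have int: "integrable (measure_pmf q) h" for h :: "'a \<Rightarrow> real"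
      by (rule integrable_measure_pmf_finite[OF fin])
    have "ennreal (measure_pmf.expectation q (\<lambda>x. exp (l * (g x - ?\<mu>)))) =
        nn_integral q (\<lambda>x. exp (l * (g x - ?\<mu>)))"
      by (intro nn_integral_eq_integral[symmetric] int) auto
    also have "\<dots> \<le> ennreal (exp (l\<^sup>2 * (d' - c')\<^sup>2 / 8))"
      by (rule Hoeffdings_lemma_nn_integral[OF l])
    finally have "measure_pmf.expectation q (\<lambda>x. exp (l * (g x - ?\<mu>))) \<le> exp (l\<^sup>2 * (d' - c')\<^sup>2 / 8)"
      by simp
    then have "exp (l * ?\<mu>) * measure_pmf.expectation q (\<lambda>x. exp (l * (g x - ?\<mu>)))
        \<le> exp (l * ?\<mu>) * exp (l\<^sup>2 * (d' - c')\<^sup>2 / 8)"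
      by (intro mult_left_mono) auto
    also have "exp (l * ?\<mu>) * measure_pmf.expectation q (\<lambda>x. exp (l * (g x - ?\<mu>))) =
        measure_pmf.expectation q (\<lambda>x. exp (l * g x))"
      by (simp add: Bochner_Integration.integral_mult_right_zero[symmetric] exp_add[symmetric] algebra_simps
          del: Bochner_Integration.integral_mult_right_zero)
    finally show ?thesis by (simp add: exp_add)
  qed
  consider "\<theta> > 0" | "\<theta> = 0" | "\<theta> < 0" by linarith
  then show ?thesis
  proof cases
    case 1
    then show ?thesis using h by (rule pos)
  next
    case 3
    then show ?thesis
      using pos[of "- \<theta>" "\<lambda>x. - h x" "- d" "- c"] h by simp
  qed simp
qed

context birth_death_renewal
begin

text \<open>The cutoff is exactly the condition that the weight \<open>1 - rate k / j\<close> left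
  on \<open>f k\<close> is nonnegative, so that \<open>euler j f k\<close> is an average of values
  of \<open>f\<close>. As \<open>rate\<close> is linear, only degrees at least of order
  \<open>j\<close> are frozen.\<close>

definition euler :: "nat \<Rightarrow> (nat \<Rightarrow> real) \<Rightarrow> nat \<Rightarrow> real" where
  "euler j f k = f k + (if rate k \<le> real j then gen f k / real j else 0)"

text \<open>Positivity of the averaging operator: any pointwise majorant \<open>g\<close> is
  transported along with \<open>f\<close>. It is applied to the majorants 1 and
  \<open>A / (k + 1)\<close>.\<close>

lemma abs_euler_le:
  assumes j: "j \<ge> 1" and f: "\<And>k. \<bar>f k\<bar> \<le> g k"
  shows "\<bar>euler j f k\<bar> \<le> euler j g k"
proof (cases "rate k \<le> real j")
  case True
  have eq: "euler j h k = (1 - rate k / real j) * h k + (a * (real k + \<delta>) / real j) * h (Suc k)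
      + (b * real k / real j) * h (k - 1)" for h
    using True j by (simp add: euler_def gen_def rate_def field_simps)
  have c: "0 \<le> 1 - rate k / real j" "0 \<le> a * (real k + \<delta>) / real j" "0 \<le> b * real k / real j"
    using True j a_pos b_pos delta_pos by simp_all
  have tri: "\<bar>x + y + z\<bar> \<le> \<bar>x\<bar> + \<bar>y\<bar> + \<bar>z\<bar>" for x y z :: real by linarith
  have "\<bar>euler j f k\<bar> \<le> \<bar>(1 - rate k / real j) * f k\<bar> + \<bar>(a * (real k + \<delta>) / real j) * f (Suc k)\<bar>
      + \<bar>(b * real k / real j) * f (k - 1)\<bar>"
    unfolding eq by (rule tri)
  also have "\<dots> \<le> euler j g k"
    unfolding eq abs_mult abs_of_nonneg[OF c(1)] abs_of_nonneg[OF c(2)] abs_of_nonneg[OF c(3)]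
    using c f by (intro add_mono mult_left_mono)
  finally show ?thesis .
qed (use f in \<open>simp add: euler_def\<close>)

lemma abs_euler_le_1:
  assumes "j \<ge> 1" "\<And>k. \<bar>f k\<bar> \<le> 1"
  shows "\<bar>euler j f k\<bar> \<le> 1"
proof -
  have "euler j (\<lambda>_. 1) k = 1" by (simp add: euler_def gen_def)
  with abs_euler_le[of j f "\<lambda>_. 1" k] assms show ?thesis by simp
qed

text \<open>The decay \<open>1 / (k + 1)\<close> survives the evolution because deaths increase it at a rate at most \<open>b\<close>.\<close>

lemma abs_euler_le_decay:
  assumes j: "j \<ge> 1" and f: "\<And>k. \<bar>f k\<bar> \<le> A / (real k + 1)"
  shows "\<bar>euler j f k\<bar> \<le> A * (1 + b / real j) / (real k + 1)"
proof -
  let ?g = "\<lambda>k. A / (real k + 1)"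
  have A: "A \<ge> 0" using f[of 0] by simp
  have "a * (real k + \<delta>) * (?g (Suc k) - ?g k) \<le> 0"
    using a_pos delta_pos A by (intro mult_nonneg_nonpos) (auto intro!: divide_left_mono)
  moreover have "b * real k * (?g (k - 1) - ?g k) \<le> b * ?g k"
  proof (cases k)
    case (Suc m)
    have "real k * ?g (k - 1) = A" "real k * ?g k = A - ?g k" using Suc by (simp_all add: field_simps)
    then have "real k * (?g (k - 1) - ?g k) = ?g k" by (simp only: right_diff_distrib)
    then show ?thesis by (simp only: mult.assoc)
  qed (use A b_pos in simp)
  ultimately have "gen ?g k \<le> b * ?g k" unfolding gen_def by linarith
  then have "gen ?g k / real j \<le> b * ?g k / real j" by (rule divide_right_mono) simp
  moreover have "0 \<le> b * ?g k / real j" using A b_pos by simp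
  ultimately have "euler j ?g k \<le> ?g k + b * ?g k / real j"
    by (simp only: euler_def add_le_cancel_left split: if_split) simp
  also have "\<dots> = A * (1 + b / real j) / (real k + 1)" by (simp add: algebra_simps add_divide_distrib)
  finally show ?thesis using abs_euler_le[OF j, where f = f and g = ?g and k = k, OF f] by linarith
qed

lemma euler_eq_0: "(\<And>k. k \<ge> N \<Longrightarrow> f k = 0) \<Longrightarrow> k \<ge> Suc N \<Longrightarrow> euler j f k = 0"
  by (simp add: euler_def gen_def)

definition total_coeff :: real where "total_coeff = a + b + a * \<delta>"

lemma rate_le: "rate k \<le> total_coeff * (real k + 1)"
  using a_pos b_pos delta_pos by (simp add: rate_def total_coeff_def algebra_simps)

lemma total_coeff_pos: "total_coeff > 0"
  using a_pos b_pos delta_pos by (simp add: total_coeff_def add_pos_pos)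

text \<open>Only frozen degrees contribute. There \<open>rate k > j\<close> forces
  \<open>1 / (k + 1) < total_coeff / j\<close>, which the decay of \<open>f\<close> turns into a
  gain of \<open>1 / j\<close>; the remaining factor \<open>rate k\<close> has bounded mean under
  the stationary law and over the vertices.\<close>

lemma gen_minus_euler:
  assumes j: "j \<ge> 1" and f: "\<And>k. \<bar>f k\<bar> \<le> A / (real k + 1)"
  shows "\<bar>gen f k - real j * (euler j f k - f k)\<bar> \<le> 3 * A * total_coeff * rate k / real j"
proof (cases "rate k \<le> real j")
  case True
  have A: "A \<ge> 0" using f[of 0] by simp
  then show ?thesis using True j rate_nonneg total_coeff_pos by (simp add: euler_def)
next
  case False
  have A: "A \<ge> 0" using f[of 0] by simp
  \<comment> \<open>The worst difference is \<open>f (k - 1) - f k\<close> with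
    \<open>1 / k \<le> 2 / (k + 1)\<close>, so two plus one shares of
    \<open>A / (k + 1)\<close>.\<close>
  let ?c = "3 * A / (real k + 1)"
  have "A / (real (Suc k) + 1) \<le> A / (real k + 1)" using A by (intro divide_left_mono) auto
  then have 1: "\<bar>f (Suc k) - f k\<bar> \<le> ?c" using f[of k] f[of "Suc k"] by simp
  have 2: "\<bar>real k * (f (k - 1) - f k)\<bar> \<le> real k * ?c"
  proof (cases k)
    case (Suc m)
    have "A / (real m + 1) \<le> 2 * A / (real k + 1)" using A Suc by (simp add: field_simps)
    then have "\<bar>f (k - 1) - f k\<bar> \<le> ?c" using f[of k] f[of m] Suc by simp
    from mult_left_mono[OF this, of "real k"] show ?thesis by (simp add: abs_mult)
  qed simp
  have "\<bar>gen f k\<bar> \<le> a * (real k + \<delta>) * \<bar>f (Suc k) - f k\<bar> + b * \<bar>real k * (f (k - 1) - f k)\<bar>"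
    unfolding gen_def using a_pos b_pos delta_pos by (intro order.trans[OF abs_triangle_ineq]) (simp add: abs_mult)
  also have "\<dots> \<le> a * (real k + \<delta>) * ?c + b * (real k * ?c)"
    using 1 2 a_pos b_pos delta_pos by (intro add_mono mult_left_mono) auto
  also have "\<dots> = 3 * A * rate k * (1 / (real k + 1))"
  proof -
    have "a * (real k + \<delta>) * (3 * A * i) + b * (real k * (3 * A * i)) = 3 * A * rate k * (1 * i)" for i
      by (simp add: rate_def algebra_simps)
    then show ?thesis by (simp only: divide_inverse)
  qed
  also have "\<dots> \<le> 3 * A * rate k * (total_coeff / real j)"
    using False rate_le[of k] j A rate_nonneg[of k] by (intro mult_left_mono) (auto simp: field_simps)
  finally show ?thesis using False by (simp add: euler_def mult_ac)
qed

text \<open>With the full \<open>f + gen f / j\<close> in place of \<open>euler j f\<close>,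
  \<open>expectation_gen\<close> would make the difference zero; the bound is therefore just the
  error of the cutoff.\<close>

lemma expectation_euler:
  assumes p: "\<And>k. pmf p k * (1 + rate k) =
      (if k = 0 then 1 else a * (real k - 1 + \<delta>) * pmf p (k - 1)) + b * (real k + 1) * pmf p (k + 1)"
    and mean: "summable (\<lambda>k. real k * pmf p k)"
    and j: "j \<ge> 1" and f: "\<And>k. \<bar>f k\<bar> \<le> A / (real k + 1)" and supp: "\<And>k. k \<ge> N \<Longrightarrow> f k = 0"
  shows "\<bar>real (Suc j) * measure_pmf.expectation p f - (real j * measure_pmf.expectation p (euler j f) + f 0)\<bar>
    \<le> 3 * total_coeff * measure_pmf.expectation p rate * (A / real j)"
proof -
  have int_rate: "integrable (measure_pmf p) rate"
  proof -
    have "integrable (measure_pmf p) (\<lambda>k. a * \<delta> + (a + b) * real k)"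
      by (intro Bochner_Integration.integrable_add integrable_mult_right integrable_pmf_nat_real mean) auto
    then show ?thesis by (simp add: rate_def[abs_def] algebra_simps)
  qed
  have int: "integrable (measure_pmf p) h" if "\<And>k. k \<ge> Suc N \<Longrightarrow> h k = 0" for h :: "nat \<Rightarrow> real"
  proof -
    have "finite (range h)"
    proof (rule finite_subset)
      show "range h \<subseteq> insert 0 (h ` {..N})"
        using that by (metis atMost_iff imageI image_subsetI insertCI not_less_eq_eq)
    qed simp
    then have "bounded (range h)" by (rule finite_imp_bounded)
    then obtain B where "\<And>k. norm (h k) \<le> B" by (auto simp: bounded_iff)
    then show ?thesis by (intro measure_pmf.integrable_const_bound[where B = B]) auto
  qed
  have ints: "integrable (measure_pmf p) f" "integrable (measure_pmf p) (euler j f)" "integrable (measure_pmf p) (gen f)"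
    using supp euler_eq_0[OF supp] by (intro int; simp add: gen_def)+
  have "real (Suc j) * measure_pmf.expectation p f - (real j * measure_pmf.expectation p (euler j f) + f 0)
      = measure_pmf.expectation p (\<lambda>k. gen f k - real j * (euler j f k - f k))"
    using ints expectation_gen[OF p, of N f] supp by (simp add: algebra_simps)
  also have "\<bar>\<dots>\<bar> \<le> measure_pmf.expectation p (\<lambda>k. \<bar>gen f k - real j * (euler j f k - f k)\<bar>)"
    by (rule integral_abs_bound)
  also have "\<dots> \<le> measure_pmf.expectation p (\<lambda>k. 3 * A * total_coeff / real j * rate k)"
    using ints int_rate gen_minus_euler[OF j f] by (intro integral_mono) (auto simp: mult_ac)
  also have "\<dots> = 3 * total_coeff * measure_pmf.expectation p rate * (A / real j)"
    by simp
  finally show ?thesis .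
qed

end

subsection \<open>Fluctuations of the number of vertices\<close>

context attachment_deletion
begin

definition dev :: "nat \<Rightarrow> graph \<Rightarrow> real" where
  "dev n G = real (num_verts G) - \<pi> * real n"

lemma admissible_num_edges:
  "admissible n G \<Longrightarrow> real (num_edges G) = 2 * real (num_verts G) - real n - 3"
  by (auto simp: admissible_def dest!: arg_cong[where f = real])

lemma admissible_num_verts_le:
  assumes "admissible n G"
  shows "real (num_verts G) \<le> real n + 2" "real n + 3 \<le> 2 * real (num_verts G)"
proof -
  have "num_verts G \<le> n + 2" "n + 3 \<le> 2 * num_verts G"
    using assms unfolding admissible_def by linarith+
  then show "real (num_verts G) \<le> real n + 2" "real n + 3 \<le> 2 * real (num_verts G)" by linarith+
qed

text \<open>When no edge is left, the walk \<open>dev\<close> is low, so the forced addition cannot push it up.\<close>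

lemma dev_no_edges:
  assumes "admissible n G" "num_edges G = 0"
  shows "dev n G = 3 / 2 - (\<pi> - 1 / 2) * real n"
  using admissible_num_edges[OF assms(1)] assms(2) by (simp add: dev_def algebra_simps)

lemma dev_no_edges_le:
  assumes "admissible n G" "num_edges G = 0"
  shows "dev n G \<le> 3 / 2"
  using dev_no_edges[OF assms] pi_gt_half by simp

lemma expectation_step_dev:
  assumes "admissible n G"
  shows "measure_pmf.expectation (step \<pi> \<delta> G) (\<lambda>G'. h (dev (Suc n) G')) =
    (if num_edges G > 0 then \<pi> * h (dev n G + (1 - \<pi>)) + (1 - \<pi>) * h (dev n G - \<pi>)
     else h (dev n G + (1 - \<pi>)))"
proof -
  have G: "pair_fin_digraph G" using assms by (simp add: admissible_def)
  have 1: "dev (Suc n) (attach G u) = dev n G + (1 - \<pi>)" for u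
    by (simp add: dev_def num_attach[OF G] algebra_simps)
  have 2: "dev (Suc n) (remove_edge G e) = dev n G - \<pi>" if "e \<in> parcs G" for e
    using num_remove_edge(1)[OF G that] by (simp add: dev_def algebra_simps)
  have "(\<Sum>e\<in>parcs G. h (dev (Suc n) (remove_edge G e))) = num_edges G * h (dev n G - \<pi>)"
    by (simp add: 2)
  then show ?thesis
    by (auto simp: expectation_step[OF G] 1)
qed

text \<open>With edges present the increment is centred and adds its variance
  \<open>\<pi> * (1 - \<pi>)\<close>. Without edges the cross term is controlled by
  \<open>dev \<le> 3 / 2\<close>. In both cases 4 is a generous bound for the increase.\<close>

lemma expectation_dev_sq: "measure_pmf.expectation (law n) (\<lambda>G. (dev n G)\<^sup>2) \<le> 4 * (real n + 1)"
proof (induction n)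
  case 0
  show ?case by (simp add: law_0 dev_def) (simp add: initial_graph_def)
next
  case (Suc n)
  have "measure_pmf.expectation (step \<pi> \<delta> G) (\<lambda>G'. (dev (Suc n) G')\<^sup>2) \<le> (dev n G)\<^sup>2 + 4"
    if G: "admissible n G" for G
  proof (cases "num_edges G > 0")
    case True
    have "\<pi> * (dev n G + (1 - \<pi>))\<^sup>2 + (1 - \<pi>) * (dev n G - \<pi>)\<^sup>2 = (dev n G)\<^sup>2 + \<pi> * (1 - \<pi>)"
      by (simp add: power2_eq_square algebra_simps)
    moreover have "\<pi> * (1 - \<pi>) \<le> 1 * 1"
      using pi_gt_half pi_less_one by (intro mult_mono) auto
    ultimately show ?thesis
      using True unfolding expectation_step_dev[OF G, where h = "\<lambda>x. x\<^sup>2"] by simp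
  next
    case False
    then have "dev n G \<le> 3 / 2" using G by (intro dev_no_edges_le) auto
    then have "2 * (1 - \<pi>) * dev n G \<le> 2 * (1 - \<pi>) * (3 / 2)"
      using pi_less_one by (intro mult_left_mono) auto
    moreover have "(1 - \<pi>)\<^sup>2 \<le> 1"
      using pi_gt_half pi_less_one by (intro power_le_one) auto
    moreover have "(dev n G + (1 - \<pi>))\<^sup>2 = (dev n G)\<^sup>2 + 2 * (1 - \<pi>) * dev n G + (1 - \<pi>)\<^sup>2"
      by (simp add: power2_eq_square algebra_simps)
    ultimately show ?thesis
      using False pi_gt_half unfolding expectation_step_dev[OF G, where h = "\<lambda>x. x\<^sup>2"] by simp
  qed
  then have "measure_pmf.expectation (law (Suc n)) (\<lambda>G. (dev (Suc n) G)\<^sup>2) \<le>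
      measure_pmf.expectation (law n) (\<lambda>G. (dev n G)\<^sup>2 + 4)"
    unfolding expectation_law_Suc by (intro expectation_law_mono)
  also have "\<dots> = measure_pmf.expectation (law n) (\<lambda>G. (dev n G)\<^sup>2) + 4"
    by simp
  finally show ?case using Suc by simp
qed

text \<open>Cauchy-Schwarz in the form of the pointwise inequality from the square of
  \<open>\<bar>dev\<bar> - 2 * s\<close>, with \<open>s = sqrt (n + 1)\<close>.\<close>

lemma expectation_abs_dev: "measure_pmf.expectation (law n) (\<lambda>G. \<bar>dev n G\<bar>) \<le> 2 * sqrt (real n + 1)"
proof -
  let ?s = "sqrt (real n + 1)"
  have s: "?s > 0" "?s * ?s = real n + 1" by simp_all
  have "measure_pmf.expectation (law n) (\<lambda>G. \<bar>dev n G\<bar>) \<le>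
      measure_pmf.expectation (law n) (\<lambda>G. (dev n G)\<^sup>2 / (4 * ?s) + ?s)"
  proof (rule expectation_law_mono)
    fix G
    have "0 \<le> (\<bar>dev n G\<bar> - 2 * ?s)\<^sup>2" by simp
    then have "4 * ?s * \<bar>dev n G\<bar> \<le> (dev n G)\<^sup>2 + 4 * ?s * ?s"
      by (simp add: power2_diff power_mult_distrib mult_ac)
    then show "\<bar>dev n G\<bar> \<le> (dev n G)\<^sup>2 / (4 * ?s) + ?s"
      using s(1) by (simp add: field_simps)
  qed
  also have "\<dots> = measure_pmf.expectation (law n) (\<lambda>G. (dev n G)\<^sup>2) / (4 * ?s) + ?s"
    by simp
  also have "\<dots> \<le> 4 * (real n + 1) / (4 * ?s) + ?s"
    using expectation_dev_sq[of n] s(1) by (intro add_right_mono divide_right_mono) auto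
  also have "\<dots> = 2 * ?s" using s by (simp add: field_simps)
  finally show ?thesis .
qed

text \<open>With edges Hoeffding's lemma on a range of length one costs
  \<open>\<theta> * \<theta> / 8\<close>. Without edges and for \<open>\<theta> \<ge> 0\<close> the
  walk lands below \<open>3 / 2 + 1\<close>, so the exponential is at most
  \<open>exp (5 / 2 * \<bar>\<theta>\<bar>)\<close>; this is added at each step and produces the
  factor \<open>n + 1\<close>. For \<open>\<theta> < 0\<close> the forced move upwards only
  helps.\<close>

lemma expectation_exp_dev:
  "measure_pmf.expectation (law n) (\<lambda>G. exp (\<theta> * dev n G)) \<le>
    (real n + 1) * exp (\<theta>\<^sup>2 * real n / 8 + 5 / 2 * \<bar>\<theta>\<bar>)"
proof (induction n)
  case 0
  have "2 * \<theta> \<le> 5 / 2 * \<bar>\<theta>\<bar>" by linarith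
  then show ?case by (simp add: law_0 dev_def) (simp add: initial_graph_def mult.commute)
next
  case (Suc n)
  let ?E = "\<lambda>n. \<theta>\<^sup>2 * real n / 8 + 5 / 2 * \<bar>\<theta>\<bar>"
  have "measure_pmf.expectation (step \<pi> \<delta> G) (\<lambda>G'. exp (\<theta> * dev (Suc n) G')) \<le>
      exp (\<theta>\<^sup>2 / 8) * exp (\<theta> * dev n G) + exp (5 / 2 * \<bar>\<theta>\<bar>)"
    if G: "admissible n G" for G
  proof (cases "num_edges G > 0")
    case True
    have pf: "pair_fin_digraph G" using G by (simp add: admissible_def)
    have range: "dev (Suc n) G' \<in> {dev n G - \<pi> .. dev n G + (1 - \<pi>)}"
      if "G' \<in> set_pmf (step \<pi> \<delta> G)" for G'
      using pf that
    proof (cases rule: step_cases)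
      case (attach u)
      then show ?thesis by (simp add: dev_def num_attach[OF pf] algebra_simps)
    next
      case (remove e)
      then show ?thesis using num_remove_edge(1)[OF pf remove(1)] by (simp add: dev_def algebra_simps)
    qed
    have "measure_pmf.expectation (step \<pi> \<delta> G) (dev (Suc n)) = dev n G"
      using True unfolding expectation_step_dev[OF G, where h = "\<lambda>x. x"] by (simp add: algebra_simps)
    with expectation_exp_le_pmf[OF finite_set_step[OF pf], where h = "dev (Suc n)" and \<theta> = \<theta>, OF range] True
    have "measure_pmf.expectation (step \<pi> \<delta> G) (\<lambda>G'. exp (\<theta> * dev (Suc n) G')) \<le>
        exp (\<theta> * dev n G + \<theta>\<^sup>2 / 8)"
      by simp
    also have "\<dots> = exp (\<theta>\<^sup>2 / 8) * exp (\<theta> * dev n G)" by (simp add: exp_add)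
    finally show ?thesis using exp_ge_zero[of "5 / 2 * \<bar>\<theta>\<bar>"] by linarith
  next
    case False
    then have d: "dev n G \<le> 3 / 2" using G by (intro dev_no_edges_le) auto
    have "exp (\<theta> * (dev n G + (1 - \<pi>))) \<le> exp (\<theta>\<^sup>2 / 8) * exp (\<theta> * dev n G) + exp (5 / 2 * \<bar>\<theta>\<bar>)"
    proof (cases "\<theta> \<ge> 0")
      case True
      have "\<theta> * (dev n G + (1 - \<pi>)) \<le> \<theta> * (5 / 2)"
        using True d pi_gt_half by (intro mult_left_mono) auto
      then have "exp (\<theta> * (dev n G + (1 - \<pi>))) \<le> exp (5 / 2 * \<bar>\<theta>\<bar>)" using True by (simp add: mult.commute)
      then show ?thesis by (simp add: add_increasing)
    next
      case False
      have "\<theta> * (dev n G + (1 - \<pi>)) \<le> \<theta> * dev n G"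
        using False pi_less_one by (intro mult_left_mono_neg) auto
      also have "\<dots> \<le> \<theta>\<^sup>2 / 8 + \<theta> * dev n G" by simp
      finally have "exp (\<theta> * (dev n G + (1 - \<pi>))) \<le> exp (\<theta>\<^sup>2 / 8) * exp (\<theta> * dev n G)"
        by (simp add: exp_add[symmetric])
      then show ?thesis by (simp add: add_increasing2)
    qed
    with False show ?thesis
      unfolding expectation_step_dev[OF G, where h = "\<lambda>x. exp (\<theta> * x)"] by simp
  qed
  then have "measure_pmf.expectation (law (Suc n)) (\<lambda>G. exp (\<theta> * dev (Suc n) G)) \<le>
      measure_pmf.expectation (law n) (\<lambda>G. exp (\<theta>\<^sup>2 / 8) * exp (\<theta> * dev n G) + exp (5 / 2 * \<bar>\<theta>\<bar>))"
    unfolding expectation_law_Suc by (intro expectation_law_mono)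
  also have "\<dots> = exp (\<theta>\<^sup>2 / 8) * measure_pmf.expectation (law n) (\<lambda>G. exp (\<theta> * dev n G)) + exp (5 / 2 * \<bar>\<theta>\<bar>)"
    by simp
  also have "\<dots> \<le> exp (\<theta>\<^sup>2 / 8) * ((real n + 1) * exp (?E n)) + exp (?E (Suc n))"
    using Suc by (intro add_mono mult_left_mono) auto
  also have "exp (\<theta>\<^sup>2 / 8) * ((real n + 1) * exp (?E n)) = (real n + 1) * exp (?E (Suc n))"
    by (simp add: exp_add[symmetric] field_simps)
  finally show ?case by (simp add: algebra_simps)
qed

lemma markov_law:
  fixes h :: "graph \<Rightarrow> real"
  assumes "\<And>G. admissible n G \<Longrightarrow> h G \<ge> 0" "\<And>G. admissible n G \<Longrightarrow> P G \<Longrightarrow> h G \<ge> 1"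
  shows "measure_pmf.prob (law n) {G. P G} \<le> measure_pmf.expectation (law n) h"
proof -
  have "measure_pmf.prob (law n) {G. P G} = measure_pmf.expectation (law n) (indicator {G. P G})"
    by simp
  also have "\<dots> \<le> measure_pmf.expectation (law n) h"
    using assms by (intro expectation_law_mono) (auto simp: indicator_def)
  finally show ?thesis .
qed

lemma dev_tail:
  assumes "\<epsilon> > 0"
  shows "measure_pmf.prob (law n) {G. \<bar>dev n G\<bar> > \<epsilon> * real n} \<le>
    2 * (real n + 1) * exp (10 * \<epsilon>) * exp (- (2 * \<epsilon>\<^sup>2 * real n))"
proof -
  \<comment> \<open>Minimises
    \<open>\<theta> * \<theta> * n / 8 - \<theta> * \<epsilon> * n\<close>.\<close>
  let ?\<theta> = "4 * \<epsilon>"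
  let ?h = "\<lambda>G. exp (?\<theta> * dev n G - ?\<theta> * \<epsilon> * real n) + exp (- ?\<theta> * dev n G - ?\<theta> * \<epsilon> * real n)"
  have "measure_pmf.prob (law n) {G. \<bar>dev n G\<bar> > \<epsilon> * real n} \<le> measure_pmf.expectation (law n) ?h"
  proof (rule markov_law)
    fix G assume "\<bar>dev n G\<bar> > \<epsilon> * real n"
    then consider "dev n G > \<epsilon> * real n" | "- dev n G > \<epsilon> * real n" by linarith
    then show "?h G \<ge> 1"
    proof cases
      case 1
      then have "?\<theta> * dev n G \<ge> ?\<theta> * (\<epsilon> * real n)" using assms by (intro mult_left_mono) auto
      then show ?thesis by (intro add_increasing2) auto
    next
      case 2
      then have "?\<theta> * - dev n G \<ge> ?\<theta> * (\<epsilon> * real n)" using assms by (intro mult_left_mono) auto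
      then show ?thesis by (intro add_increasing) auto
    qed
  qed (simp add: add_nonneg_nonneg)
  also have "\<dots> = exp (- (?\<theta> * \<epsilon> * real n)) * (measure_pmf.expectation (law n) (\<lambda>G. exp (?\<theta> * dev n G))
      + measure_pmf.expectation (law n) (\<lambda>G. exp (- ?\<theta> * dev n G)))"
  proof -
    have "?h = (\<lambda>G. exp (- (?\<theta> * \<epsilon> * real n)) * exp (?\<theta> * dev n G)
        + exp (- (?\<theta> * \<epsilon> * real n)) * exp (- ?\<theta> * dev n G))"
      by (simp add: exp_add[symmetric] fun_eq_iff)
    then show ?thesis
      by (simp only: Bochner_Integration.integral_add[OF integrable_law integrable_law]
          integral_mult_right_zero distrib_left)
  qed
  also have "\<dots> \<le> exp (- (?\<theta> * \<epsilon> * real n)) *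
      ((real n + 1) * exp (?\<theta>\<^sup>2 * real n / 8 + 5 / 2 * \<bar>?\<theta>\<bar>) + (real n + 1) * exp ((- ?\<theta>)\<^sup>2 * real n / 8 + 5 / 2 * \<bar>- ?\<theta>\<bar>))"
    by (intro mult_left_mono add_mono expectation_exp_dev) auto
  also have "\<dots> = 2 * (real n + 1) * (exp (- (?\<theta> * \<epsilon> * real n)) * exp (?\<theta>\<^sup>2 * real n / 8 + 5 / 2 * \<bar>?\<theta>\<bar>))"
    by (simp add: algebra_simps)
  also have "exp (- (?\<theta> * \<epsilon> * real n)) * exp (?\<theta>\<^sup>2 * real n / 8 + 5 / 2 * \<bar>?\<theta>\<bar>) =
      exp (10 * \<epsilon>) * exp (- (2 * \<epsilon>\<^sup>2 * real n))"
    using assms by (simp add: exp_add[symmetric] power2_eq_square algebra_simps)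
  finally show ?thesis by (simp add: mult.assoc)
qed

text \<open>The typical size of \<open>total_weight\<close> per unit of time:
  \<open>2 * \<pi> - 1\<close> from the edges and \<open>\<delta> * \<pi>\<close> from the vertices.
  The two coefficients below are the probabilities of an addition and a deletion over the typical
  denominators.\<close>

definition growth :: real where "growth = 2 * \<pi> - 1 + \<delta> * \<pi>"

definition birth_coeff :: real where "birth_coeff = \<pi> / growth"

definition death_coeff :: real where "death_coeff = (1 - \<pi>) / (2 * \<pi> - 1)"

lemma growth_pos: "growth > 0"
  using pi_gt_half delta_pos by (simp add: growth_def add_pos_pos)

sublocale bd: birth_death_renewal birth_coeff death_coeff \<delta>
proof
  show "birth_coeff > 0" "death_coeff > 0" "\<delta> > 0"
    using growth_pos pi_gt_half pi_less_one delta_pos by (simp_all add: birth_coeff_def death_coeff_def)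
  \<comment> \<open>Dropping \<open>\<delta> * \<pi>\<close> from the denominator enlarges the birth
    coefficient to exactly one plus the death coefficient.\<close>
  have "\<pi> / growth < \<pi> / (2 * \<pi> - 1)"
    using growth_pos pi_gt_half delta_pos by (intro divide_strict_left_mono) (auto simp: growth_def)
  also have "\<dots> = 1 + (1 - \<pi>) / (2 * \<pi> - 1)"
    using pi_gt_half by (simp add: field_simps)
  finally show "birth_coeff - death_coeff < 1"
    by (simp add: birth_coeff_def death_coeff_def)
qed

end

subsection \<open>The drift of degree sums\<close>

context attachment_deletion
begin

lemma admissible_pair_fin_digraph: "admissible n G \<Longrightarrow> pair_fin_digraph G"
  by (simp add: admissible_def)

lemma deg_sum_rate_le:
  assumes "admissible j G" "j \<ge> 1"
  shows "deg_sum bd.rate G \<le> 6 * bd.total_coeff * real j"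
proof -
  have G: "pair_fin_digraph G" using assms by (simp add: admissible_def)
  have "deg_sum bd.rate G \<le> deg_sum (\<lambda>k. bd.total_coeff * (real k + 1)) G"
    by (intro deg_sum_mono bd.rate_le)
  also have "\<dots> = bd.total_coeff * (real (num_edges G) + real (num_verts G))"
    by (simp only: deg_sum_cmult deg_sum_add deg_sum_const deg_sum_of_nat[OF G] mult_1)
  also have "\<dots> \<le> bd.total_coeff * (6 * real j)"
    using admissible_num_edges[OF assms(1)] admissible_num_verts_le[OF assms(1)] assms(2) bd.total_coeff_pos
    by (intro mult_left_mono) auto
  finally show ?thesis by (simp add: mult_ac)
qed

lemma deg_sum_euler:
  assumes G: "admissible j G" and j: "j \<ge> 1" and f: "\<And>k. \<bar>f k\<bar> \<le> A / (real k + 1)"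
  shows "\<bar>deg_sum (bd.gen f) G / real j - (deg_sum (bd.euler j f) G - deg_sum f G)\<bar>
    \<le> 18 * bd.total_coeff\<^sup>2 * A / real j"
proof -
  have A: "A \<ge> 0" using f[of 0] by simp
  let ?d = "\<lambda>k. bd.gen f k - real j * (bd.euler j f k - f k)"
  have "\<bar>deg_sum ?d G\<bar> \<le> deg_sum (\<lambda>k. \<bar>?d k\<bar>) G" by (rule abs_deg_sum_le)
  also have "\<dots> \<le> deg_sum (\<lambda>k. 3 * A * bd.total_coeff / real j * bd.rate k) G"
    using bd.gen_minus_euler[OF j f] by (intro deg_sum_mono) auto
  also have "\<dots> = 3 * A * bd.total_coeff / real j * deg_sum bd.rate G"
    by (rule deg_sum_cmult)
  also have "\<dots> \<le> 3 * A * bd.total_coeff / real j * (6 * bd.total_coeff * real j)"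
    using deg_sum_rate_le[OF G j] A bd.total_coeff_pos by (intro mult_left_mono) auto
  also have "\<dots> = 18 * bd.total_coeff\<^sup>2 * A"
    using j by (simp add: power2_eq_square)
  finally have "\<bar>deg_sum ?d G\<bar> / real j \<le> 18 * bd.total_coeff\<^sup>2 * A / real j"
    by (rule divide_right_mono) simp
  moreover have "\<bar>deg_sum ?d G\<bar> / real j = \<bar>deg_sum ?d G / real j\<bar>" by simp
  moreover have "deg_sum ?d G / real j = deg_sum (bd.gen f) G / real j - (deg_sum (bd.euler j f) G - deg_sum f G)"
    using j by (simp add: deg_sum_diff deg_sum_cmult diff_divide_distrib)
  ultimately show ?thesis by simp
qed

lemma abs_birth_sum_le:
  assumes G: "pair_fin_digraph G" and f: "\<And>k. \<bar>f k\<bar> \<le> 1"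
  shows "\<bar>deg_sum (\<lambda>k. (real k + \<delta>) * (f (Suc k) - f k)) G\<bar> \<le> 2 * (real (num_edges G) + \<delta> * real (num_verts G))"
proof -
  have diff: "\<bar>f (Suc k) - f k\<bar> \<le> 2" for k using f[of k] f[of "Suc k"] by linarith
  have "\<bar>deg_sum (\<lambda>k. (real k + \<delta>) * (f (Suc k) - f k)) G\<bar> \<le> deg_sum (\<lambda>k. \<bar>(real k + \<delta>) * (f (Suc k) - f k)\<bar>) G"
    by (rule abs_deg_sum_le)
  also have "\<dots> \<le> deg_sum (\<lambda>k. 2 * (real k + \<delta>)) G"
  proof (rule deg_sum_mono)
    fix k show "\<bar>(real k + \<delta>) * (f (Suc k) - f k)\<bar> \<le> 2 * (real k + \<delta>)"
      using mult_left_mono[OF diff[of k], of "real k + \<delta>"] delta_pos by (simp add: abs_mult mult.commute)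
  qed
  also have "\<dots> = 2 * (real (num_edges G) + \<delta> * real (num_verts G))"
    by (simp only: deg_sum_cmult deg_sum_add deg_sum_const deg_sum_of_nat[OF G])
  finally show ?thesis .
qed

lemma abs_death_sum_le:
  assumes G: "pair_fin_digraph G" and f: "\<And>k. \<bar>f k\<bar> \<le> 1"
  shows "\<bar>deg_sum (\<lambda>k. real k * (f (k - 1) - f k)) G\<bar> \<le> 2 * real (num_edges G)"
proof -
  have diff: "\<bar>f (k - 1) - f k\<bar> \<le> 2" for k using f[of k] f[of "k - 1"] by linarith
  have "\<bar>deg_sum (\<lambda>k. real k * (f (k - 1) - f k)) G\<bar> \<le> deg_sum (\<lambda>k. \<bar>real k * (f (k - 1) - f k)\<bar>) G"
    by (rule abs_deg_sum_le)
  also have "\<dots> \<le> deg_sum (\<lambda>k. 2 * real k) G"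
    using diff by (intro deg_sum_mono) (auto simp: abs_mult mult.commute intro!: mult_mono)
  also have "\<dots> = 2 * real (num_edges G)"
    by (simp only: deg_sum_cmult deg_sum_of_nat[OF G])
  finally show ?thesis .
qed

lemma deg_sum_gen:
  "deg_sum (bd.gen f) G = birth_coeff * deg_sum (\<lambda>k. (real k + \<delta>) * (f (Suc k) - f k)) G
     + death_coeff * deg_sum (\<lambda>k. real k * (f (k - 1) - f k)) G"
  by (simp only: deg_sum_cmult[symmetric] deg_sum_add[symmetric] bd.gen_def[abs_def] mult.assoc)

text \<open>Replaces a random denominator \<open>x\<close> by a deterministic \<open>z\<close>. As
  the numerator is at most \<open>c * x\<close>, the cost is relative to \<open>z\<close>, and no
  lower bound on \<open>x\<close> beyond positivity is required.\<close>

lemma abs_scaled_diff_le: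
  fixes x y z B c :: real
  assumes "\<bar>B\<bar> \<le> c * y" "y \<ge> 0" "x > 0" "z > 0" "c \<ge> 0" "y \<le> x"
  shows "\<bar>B / x - B / z\<bar> \<le> c * \<bar>z - x\<bar> / z"
proof -
  have "B / x - B / z = B / x * ((z - x) / z)" using assms by (simp add: field_simps)
  then have "\<bar>B / x - B / z\<bar> = \<bar>B\<bar> / x * (\<bar>z - x\<bar> / z)"
    using assms by (simp add: abs_mult)
  also have "\<dots> \<le> c * (\<bar>z - x\<bar> / z)"
  proof (rule mult_right_mono)
    have "c * y \<le> c * x" using assms by (intro mult_left_mono) auto
    then have "\<bar>B\<bar> \<le> c * x" using assms(1) by linarith
    then show "\<bar>B\<bar> / x \<le> c" using assms(3) by (simp add: divide_le_eq)
  qed (use assms in auto)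
  finally show ?thesis by simp
qed

text \<open>Both denominators are affine in the number of vertices, so their distances to
  \<open>growth * j\<close> and \<open>(2 * \<pi> - 1) * j\<close> are of order
  \<open>\<bar>dev j G\<bar> + 1\<close>; the numerators are at most twice the denominators.\<close>

lemma step_vs_gen_edges:
  assumes G: "admissible j G" and j: "j \<ge> 1" and f: "\<And>k. \<bar>f k\<bar> \<le> 1" and e: "num_edges G > 0"
  defines "B \<equiv> deg_sum (\<lambda>k. (real k + \<delta>) * (f (Suc k) - f k)) G"
    and "D \<equiv> deg_sum (\<lambda>k. real k * (f (k - 1) - f k)) G"
  shows "\<bar>\<pi> * ((B + \<delta> * (f 1 - f 0)) / total_weight G) + (1 - \<pi>) * (D / num_edges G) - deg_sum (bd.gen f) G / real j\<bar>
    \<le> (2 * birth_coeff * (3 + \<delta>) + 6 * death_coeff + 4) * (\<bar>dev j G\<bar> + 1) / real j"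
proof -
  have pf: "pair_fin_digraph G" using G by (rule admissible_pair_fin_digraph)
  let ?e = "real (num_edges G)" and ?v = "real (num_verts G)" and ?T = "total_weight G" and ?W = "\<bar>dev j G\<bar>"
  let ?z = "growth * real j" and ?z' = "(2 * \<pi> - 1) * real j"
  have z: "?z > 0" "?z' > 0" using growth_pos j pi_gt_half by simp_all
  have T: "?T = ?e + \<delta> * ?v + \<delta>" by (simp add: total_weight_def)
  note ev = admissible_num_edges[OF G] admissible_num_verts_le[OF G]
  have "\<bar>B / ?T - B / ?z\<bar> \<le> 2 * \<bar>?z - ?T\<bar> / ?z"
    using abs_birth_sum_le[OF pf f] total_weight_pos[of G] z delta_pos
    unfolding B_def by (intro abs_scaled_diff_le[where y = "?e + \<delta> * ?v"]) (auto simp: T)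
  moreover have "\<bar>?z - ?T\<bar> \<le> (3 + \<delta>) * (?W + 1)"
  proof -
    have "?z - ?T = - ((2 + \<delta>) * dev j G) + (3 - \<delta>)"
      unfolding T ev(1) by (simp add: growth_def dev_def algebra_simps)
    moreover have "\<bar>(2 + \<delta>) * dev j G\<bar> = (2 + \<delta>) * ?W" using delta_pos by (simp add: abs_mult)
    moreover have "(3 + \<delta>) * (?W + 1) = (2 + \<delta>) * ?W + ?W + 3 + \<delta>" by (simp add: algebra_simps)
    ultimately show ?thesis using delta_pos by linarith
  qed
  then have "2 * \<bar>?z - ?T\<bar> / ?z \<le> 2 * ((3 + \<delta>) * (?W + 1)) / ?z"
    using z by (intro divide_right_mono) auto
  ultimately have "\<bar>B / ?T - B / ?z\<bar> \<le> 2 * ((3 + \<delta>) * (?W + 1)) / ?z" by linarith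
  then have "\<pi> * \<bar>B / ?T - B / ?z\<bar> \<le> \<pi> * (2 * ((3 + \<delta>) * (?W + 1)) / ?z)"
    using pi_gt_half by (intro mult_left_mono) auto
  also have "\<dots> = 2 * birth_coeff * (3 + \<delta>) * (?W + 1) / real j"
    by (simp add: birth_coeff_def)
  finally have "\<bar>\<pi> * (B / ?T - B / ?z)\<bar> \<le> 2 * birth_coeff * (3 + \<delta>) * (?W + 1) / real j"
    using pi_gt_half by (simp only: abs_mult)
  moreover have "\<pi> * (B / ?T - B / ?z) = \<pi> * (B / ?T) - birth_coeff * B / real j"
    by (simp add: birth_coeff_def right_diff_distrib)
  ultimately have 1: "\<bar>\<pi> * (B / ?T) - birth_coeff * B / real j\<bar> \<le> 2 * birth_coeff * (3 + \<delta>) * (?W + 1) / real j"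
    by (simp only:)
  have "\<bar>D / ?e - D / ?z'\<bar> \<le> 2 * \<bar>?z' - ?e\<bar> / ?z'"
    using abs_death_sum_le[OF pf f] z e
    unfolding D_def by (intro abs_scaled_diff_le[where y = ?e]) auto
  moreover have "\<bar>?z' - ?e\<bar> \<le> 3 * (?W + 1)"
  proof -
    have eq: "?z' - ?e = - (2 * dev j G) + 3"
      unfolding ev(1) dev_def by (simp add: algebra_simps)
    have "\<bar>- (2 * x) + 3\<bar> \<le> 3 * (\<bar>x\<bar> + 1)" for x :: real by (auto simp: abs_if)
    then show ?thesis unfolding eq .
  qed
  then have "2 * \<bar>?z' - ?e\<bar> / ?z' \<le> 2 * (3 * (?W + 1)) / ?z'"
    using z by (intro divide_right_mono) auto
  ultimately have "\<bar>D / ?e - D / ?z'\<bar> \<le> 2 * (3 * (?W + 1)) / ?z'" by linarith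
  then have "(1 - \<pi>) * \<bar>D / ?e - D / ?z'\<bar> \<le> (1 - \<pi>) * (2 * (3 * (?W + 1)) / ?z')"
    using pi_less_one by (intro mult_left_mono) auto
  also have "\<dots> = 6 * death_coeff * (?W + 1) / real j"
  proof -
    have "q * (2 * (3 * w) / (d * r)) = 6 * (q / d) * w / r" for q w d r :: real by simp
    then show ?thesis unfolding death_coeff_def .
  qed
  finally have "\<bar>(1 - \<pi>) * (D / ?e - D / ?z')\<bar> \<le> 6 * death_coeff * (?W + 1) / real j"
    using pi_less_one by (simp only: abs_mult)
  moreover have "(1 - \<pi>) * (D / ?e - D / ?z') = (1 - \<pi>) * (D / ?e) - death_coeff * D / real j"
    by (simp only: right_diff_distrib) (simp add: death_coeff_def)
  ultimately have 2: "\<bar>(1 - \<pi>) * (D / ?e) - death_coeff * D / real j\<bar> \<le> 6 * death_coeff * (?W + 1) / real j"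
    by (simp only:)
  \<comment> \<open>The loop term: \<open>total_weight\<close> is at least
    \<open>\<delta> * j / 2\<close>, because there are at least \<open>j / 2\<close>
    vertices.\<close>
  have 3: "\<bar>\<pi> * (\<delta> * (f 1 - f 0) / ?T)\<bar> \<le> 4 * (?W + 1) / real j"
  proof -
    have "\<bar>\<delta> * (f 1 - f 0)\<bar> \<le> \<delta> * 2"
      using f[of 0] f[of 1] delta_pos by (simp add: abs_mult)
    moreover have "?T \<ge> \<delta> * (real j / 2)"
    proof -
      have "\<delta> * (real j / 2) \<le> \<delta> * ?v" using ev delta_pos by (intro mult_left_mono) auto
      also have "\<dots> \<le> ?T" unfolding T using delta_pos by simp
      finally show ?thesis .
    qed
    ultimately have "\<bar>\<delta> * (f 1 - f 0)\<bar> / ?T \<le> (\<delta> * 2) / (\<delta> * (real j / 2))"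
      using delta_pos j by (intro frac_le) auto
    also have "\<dots> = 4 / real j" using delta_pos by simp
    finally have "\<pi> * (\<bar>\<delta> * (f 1 - f 0)\<bar> / ?T) \<le> 1 * (4 / real j)"
      using pi_less_one pi_gt_half total_weight_pos[of G] by (intro mult_mono) auto
    also have "\<dots> \<le> 4 * (?W + 1) / real j" by (simp add: divide_right_mono)
    finally show ?thesis using pi_gt_half total_weight_pos[of G] by (simp add: abs_mult)
  qed
  have eq: "\<pi> * ((B + \<delta> * (f 1 - f 0)) / ?T) + (1 - \<pi>) * (D / ?e) - deg_sum (bd.gen f) G / real j =
      (\<pi> * (B / ?T) - birth_coeff * B / real j) + ((1 - \<pi>) * (D / ?e) - death_coeff * D / real j)
      + \<pi> * (\<delta> * (f 1 - f 0) / ?T)"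
    unfolding deg_sum_gen B_def[symmetric] D_def[symmetric] by (simp add: add_divide_distrib distrib_left)
  have sum: "(2 * birth_coeff * (3 + \<delta>) + 6 * death_coeff + 4) * (?W + 1) / real j =
      2 * birth_coeff * (3 + \<delta>) * (?W + 1) / real j + 6 * death_coeff * (?W + 1) / real j + 4 * (?W + 1) / real j"
    by (simp only: distrib_right add_divide_distrib)
  show ?thesis unfolding eq sum using 1 2 3 by linarith
qed

text \<open>Nothing is approximated here: all terms are bounded by a constant, and the absence of
  edges forces \<open>\<bar>dev j G\<bar>\<close> to be of order \<open>j\<close>, so that
  \<open>(\<bar>dev j G\<bar> + 1) / j\<close> is bounded below. The term
  \<open>(1 - \<pi>) * f 0\<close> appears since the addition is certain instead of having
  probability \<open>\<pi>\<close>.\<close>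

lemma step_vs_gen_no_edges:
  assumes G: "admissible j G" and j: "j \<ge> 1" and f: "\<And>k. \<bar>f k\<bar> \<le> 1" and e: "num_edges G = 0"
  defines "B \<equiv> deg_sum (\<lambda>k. (real k + \<delta>) * (f (Suc k) - f k)) G"
  shows "\<bar>(1 - \<pi>) * f 0 + (B + \<delta> * (f 1 - f 0)) / total_weight G - deg_sum (bd.gen f) G / real j\<bar>
    \<le> (3 + 6 * birth_coeff * \<delta>) * (3 / (2 * \<pi> - 1)) * (\<bar>dev j G\<bar> + 1) / real j"
proof -
  have pf: "pair_fin_digraph G" using G by (rule admissible_pair_fin_digraph)
  let ?v = "real (num_verts G)" and ?T = "total_weight G" and ?W = "\<bar>dev j G\<bar>"
  have T: "?T = \<delta> * ?v + \<delta>" using e by (simp add: total_weight_def)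
  note v = admissible_num_verts_le[OF G]
  have B: "\<bar>B\<bar> \<le> 2 * (\<delta> * ?v)" using abs_birth_sum_le[OF pf f] e by (simp add: B_def)
  have "\<bar>\<delta> * (f 1 - f 0)\<bar> \<le> \<delta> * 2"
    using f[of 0] f[of 1] delta_pos by (simp add: abs_mult)
  with B have "\<bar>B + \<delta> * (f 1 - f 0)\<bar> \<le> 2 * ?T" by (simp add: T)
  then have 1: "\<bar>(B + \<delta> * (f 1 - f 0)) / ?T\<bar> \<le> 2"
    using total_weight_pos[of G] by (simp add: divide_le_eq)
  have 2: "\<bar>(1 - \<pi>) * f 0\<bar> \<le> 1"
    using pi_less_one pi_gt_half f[of 0] by (simp add: abs_mult mult_le_one)
  have "deg_sum (\<lambda>k. real k * (f (k - 1) - f k)) G = 0"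
    using abs_death_sum_le[OF pf f] e by simp
  then have "\<bar>deg_sum (bd.gen f) G / real j\<bar> = birth_coeff * \<bar>B\<bar> / real j"
    using bd.a_pos unfolding deg_sum_gen B_def[symmetric] by (simp add: abs_mult)
  also have "\<dots> \<le> birth_coeff * (2 * (\<delta> * (3 * real j))) / real j"
  proof (intro divide_right_mono mult_left_mono)
    have "2 * (\<delta> * ?v) \<le> 2 * (\<delta> * (3 * real j))"
      using v j delta_pos by (intro mult_left_mono) auto
    with B show "\<bar>B\<bar> \<le> 2 * (\<delta> * (3 * real j))" by linarith
  qed (use bd.a_pos in auto)
  also have "\<dots> = 6 * birth_coeff * \<delta>" using j by simp
  finally have 3: "\<bar>deg_sum (bd.gen f) G / real j\<bar> \<le> 6 * birth_coeff * \<delta>" .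
  have "real j \<le> 3 / (2 * \<pi> - 1) * (?W + 1)" (is "_ \<le> ?X")
  proof -
    have "(\<pi> - 1 / 2) * real j \<le> 3 / 2 * (?W + 1)"
      using dev_no_edges[OF G e] by (simp add: algebra_simps)
    then show ?thesis using pi_gt_half by (simp add: field_simps)
  qed
  then have "real j / real j \<le> ?X / real j" by (rule divide_right_mono) simp
  then have 4: "1 \<le> 3 / (2 * \<pi> - 1) * (?W + 1) / real j" using j by simp
  have "\<bar>(1 - \<pi>) * f 0 + (B + \<delta> * (f 1 - f 0)) / ?T - deg_sum (bd.gen f) G / real j\<bar> \<le> 3 + 6 * birth_coeff * \<delta>"
    using 1 2 3 by linarith
  also have "\<dots> \<le> (3 + 6 * birth_coeff * \<delta>) * (3 / (2 * \<pi> - 1) * (?W + 1) / real j)"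
    using mult_left_mono[OF 4, of "3 + 6 * birth_coeff * \<delta>"] bd.a_pos delta_pos by simp
  finally show ?thesis by (simp only: mult.assoc times_divide_eq_right times_divide_eq_left)
qed

definition drift_const :: real where
  "drift_const = (2 * birth_coeff * (3 + \<delta>) + 6 * death_coeff + 4)
     + (3 + 6 * birth_coeff * \<delta>) * (3 / (2 * \<pi> - 1)) + 18 * bd.total_coeff\<^sup>2"

text \<open>In the error, \<open>\<bar>dev j G\<bar> + 1\<close> stems from the denominators and
  \<open>A\<close> from freezing large degrees.\<close>

lemma drift:
  assumes G: "admissible j G" and j: "j \<ge> 1"
    and f1: "\<And>k. \<bar>f k\<bar> \<le> 1" and f: "\<And>k. \<bar>f k\<bar> \<le> A / (real k + 1)"
  shows "\<bar>measure_pmf.expectation (step \<pi> \<delta> G) (deg_sum f) - (deg_sum (bd.euler j f) G + \<pi> * f 0)\<bar>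
    \<le> drift_const * ((\<bar>dev j G\<bar> + 1 + A) / real j)"
proof -
  let ?W = "\<bar>dev j G\<bar>"
  let ?c1 = "2 * birth_coeff * (3 + \<delta>) + 6 * death_coeff + 4"
  let ?c2 = "(3 + 6 * birth_coeff * \<delta>) * (3 / (2 * \<pi> - 1))"
  let ?c3 = "18 * bd.total_coeff\<^sup>2"
  have A: "A \<ge> 0" using f[of 0] by simp
  have pf: "pair_fin_digraph G" using G by (rule admissible_pair_fin_digraph)
  have c: "?c1 \<ge> 0" "?c2 \<ge> 0" "?c3 \<ge> 0"
    using bd.a_pos bd.b_pos delta_pos pi_gt_half by simp_all
  have "\<bar>measure_pmf.expectation (step \<pi> \<delta> G) (deg_sum f) - deg_sum f G - \<pi> * f 0 - deg_sum (bd.gen f) G / real j\<bar>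
      \<le> (?c1 + ?c2) * (?W + 1) / real j"
  proof (cases "num_edges G > 0")
    case True
    have "\<bar>measure_pmf.expectation (step \<pi> \<delta> G) (deg_sum f) - deg_sum f G - \<pi> * f 0 - deg_sum (bd.gen f) G / real j\<bar>
        \<le> ?c1 * (?W + 1) / real j"
      using step_vs_gen_edges[of j G f] G j f1 True unfolding expectation_step_deg_sum[OF pf] Let_def
      by (simp add: distrib_left)
    also have "\<dots> \<le> (?c1 + ?c2) * (?W + 1) / real j"
      using c by (intro divide_right_mono mult_right_mono) auto
    finally show ?thesis .
  next
    case False
    then have e: "num_edges G = 0" by simp
    have "\<bar>measure_pmf.expectation (step \<pi> \<delta> G) (deg_sum f) - deg_sum f G - \<pi> * f 0 - deg_sum (bd.gen f) G / real j\<bar>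
        \<le> ?c2 * (?W + 1) / real j"
      using step_vs_gen_no_edges[of j G f] G j f1 e False unfolding expectation_step_deg_sum[OF pf] Let_def
      by (simp add: left_diff_distrib)
    also have "\<dots> \<le> (?c1 + ?c2) * (?W + 1) / real j"
      using c by (intro divide_right_mono mult_right_mono) auto
    finally show ?thesis .
  qed
  moreover have "\<bar>deg_sum (bd.gen f) G / real j - (deg_sum (bd.euler j f) G - deg_sum f G)\<bar> \<le> ?c3 * A / real j"
    using deg_sum_euler[OF G j f] by simp
  ultimately have "\<bar>measure_pmf.expectation (step \<pi> \<delta> G) (deg_sum f) - (deg_sum (bd.euler j f) G + \<pi> * f 0)\<bar>
      \<le> (?c1 + ?c2) * (?W + 1) / real j + ?c3 * A / real j"
    by linarith
  also have "\<dots> = ((?c1 + ?c2) * (?W + 1) + ?c3 * A) / real j" by (simp only: add_divide_distrib)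
  also have "\<dots> \<le> (drift_const * (?W + 1 + A)) / real j"
  proof (rule divide_right_mono)
    have "(c1 + c2) * w + c3 * A \<le> (c1 + c2 + c3) * (w + A)"
      if "c1 \<ge> 0" "c2 \<ge> 0" "c3 \<ge> 0" "w \<ge> 0" for c1 c2 c3 w :: real
      using that A by (simp add: algebra_simps)
    from this[OF c, of "?W + 1"] show "(?c1 + ?c2) * (?W + 1) + ?c3 * A \<le> drift_const * (?W + 1 + A)"
      by (simp only: drift_const_def)
  qed simp
  finally show ?thesis by simp
qed

lemma drift_const_nonneg: "drift_const \<ge> 0"
  using bd.a_pos bd.b_pos delta_pos pi_gt_half by (simp add: drift_const_def)

end

subsection \<open>Mean and exponential moments of the excess\<close>

locale attachment_deletion_limit = attachment_deletion +
  fixes p :: "nat pmf"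
  assumes p_rec: "\<And>k. pmf p k * (1 + bd.rate k) =
      (if k = 0 then 1 else birth_coeff * (real k - 1 + \<delta>) * pmf p (k - 1)) + death_coeff * (real k + 1) * pmf p (k + 1)"
    and p_mean: "summable (\<lambda>k. real k * pmf p k)"
begin

text \<open>Centred with the deterministic \<open>\<pi> * n\<close> and not with the number of
  vertices, so that only \<open>deg_sum\<close> is random in the recursion; \<open>dev\<close> pays
  for the exchange at the end.\<close>

definition excess :: "nat \<Rightarrow> (nat \<Rightarrow> real) \<Rightarrow> graph \<Rightarrow> real" where
  "excess n f G = deg_sum f G - \<pi> * real n * measure_pmf.expectation p f"

text \<open>The class carried by the induction: \<open>euler\<close> preserves the bound 1 and
  finite support and enlarges \<open>A\<close> slightly. No estimate depends on the size of the
  support.\<close>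

definition test_fun :: "real \<Rightarrow> (nat \<Rightarrow> real) \<Rightarrow> bool" where
  "test_fun A f \<longleftrightarrow> (\<forall>k. \<bar>f k\<bar> \<le> 1) \<and> (\<forall>k. \<bar>f k\<bar> \<le> A / (real k + 1)) \<and> (\<exists>N. \<forall>k\<ge>N. f k = 0)"

lemma test_fun_nonneg: "test_fun A f \<Longrightarrow> A \<ge> 0"
  unfolding test_fun_def by (metis abs_ge_zero div_by_1 add_0 of_nat_0 order_trans)

lemma test_fun_euler: "test_fun A f \<Longrightarrow> j \<ge> 1 \<Longrightarrow> test_fun (A * (1 + death_coeff / real j)) (bd.euler j f)"
  unfolding test_fun_def using bd.abs_euler_le_1 bd.abs_euler_le_decay bd.euler_eq_0 by meson

lemma test_fun_uminus: "test_fun A f \<Longrightarrow> test_fun A (\<lambda>k. - f k)"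
  by (auto simp: test_fun_def)

lemma excess_uminus: "excess n (\<lambda>k. - f k) G = - excess n f G"
  using deg_sum_cmult[of "-1" f G] by (simp add: excess_def)

definition step_const :: real where
  "step_const = drift_const + 3 * bd.total_coeff * measure_pmf.expectation p bd.rate"

lemma expectation_rate_nonneg: "measure_pmf.expectation p bd.rate \<ge> 0"
  by (intro integral_nonneg_AE) (simp add: bd.rate_nonneg)

lemma step_const_nonneg: "step_const \<ge> 0"
  using drift_const_nonneg bd.total_coeff_pos expectation_rate_nonneg by (simp add: step_const_def)

lemma expectation_step_diff:
  "pair_fin_digraph G \<Longrightarrow> measure_pmf.expectation (step \<pi> \<delta> G) (\<lambda>G'. h G' - c) =
    measure_pmf.expectation (step \<pi> \<delta> G) h - (c :: real)"
  using integrable_measure_pmf_finite[OF finite_set_step]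
  by (subst Bochner_Integration.integral_diff) auto

lemma excess_drift:
  assumes G: "admissible j G" and j: "j \<ge> 1" and f: "test_fun A f"
  shows "\<bar>measure_pmf.expectation (step \<pi> \<delta> G) (excess (Suc j) f) - excess j (bd.euler j f) G\<bar>
    \<le> step_const * ((\<bar>dev j G\<bar> + 1 + A) / real j)"
proof -
  from f obtain N where f1: "\<And>k. \<bar>f k\<bar> \<le> 1" and fA: "\<And>k. \<bar>f k\<bar> \<le> A / (real k + 1)"
    and fN: "\<And>k. k \<ge> N \<Longrightarrow> f k = 0"
    by (auto simp: test_fun_def)
  have A: "A \<ge> 0" using f by (rule test_fun_nonneg)
  let ?E = "measure_pmf.expectation p"
  let ?d = "real (Suc j) * ?E f - (real j * ?E (bd.euler j f) + f 0)"
  have "\<bar>\<pi> * ?d\<bar> \<le> 1 * (3 * bd.total_coeff * ?E bd.rate * (A / real j))"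
    unfolding abs_mult using bd.expectation_euler[OF p_rec p_mean j fA fN] pi_less_one pi_gt_half
    by (intro mult_mono) auto
  also have "\<dots> \<le> 3 * bd.total_coeff * ?E bd.rate * ((\<bar>dev j G\<bar> + 1 + A) / real j)"
    using bd.total_coeff_pos expectation_rate_nonneg unfolding mult_1
    by (intro mult_left_mono divide_right_mono) auto
  finally have 1: "\<bar>\<pi> * ?d\<bar> \<le> 3 * bd.total_coeff * ?E bd.rate * ((\<bar>dev j G\<bar> + 1 + A) / real j)" .
  have "measure_pmf.expectation (step \<pi> \<delta> G) (excess (Suc j) f) - excess j (bd.euler j f) G =
      (measure_pmf.expectation (step \<pi> \<delta> G) (deg_sum f) - (deg_sum (bd.euler j f) G + \<pi> * f 0)) - \<pi> * ?d"
    using expectation_step_diff[OF admissible_pair_fin_digraph[OF G], of "deg_sum f" "\<pi> * real (Suc j) * ?E f"]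
    by (simp add: excess_def[abs_def] algebra_simps)
  moreover have "\<bar>measure_pmf.expectation (step \<pi> \<delta> G) (deg_sum f) - (deg_sum (bd.euler j f) G + \<pi> * f 0)\<bar>
      \<le> drift_const * ((\<bar>dev j G\<bar> + 1 + A) / real j)"
    by (rule drift[OF G j f1 fA])
  moreover have "step_const * ((\<bar>dev j G\<bar> + 1 + A) / real j) = drift_const * ((\<bar>dev j G\<bar> + 1 + A) / real j)
      + 3 * bd.total_coeff * ?E bd.rate * ((\<bar>dev j G\<bar> + 1 + A) / real j)"
    by (simp only: step_const_def distrib_right)
  ultimately show ?thesis using 1 by linarith
qed

lemma abs_excess_le:
  assumes G: "admissible j G" and j: "j \<ge> 1" and f: "test_fun A f"
  shows "\<bar>excess j f G\<bar> \<le> 4 * real j"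
proof -
  have f1: "\<And>k. \<bar>f k\<bar> \<le> 1" using f by (simp add: test_fun_def)
  have "\<bar>deg_sum f G\<bar> \<le> deg_sum (\<lambda>k. \<bar>f k\<bar>) G" by (rule abs_deg_sum_le)
  also have "\<dots> \<le> deg_sum (\<lambda>k. 1) G" using f1 by (intro deg_sum_mono)
  also have "\<dots> \<le> 3 * real j" using admissible_num_verts_le[OF G] j by (simp add: deg_sum_const)
  finally have 1: "\<bar>deg_sum f G\<bar> \<le> 3 * real j" .
  have "\<bar>measure_pmf.expectation p f\<bar> \<le> measure_pmf.expectation p (\<lambda>k. \<bar>f k\<bar>)" by (rule integral_abs_bound)
  also have "\<dots> \<le> 1"
    using f1 by (intro measure_pmf.integral_le_const measure_pmf.integrable_const_bound[where B = 1]) auto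
  finally have "\<bar>\<pi> * real j * measure_pmf.expectation p f\<bar> \<le> (1 * real j) * 1"
    using pi_gt_half pi_less_one unfolding abs_mult by (intro mult_mono) auto
  with 1 show ?thesis unfolding excess_def by linarith
qed

text \<open>Rounded up to a natural number so that Bernoulli's inequality bounds
  \<open>1 + death_coeff / n\<close> by \<open>(1 + 1 / n) ^ decay_exp\<close>, whose product over
  time telescopes.\<close>

definition decay_exp :: nat where "decay_exp = nat \<lceil>death_coeff\<rceil>"

lemma death_coeff_le: "death_coeff \<le> real decay_exp"
  unfolding decay_exp_def by (rule real_nat_ceiling_ge)

lemma decay_growth:
  assumes n: "n \<ge> 1" and m: "m > 0" and A: "A \<ge> 0"
  shows "A * (1 + death_coeff / real n) * (real n / m) ^ decay_exp \<le> A * (real (Suc n) / m) ^ decay_exp"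
proof -
  have "1 + death_coeff / real n \<le> 1 + real decay_exp * (1 / real n)"
    using death_coeff_le n by (simp add: divide_right_mono)
  also have "\<dots> \<le> (1 + 1 / real n) ^ decay_exp"
    using n by (intro Bernoulli_inequality) (simp add: order_trans[of _ 0])
  finally have "(1 + death_coeff / real n) * (real n / m) ^ decay_exp \<le> (1 + 1 / real n) ^ decay_exp * (real n / m) ^ decay_exp"
    using m by (intro mult_right_mono) auto
  also have "\<dots> = (real (Suc n) / m) ^ decay_exp"
  proof -
    have "(1 + 1 / real n) * (real n / m) = real (Suc n) / m" using n m by (simp add: field_simps)
    then show ?thesis by (simp only: power_mult_distrib[symmetric])
  qed
  finally show ?thesis using A by (simp add: mult.assoc mult_left_mono)
qed

text \<open>Bounds the decay constant of a test function carried back from time \<open>n\<close> to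
  time \<open>m\<close>. By \<open>decay_at_euler\<close> the bound for time \<open>Suc n\<close>
  already pays for the next \<open>euler\<close> step.\<close>

definition decay_at :: "nat \<Rightarrow> nat \<Rightarrow> real \<Rightarrow> real" where
  "decay_at m n A = A * (real n / real m) ^ decay_exp"

lemma decay_at_euler:
  assumes "n \<ge> m" "m \<ge> 1" "A \<ge> 0"
  shows "decay_at m n (A * (1 + death_coeff / real n)) \<le> decay_at m (Suc n) A"
  using decay_growth[of n "real m" A] assms by (simp add: decay_at_def)

lemma le_decay_at:
  assumes "n \<ge> m" "m \<ge> 1" "A \<ge> 0"
  shows "A \<le> decay_at m n A"
proof -
  have "1 \<le> (real n / real m) ^ decay_exp" using assms by (intro one_le_power) simp
  from mult_left_mono[OF this assms(3)] show ?thesis by (simp add: decay_at_def)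
qed

text \<open>The left side bounds the error due to \<open>dev\<close> in one step; it is dominated by
  an increment of \<open>12 * sqrt\<close>, so the errors telescope.\<close>

lemma sqrt_step:
  assumes "n \<ge> 1"
  shows "(2 * sqrt (real n + 1) + 1) / real n \<le> 12 * (sqrt (real n + 1) - sqrt (real n))"
proof -
  let ?s = "sqrt (real n + 1)" and ?r = "sqrt (real n)"
  have r: "?r \<ge> 1" "?r * ?r = real n" and s: "?s * ?s = real n + 1" using assms by auto
  have "real n + 1 \<le> (3 / 2 * ?r)\<^sup>2" using assms by (simp add: power_mult_distrib power2_eq_square)
  then have sr: "?s \<le> 3 / 2 * ?r" using r by (intro real_le_lsqrt) auto
  have "2 * ?s + 1 \<le> 4 * ?r" "?s + ?r \<le> 5 / 2 * ?r" using sr r(1) by linarith+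
  then have "(2 * ?s + 1) * (?s + ?r) \<le> (4 * ?r) * (5 / 2 * ?r)"
    by (intro mult_mono) auto
  also have "\<dots> \<le> 12 * real n" using r by simp
  also have "12 * real n = 12 * real n * ((?s - ?r) * (?s + ?r))"
    using r s by (simp add: algebra_simps)
  finally have "(2 * ?s + 1) * (?s + ?r) \<le> (12 * (?s - ?r) * real n) * (?s + ?r)" by (simp only: mult_ac)
  then have "2 * ?s + 1 \<le> 12 * (?s - ?r) * real n"
    using r by (subst (asm) mult_le_cancel_right_pos) (auto intro: add_nonneg_pos)
  then show ?thesis using assms by (simp add: divide_le_eq)
qed

text \<open>The step from \<open>n\<close> to \<open>Suc n\<close> replaces \<open>f\<close> by
  \<open>bd.euler n f\<close> and \<open>A\<close> by a larger constant, hence the induction for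
  arbitrary \<open>f\<close> and \<open>A\<close>. Started at \<open>m\<close>, it loses the trivial
  bound \<open>4 * m\<close> there and the drift errors afterwards.\<close>

lemma expectation_excess:
  assumes m: "m \<ge> 1" and n: "n \<ge> m" and f: "test_fun A f"
  shows "\<bar>measure_pmf.expectation (law n) (excess n f)\<bar> \<le>
    4 * real m + step_const * (12 * sqrt (real n) + (real n - real m) * (decay_at m n A / real m))"
  using n f
proof (induction n arbitrary: f A rule: dec_induct)
  case base
  have "\<bar>measure_pmf.expectation (law m) (excess m f)\<bar> \<le> measure_pmf.expectation (law m) (\<lambda>G. \<bar>excess m f G\<bar>)"
    by (rule integral_abs_bound)
  also have "\<dots> \<le> measure_pmf.expectation (law m) (\<lambda>G. 4 * real m)"
    by (intro expectation_law_mono abs_excess_le[OF _ m base])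
  finally have "\<bar>measure_pmf.expectation (law m) (excess m f)\<bar> \<le> 4 * real m" by simp
  moreover have "0 \<le> step_const * (12 * sqrt (real m))"
    using step_const_nonneg by (intro mult_nonneg_nonneg) auto
  ultimately show ?case unfolding diff_self mult_zero_left add_0_right by linarith
next
  case (step n)
  let ?A = "A * (1 + death_coeff / real n)" and ?g = "bd.euler n f"
  have n: "n \<ge> 1" using step m by linarith
  have A: "A \<ge> 0" using step.prems by (rule test_fun_nonneg)
  have "\<bar>measure_pmf.expectation (law (Suc n)) (excess (Suc n) f) - measure_pmf.expectation (law n) (excess n ?g)\<bar>
      = \<bar>measure_pmf.expectation (law n) (\<lambda>G. measure_pmf.expectation (step \<pi> \<delta> G) (excess (Suc n) f) - excess n ?g G)\<bar>"
    by (simp add: expectation_law_Suc)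
  also have "\<dots> \<le> measure_pmf.expectation (law n) (\<lambda>G. \<bar>measure_pmf.expectation (step \<pi> \<delta> G) (excess (Suc n) f) - excess n ?g G\<bar>)"
    by (rule integral_abs_bound)
  also have "\<dots> \<le> measure_pmf.expectation (law n) (\<lambda>G. step_const * ((\<bar>dev n G\<bar> + 1 + A) / real n))"
    by (intro expectation_law_mono excess_drift n step.prems)
  also have "\<dots> = step_const * ((measure_pmf.expectation (law n) (\<lambda>G. \<bar>dev n G\<bar>) + 1 + A) / real n)"
    by simp
  also have "\<dots> \<le> step_const * ((2 * sqrt (real n + 1) + 1 + A) / real n)"
    using expectation_abs_dev[of n] step_const_nonneg by (intro mult_left_mono divide_right_mono) auto
  also have "\<dots> = step_const * ((2 * sqrt (real n + 1) + 1) / real n + A / real n)"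
    by (simp add: add_divide_distrib)
  also have "\<dots> \<le> step_const * (12 * (sqrt (real n + 1) - sqrt (real n)) + decay_at m (Suc n) A / real m)"
    using sqrt_step[OF n] step_const_nonneg le_decay_at[of m "Suc n" A] A m step.hyps
    by (intro mult_left_mono add_mono frac_le) auto
  finally have 1: "\<bar>measure_pmf.expectation (law (Suc n)) (excess (Suc n) f) - measure_pmf.expectation (law n) (excess n ?g)\<bar>
      \<le> step_const * (12 * (sqrt (real n + 1) - sqrt (real n)) + decay_at m (Suc n) A / real m)" .
  have "\<bar>measure_pmf.expectation (law n) (excess n ?g)\<bar> \<le>
      4 * real m + step_const * (12 * sqrt (real n) + (real n - real m) * (decay_at m n ?A / real m))"
    by (intro step.IH test_fun_euler step.prems n)
  also have "\<dots> \<le> 4 * real m + step_const * (12 * sqrt (real n) + (real n - real m) * (decay_at m (Suc n) A / real m))"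
    using step_const_nonneg decay_at_euler[OF step.hyps(1) m A] step.hyps m
    by (intro add_left_mono mult_left_mono divide_right_mono) auto
  finally have 2: "\<bar>measure_pmf.expectation (law n) (excess n ?g)\<bar> \<le>
      4 * real m + step_const * (12 * sqrt (real n) + (real n - real m) * (decay_at m (Suc n) A / real m))" .
  have "4 * real m + step_const * (12 * sqrt (real (Suc n)) + (real (Suc n) - real m) * (decay_at m (Suc n) A / real m)) =
      (4 * real m + step_const * (12 * sqrt (real n) + (real n - real m) * (decay_at m (Suc n) A / real m)))
      + step_const * (12 * (sqrt (real n + 1) - sqrt (real n)) + decay_at m (Suc n) A / real m)"
  proof -
    have "real (Suc n) - real m = (real n - real m) + 1" "real (Suc n) = real n + 1" by simp_all
    then show ?thesis by (simp only: distrib_right distrib_left right_diff_distrib mult_1)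
  qed
  then show ?case using 1 2 by linarith
qed

text \<open>At most three values of \<open>f\<close> enter the change. The resulting range of length
  6 gives the factor \<open>36 / 8 = 9 / 2\<close> in the exponential moments.\<close>

lemma deg_sum_step_range:
  assumes G: "pair_fin_digraph G" and f: "\<And>k. \<bar>f k\<bar> \<le> 1" and G': "G' \<in> set_pmf (step \<pi> \<delta> G)"
  shows "deg_sum f G' \<in> {deg_sum f G - 3 .. deg_sum f G + 3}"
  using G G'
proof (cases rule: step_cases)
  case (attach u)
  then show ?thesis using deg_sum_attach[OF G attach(1), of f] f[of 0] f[of "indeg G u"] f[of "Suc (indeg G u)"]
    by (auto simp: abs_le_iff)
next
  case (remove e)
  then show ?thesis using deg_sum_remove_edge[OF G remove(1), of f] f[of "indeg G (snd e)"] f[of "indeg G (snd e) - 1"]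
    by (auto simp: abs_le_iff)
qed

text \<open>Truncating the exponential at one lets the induction absorb the graphs with an untypical
  number of vertices at the cost of their probability.\<close>

lemma expectation_exp_excess:
  assumes m: "m \<ge> 1" and n: "n \<ge> m" and f: "test_fun A f" and l: "l \<ge> 0" and \<eta>: "\<eta> \<ge> 0"
  shows "measure_pmf.expectation (law n) (\<lambda>G. min 1 (exp (l * (excess n f G - t)))) \<le>
    exp (l * (4 * real m + (real n - real m) * (step_const * (\<eta> + (1 + decay_at m n A) / real m)) - t)
      + 9 / 2 * l\<^sup>2 * (real n - real m))
    + (\<Sum>j=m..<n. measure_pmf.prob (law j) {G. \<bar>dev j G\<bar> > \<eta> * real j})"
  using n f
proof (induction n arbitrary: f A t rule: dec_induct)
  case base
  have "measure_pmf.expectation (law m) (\<lambda>G. min 1 (exp (l * (excess m f G - t)))) \<le>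
      measure_pmf.expectation (law m) (\<lambda>G. exp (l * (4 * real m - t)))"
  proof (rule expectation_law_mono)
    fix G assume "admissible m G"
    from abs_excess_le[OF this m base] have "l * (excess m f G - t) \<le> l * (4 * real m - t)"
      using l by (intro mult_left_mono) auto
    then show "min 1 (exp (l * (excess m f G - t))) \<le> exp (l * (4 * real m - t))"
      by (simp add: min.coboundedI2)
  qed
  then show ?case by simp
next
  case (step n)
  let ?A = "A * (1 + death_coeff / real n)" and ?g = "bd.euler n f"
  let ?bad = "{G. \<bar>dev n G\<bar> > \<eta> * real n}"
  \<comment> \<open>\<open>?err\<close> bounds the drift error outside \<open>?bad\<close>. In
    \<open>?t\<close> the threshold is lowered by it and by \<open>9 / 2 * l\<close>, the Hoeffding
    exponent divided by \<open>l\<close>, so the hypothesis applies to the same kind of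
    expression.\<close>
  let ?err = "step_const * (\<eta> + (1 + A) / real m)"
  let ?t = "t - ?err - 9 / 2 * l"
  have n: "n \<ge> 1" using step m by linarith
  have A: "A \<ge> 0" using step.prems by (rule test_fun_nonneg)
  have f1: "\<And>k. \<bar>f k\<bar> \<le> 1" using step.prems by (simp add: test_fun_def)
  have "measure_pmf.expectation (step \<pi> \<delta> G) (\<lambda>G'. min 1 (exp (l * (excess (Suc n) f G' - t)))) \<le>
      min 1 (exp (l * (excess n ?g G - ?t))) + indicator ?bad G"
    if G: "admissible n G" for G
  proof -
    have pf: "pair_fin_digraph G" using G by (rule admissible_pair_fin_digraph)
    let ?E = "measure_pmf.expectation (step \<pi> \<delta> G)"
    let ?X = "\<lambda>G'. exp (l * (excess (Suc n) f G' - t))"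
    have int: "integrable (measure_pmf (step \<pi> \<delta> G)) h" for h :: "graph \<Rightarrow> real"
      by (rule integrable_measure_pmf_finite[OF finite_set_step[OF pf]])
    have le1: "?E (\<lambda>G'. min 1 (?X G')) \<le> 1"
      by (rule measure_pmf.integral_le_const[OF int]) auto
    show ?thesis
    proof (cases "G \<in> ?bad")
      case True
      then show ?thesis using le1 by (simp add: add_increasing)
    next
      case False
      then have dev: "\<bar>dev n G\<bar> \<le> \<eta> * real n" by simp
      have "(\<bar>dev n G\<bar> + 1 + A) / real n \<le> (\<eta> * real n + 1 + A) / real n"
        using dev by (intro divide_right_mono) auto
      also have "\<dots> = \<eta> + (1 + A) / real n" using n by (simp add: add_divide_distrib)
      also have "\<dots> \<le> \<eta> + (1 + A) / real m"
        using step.hyps m A by (intro add_left_mono divide_left_mono) auto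
      finally have "step_const * ((\<bar>dev n G\<bar> + 1 + A) / real n) \<le> ?err"
        using step_const_nonneg by (rule mult_left_mono)
      with excess_drift[OF G n step.prems]
      have mean: "?E (excess (Suc n) f) \<le> excess n ?g G + ?err" by linarith
      let ?c = "\<pi> * real (Suc n) * measure_pmf.expectation p f"
      have range: "excess (Suc n) f G' \<in> {deg_sum f G - 3 - ?c .. deg_sum f G + 3 - ?c}"
        if "G' \<in> set_pmf (step \<pi> \<delta> G)" for G'
        using deg_sum_step_range[OF pf f1 that] by (simp add: excess_def)
      have "?E (\<lambda>G'. min 1 (?X G')) \<le> ?E ?X"
        by (intro integral_mono int) auto
      also have "\<dots> = exp (- (l * t)) * ?E (\<lambda>G'. exp (l * excess (Suc n) f G'))"
        by (simp add: exp_add[symmetric] right_diff_distrib flip: integral_mult_right_zero)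
      also have "\<dots> \<le> exp (- (l * t)) * exp (l * ?E (excess (Suc n) f) + 9 / 2 * l\<^sup>2)"
        using expectation_exp_le_pmf[OF finite_set_step[OF pf], where h = "excess (Suc n) f" and \<theta> = l, OF range]
        by (intro mult_left_mono) (simp_all add: mult.commute)
      also have "\<dots> = exp (l * (?E (excess (Suc n) f) - (t - 9 / 2 * l)))"
        by (simp add: exp_add[symmetric] power2_eq_square algebra_simps)
      also have "\<dots> \<le> exp (l * (excess n ?g G - ?t))"
      proof -
        have "l * (?E (excess (Suc n) f) - (t - 9 / 2 * l)) \<le> l * (excess n ?g G - ?t)"
          using mean l by (intro mult_left_mono) auto
        then show ?thesis by simp
      qed
      finally show ?thesis using le1 False by simp
    qed
  qed
  then have "measure_pmf.expectation (law (Suc n)) (\<lambda>G'. min 1 (exp (l * (excess (Suc n) f G' - t)))) \<le>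
      measure_pmf.expectation (law n) (\<lambda>G. min 1 (exp (l * (excess n ?g G - ?t))) + indicator ?bad G)"
    unfolding expectation_law_Suc by (rule expectation_law_mono)
  also have "\<dots> = measure_pmf.expectation (law n) (\<lambda>G. min 1 (exp (l * (excess n ?g G - ?t)))) + measure_pmf.prob (law n) ?bad"
    by simp
  also have "measure_pmf.expectation (law n) (\<lambda>G. min 1 (exp (l * (excess n ?g G - ?t)))) \<le>
      exp (l * (4 * real m + (real n - real m) * (step_const * (\<eta> + (1 + decay_at m n ?A) / real m)) - ?t)
        + 9 / 2 * l\<^sup>2 * (real n - real m))
      + (\<Sum>j=m..<n. measure_pmf.prob (law j) {G. \<bar>dev j G\<bar> > \<eta> * real j})"
    by (intro step.IH test_fun_euler step.prems n)
  also have "exp (l * (4 * real m + (real n - real m) * (step_const * (\<eta> + (1 + decay_at m n ?A) / real m)) - ?t)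
        + 9 / 2 * l\<^sup>2 * (real n - real m)) \<le>
      exp (l * (4 * real m + (real (Suc n) - real m) * (step_const * (\<eta> + (1 + decay_at m (Suc n) A) / real m)) - t)
        + 9 / 2 * l\<^sup>2 * (real (Suc n) - real m))"
  proof -
    let ?e = "step_const * (\<eta> + (1 + decay_at m (Suc n) A) / real m)"
    have "(real n - real m) * (step_const * (\<eta> + (1 + decay_at m n ?A) / real m)) \<le> (real n - real m) * ?e"
      using decay_at_euler[OF step.hyps(1) m A] step_const_nonneg step.hyps m
      by (intro mult_left_mono add_left_mono divide_right_mono) auto
    moreover have "?err \<le> ?e"
      using le_decay_at[of m "Suc n" A] A step_const_nonneg step.hyps m
      by (intro mult_left_mono add_left_mono divide_right_mono) auto
    moreover have "(real (Suc n) - real m) * ?e = (real n - real m) * ?e + ?e"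
    proof -
      have "real (Suc n) - real m = (real n - real m) + 1" by simp
      then show ?thesis by (simp only: distrib_right mult_1)
    qed
    ultimately have "(4 * real m + (real n - real m) * (step_const * (\<eta> + (1 + decay_at m n ?A) / real m)) - ?t)
        \<le> 4 * real m + (real (Suc n) - real m) * ?e - t + 9 / 2 * l"
      by linarith
    from mult_left_mono[OF this l]
    have "l * (4 * real m + (real n - real m) * (step_const * (\<eta> + (1 + decay_at m n ?A) / real m)) - ?t)
        \<le> l * (4 * real m + (real (Suc n) - real m) * ?e - t) + 9 / 2 * l\<^sup>2"
      by (simp only: distrib_left) (simp add: power2_eq_square)
    moreover have "9 / 2 * l\<^sup>2 * (real (Suc n) - real m) = 9 / 2 * l\<^sup>2 * (real n - real m) + 9 / 2 * l\<^sup>2"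
    proof -
      have "real (Suc n) - real m = (real n - real m) + 1" by simp
      then show ?thesis by (simp only: distrib_left mult_1_right)
    qed
    moreover have "exp (x + y) \<le> exp (x' + y')" if "x \<le> x' + z" "y' = y + z" for x x' y y' z :: real
      using that by simp
    ultimately show ?thesis by blast
  qed
  finally show ?case using step.hyps by simp
qed

end

subsection \<open>Convergence in mean\<close>

lemma sum_deg_count:
  assumes "pair_fin_digraph G" "finite S"
  shows "(\<Sum>k\<in>S. c k * real (deg_count k G)) = deg_sum (\<lambda>k. if k \<in> S then c k else 0) G"
proof -
  have "(\<Sum>k\<in>S. c k * real (deg_count k G)) = (\<Sum>k\<in>S. \<Sum>u\<in>pverts G. c k * indicator {k} (indeg G u))"
    by (simp only: deg_sum_indicator[OF assms(1), symmetric] deg_sum_def sum_distrib_left)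
  also have "\<dots> = (\<Sum>u\<in>pverts G. \<Sum>k\<in>S. c k * indicator {k} (indeg G u))"
    by (rule sum.swap)
  also have "\<dots> = deg_sum (\<lambda>k. if k \<in> S then c k else 0) G"
    unfolding deg_sum_def using assms(2)
    by (intro sum.cong refl) (simp add: indicator_def if_distrib[of "\<lambda>x. _ * x"] cong: if_cong)
  finally show ?thesis .
qed

context attachment_deletion_limit
begin

abbreviation E :: "nat \<Rightarrow> (graph \<Rightarrow> real) \<Rightarrow> real" where
  "E n \<equiv> measure_pmf.expectation (law n)"

lemma sum_expectation_deg_frac:
  assumes "finite S"
  shows "(\<Sum>k\<in>S. c k * E n (deg_frac k)) = E n (\<lambda>G. deg_sum (\<lambda>k. if k \<in> S then c k else 0) G / num_verts G)"
proof -
  have "(\<Sum>k\<in>S. c k * E n (deg_frac k)) = E n (\<lambda>G. \<Sum>k\<in>S. c k * deg_frac k G)"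
    by simp
  also have "\<dots> = E n (\<lambda>G. deg_sum (\<lambda>k. if k \<in> S then c k else 0) G / num_verts G)"
  proof (intro antisym expectation_law_mono)
    fix G assume "admissible n G"
    from sum_deg_count[OF admissible_pair_fin_digraph[OF this] assms, of c]
    have "(\<Sum>k\<in>S. c k * deg_frac k G) = deg_sum (\<lambda>k. if k \<in> S then c k else 0) G / num_verts G"
      by (simp add: deg_frac_def sum_divide_distrib[symmetric])
    then show "(\<Sum>k\<in>S. c k * deg_frac k G) \<le> deg_sum (\<lambda>k. if k \<in> S then c k else 0) G / num_verts G"
      "deg_sum (\<lambda>k. if k \<in> S then c k else 0) G / num_verts G \<le> (\<Sum>k\<in>S. c k * deg_frac k G)"
      by simp_all
  qed
  finally show ?thesis .
qed

lemma abs_expectation_p_le: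
  fixes f :: "nat \<Rightarrow> real"
  assumes f1: "\<And>k. \<bar>f k\<bar> \<le> 1"
  shows "\<bar>measure_pmf.expectation p f\<bar> \<le> 1"
proof -
  have "\<bar>measure_pmf.expectation p f\<bar> \<le> measure_pmf.expectation p (\<lambda>k. \<bar>f k\<bar>)" by (rule integral_abs_bound)
  also have "\<dots> \<le> 1"
    using f1 by (intro measure_pmf.integral_le_const measure_pmf.integrable_const_bound[where B = 1]) auto
  finally show ?thesis .
qed

lemma abs_deg_sum_le_num_verts: "(\<And>k. \<bar>f k\<bar> \<le> 1) \<Longrightarrow> \<bar>deg_sum f G\<bar> \<le> num_verts G"
  using abs_deg_sum_le[of f G] deg_sum_mono[of "\<lambda>k. \<bar>f k\<bar>" "\<lambda>k. 1" G] by (simp add: deg_sum_const)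

text \<open>Exchanges the random denominator for \<open>\<pi> * n\<close>. The ratio and the limit
  differ by at most 2, and recentring adds one more, hence
  \<open>3 * \<bar>dev n G\<bar>\<close>.\<close>

lemma expectation_ratio:
  assumes n: "n \<ge> 1" and f: "\<And>k. \<bar>f k\<bar> \<le> 1"
  shows "\<bar>E n (\<lambda>G. deg_sum f G / num_verts G) - measure_pmf.expectation p f\<bar>
    \<le> (\<bar>E n (excess n f)\<bar> + 3 * E n (\<lambda>G. \<bar>dev n G\<bar>)) / (\<pi> * real n)"
proof -
  let ?m = "measure_pmf.expectation p f" and ?s = "\<pi> * real n"
  have s: "?s > 0" using n pi_gt_half by simp
  have m: "\<bar>?m\<bar> \<le> 1" using f by (rule abs_expectation_p_le)
  have le: "\<bar>deg_sum f G / num_verts G - ?m - excess n f G / ?s\<bar> \<le> 3 * \<bar>dev n G\<bar> / ?s"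
    if G: "admissible n G" for G
  proof -
    let ?v = "real (num_verts G)"
    have v: "?v > 0" using admissible_num_verts_le[OF G] by linarith
    define X where "X = deg_sum f G - ?v * ?m"
    have "\<bar>?v * ?m\<bar> \<le> ?v" using m by (simp add: abs_mult mult_left_le)
    moreover have "\<bar>deg_sum f G\<bar> \<le> ?v" using f by (rule abs_deg_sum_le_num_verts)
    ultimately have "\<bar>X\<bar> \<le> 2 * ?v" unfolding X_def by linarith
    then have 1: "\<bar>X / ?v\<bar> \<le> 2" using v by (simp add: divide_le_eq)
    have 2: "\<bar>dev n G * ?m\<bar> \<le> \<bar>dev n G\<bar>" using m by (simp add: abs_mult mult_left_le)
    have "deg_sum f G / ?v - ?m - excess n f G / ?s = - (X / ?v * dev n G + dev n G * ?m) / ?s"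
    proof -
      have "(x + d * c) / s - x / (s + d) = (x / (s + d) * d + d * c) / s" if "s + d > 0" "s > 0" for x d c s :: real
        using that by (simp add: field_simps)
      moreover have "?s + dev n G = ?v" by (simp add: dev_def)
      ultimately have "(X + dev n G * ?m) / ?s - X / ?v = (X / ?v * dev n G + dev n G * ?m) / ?s"
        using v s by metis
      moreover have "deg_sum f G / ?v - ?m = X / ?v" using v by (simp add: X_def diff_divide_distrib)
      moreover have "excess n f G = X + dev n G * ?m" by (simp add: X_def excess_def dev_def algebra_simps)
      ultimately show ?thesis by (simp only: minus_divide_left[symmetric])
    qed
    also have "\<bar>\<dots>\<bar> = \<bar>X / ?v * dev n G + dev n G * ?m\<bar> / ?s"
      by (simp only: abs_divide abs_minus_cancel abs_of_pos[OF s])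
    also have "\<dots> \<le> 3 * \<bar>dev n G\<bar> / ?s"
    proof (rule divide_right_mono)
      have "\<bar>X / ?v * dev n G\<bar> \<le> 2 * \<bar>dev n G\<bar>"
        unfolding abs_mult using 1 by (intro mult_right_mono) auto
      with 2 show "\<bar>X / ?v * dev n G + dev n G * ?m\<bar> \<le> 3 * \<bar>dev n G\<bar>" by linarith
    qed (use s in auto)
    finally show ?thesis .
  qed
  have "\<bar>E n (\<lambda>G. deg_sum f G / num_verts G) - ?m - E n (excess n f) / ?s\<bar> =
      \<bar>E n (\<lambda>G. deg_sum f G / num_verts G - ?m - excess n f G / ?s)\<bar>"
    by simp
  also have "\<dots> \<le> E n (\<lambda>G. \<bar>deg_sum f G / num_verts G - ?m - excess n f G / ?s\<bar>)"
    by (rule integral_abs_bound)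
  also have "\<dots> \<le> E n (\<lambda>G. 3 * \<bar>dev n G\<bar> / ?s)"
    by (intro expectation_law_mono le)
  also have "\<dots> = 3 * E n (\<lambda>G. \<bar>dev n G\<bar>) / ?s" by simp
  finally have "\<bar>E n (\<lambda>G. deg_sum f G / num_verts G) - ?m - E n (excess n f) / ?s\<bar> \<le> 3 * E n (\<lambda>G. \<bar>dev n G\<bar>) / ?s" .
  moreover have "\<bar>E n (excess n f) / ?s\<bar> = \<bar>E n (excess n f)\<bar> / ?s" using s by simp
  ultimately show ?thesis unfolding add_divide_distrib by linarith
qed

definition conv_exp :: real where "conv_exp = 1 / (real decay_exp + 3)"

lemma conv_exp: "conv_exp > 0" "conv_exp \<le> 1 / 3" "conv_exp * (real decay_exp + 3) = 1"
  by (simp_all add: conv_exp_def field_simps)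

lemma powr_conv:
  assumes "n \<ge> 1"
  shows "real n powr (1 - conv_exp) = real n * real n powr (- conv_exp)"
  using assms by (simp add: powr_diff powr_minus divide_inverse)

text \<open>The time horizon starts at \<open>n powr (1 - \<kappa>)\<close>; with \<open>\<kappa> * (B + 3) = 1\<close> the decay of the test function
  then costs at most \<open>n powr (1 - \<kappa>)\<close> as well.\<close>

lemma expectation_excess_powr:
  assumes n: "n \<ge> 1" and f: "test_fun (real n powr conv_exp + 1) f"
  shows "\<bar>E n (excess n f)\<bar> \<le> (8 + 14 * step_const) * real n powr (1 - conv_exp)"
proof -
  let ?\<kappa> = conv_exp and ?B = decay_exp
  let ?x = "real n powr (1 - ?\<kappa>)"
  let ?A = "real n powr ?\<kappa> + 1"
  define m where "m = nat \<lceil>?x\<rceil>"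
  have n1: "real n \<ge> 1" using n by simp
  have x1: "?x \<ge> 1" using n1 conv_exp by (intro ge_one_powr_ge_zero) auto
  have k1: "real n powr ?\<kappa> \<ge> 1" using n1 conv_exp by (intro ge_one_powr_ge_zero) auto
  have xm: "?x \<le> real m" unfolding m_def by (rule real_nat_ceiling_ge)
  have mx: "real m \<le> 2 * ?x" using x1 unfolding m_def by linarith
  have m1: "m \<ge> 1" using xm x1 by linarith
  have "?x \<le> real n powr 1" using n1 conv_exp by (intro powr_mono) auto
  then have "?x \<le> real n" using n1 by simp
  then have mn: "m \<le> n" unfolding m_def by (simp add: ceiling_le_iff nat_le_iff)
  have "sqrt (real n) = real n powr (1 / 2)" by (simp add: powr_half_sqrt)
  also have "\<dots> \<le> ?x" using n1 conv_exp by (intro powr_mono) auto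
  finally have sq: "sqrt (real n) \<le> ?x" .
  have "real n / real m \<le> real n / ?x"
    using xm x1 m1 n by (intro divide_left_mono mult_pos_pos) auto
  also have "\<dots> = real n powr ?\<kappa>" using n1 by (simp add: powr_diff)
  finally have nm: "real n / real m \<le> real n powr ?\<kappa>" .
  have "decay_at m n ?A \<le> (2 * real n powr ?\<kappa>) * (real n powr ?\<kappa>) ^ ?B"
    unfolding decay_at_def using nm k1 by (intro mult_mono power_mono) auto
  moreover have "(real n - real m) / real m \<le> real n powr ?\<kappa>"
  proof -
    have "(real n - real m) / real m \<le> real n / real m" by (intro divide_right_mono) auto
    with nm show ?thesis by linarith
  qed
  \<comment> \<open>One factor \<open>n powr conv_exp\<close> comes from \<open>n / m\<close>, one
    from \<open>A\<close> and \<open>decay_exp\<close> many from the decay; the exponents sum to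
    \<open>1 - conv_exp\<close>.\<close>
  ultimately have "(real n - real m) / real m * decay_at m n ?A \<le>
      real n powr ?\<kappa> * ((2 * real n powr ?\<kappa>) * (real n powr ?\<kappa>) ^ ?B)"
    using mn m1 by (intro mult_mono) (auto simp: decay_at_def)
  also have "\<dots> = 2 * real n powr (?\<kappa> + (?\<kappa> + ?\<kappa> * real ?B))"
  proof -
    have "(real n powr ?\<kappa>) ^ ?B = real n powr (?\<kappa> * real ?B)"
      using n1 by (simp add: powr_powr flip: powr_realpow)
    then show ?thesis by (simp only: powr_add mult_ac)
  qed
  also have "?\<kappa> + (?\<kappa> + ?\<kappa> * real ?B) = 1 - ?\<kappa>"
    using conv_exp(3) by (simp add: algebra_simps)
  finally have dec: "(real n - real m) * (decay_at m n ?A / real m) \<le> 2 * ?x" by simp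
  have "\<bar>E n (excess n f)\<bar> \<le> 4 * real m + step_const * (12 * sqrt (real n) + (real n - real m) * (decay_at m n ?A / real m))"
    by (rule expectation_excess[OF m1 mn f])
  also have "\<dots> \<le> 4 * (2 * ?x) + step_const * (12 * ?x + 2 * ?x)"
    using mx sq dec step_const_nonneg by (intro add_mono mult_left_mono) auto
  finally show ?thesis by (simp add: algebra_simps)
qed

lemma tail_p:
  assumes "finite S" "\<And>k. k \<in> S \<Longrightarrow> real k \<ge> x" "x > 0"
  shows "(\<Sum>k\<in>S. pmf p k) \<le> (\<Sum>k. real k * pmf p k) / x"
proof -
  have "x * (\<Sum>k\<in>S. pmf p k) \<le> (\<Sum>k\<in>S. real k * pmf p k)"
    unfolding sum_distrib_left using assms by (intro sum_mono mult_right_mono) auto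
  also have "\<dots> \<le> (\<Sum>k. real k * pmf p k)"
    using p_mean assms(1) by (intro sum_le_suminf) auto
  finally show ?thesis using assms(3) by (simp add: le_divide_eq mult.commute)
qed

text \<open>Markov's inequality: there are fewer edges than vertices, so the mean in-degree is below
  one.\<close>

lemma tail_deg_frac:
  assumes "finite S" "\<And>k. k \<in> S \<Longrightarrow> real k \<ge> x" "x > 0"
  shows "(\<Sum>k\<in>S. E n (deg_frac k)) \<le> 1 / x"
proof -
  have "(\<Sum>k\<in>S. E n (deg_frac k)) = E n (\<lambda>G. deg_sum (\<lambda>k. if k \<in> S then 1 else 0) G / num_verts G)"
    using sum_expectation_deg_frac[OF assms(1), of "\<lambda>_. 1" n] by simp
  also have "\<dots> \<le> E n (\<lambda>G. 1 / x)"
  proof (rule expectation_law_mono)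
    fix G assume G: "admissible n G"
    have "deg_sum (\<lambda>k. if k \<in> S then 1 else 0) G \<le> deg_sum (\<lambda>k. 1 / x * real k) G"
      using assms by (intro deg_sum_mono) (auto simp: field_simps)
    also have "\<dots> = 1 / x * num_edges G"
      by (simp only: deg_sum_cmult deg_sum_of_nat[OF admissible_pair_fin_digraph[OF G]])
    also have "\<dots> \<le> 1 / x * num_verts G"
      using G assms(3) by (intro mult_left_mono) (auto simp: admissible_def)
    finally show "deg_sum (\<lambda>k. if k \<in> S then 1 else 0) G / num_verts G \<le> 1 / x"
      using admissible_num_verts_le[OF G] assms(3) by (simp add: divide_le_eq)
  qed
  finally show ?thesis by simp
qed

definition conv_const :: real where
  "conv_const = 2 * (8 + 14 * step_const) + 24 + (\<Sum>k. real k * pmf p k) + 1"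

lemma conv_const_pos: "conv_const > 0"
  using step_const_nonneg suminf_nonneg[OF p_mean] by (simp add: conv_const_def add_nonneg_pos)

text \<open>Duality: up to degree \<open>n powr conv_exp\<close> the absolute values are realised by
  one test function of signs, so a single estimate handles the whole sum. Beyond, both tails follow
  from bounded means. The bound is uniform in \<open>L\<close>.\<close>

lemma sum_abs_diff_le:
  assumes n: "n \<ge> 1"
  shows "(\<Sum>k<L. \<bar>pmf p k - E n (deg_frac k)\<bar>) \<le> conv_const * real n powr (- conv_exp)"
proof -
  let ?x = "real n powr conv_exp" and ?y = "real n powr (- conv_exp)"
  have n1: "real n \<ge> 1" using n by simp
  have x: "?x > 0" "1 / ?x = ?y" using n1 by (simp_all add: powr_minus_divide)
  define S where "S = {k. k < L \<and> real k \<le> ?x}"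
  define T where "T = {k. k < L \<and> real k > ?x}"
  have fin: "finite S" "finite T" by (simp_all add: S_def T_def)
  \<comment> \<open>The signs depend on \<open>n\<close>, but not on the random graph; this is
    admissible as the bound for the excess is uniform over test functions.\<close>
  define c where "c k = sgn (E n (deg_frac k) - pmf p k)" for k
  define f where "f k = (if k \<in> S then c k else 0)" for k
  have f1: "\<bar>f k\<bar> \<le> 1" for k by (simp add: f_def c_def sgn_real_def)
  have "\<bar>f k\<bar> \<le> (?x + 1) / (real k + 1)" for k
  proof (cases "k \<in> S")
    case True
    then have "1 \<le> (?x + 1) / (real k + 1)" by (simp add: S_def le_divide_eq)
    with f1[of k] show ?thesis by linarith
  qed (use x in \<open>simp add: f_def\<close>)
  moreover have "f k = 0" if "k \<ge> L" for k using that by (simp add: f_def S_def)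
  ultimately have tf: "test_fun (?x + 1) f" using f1 unfolding test_fun_def by blast
  have "(\<Sum>k\<in>S. \<bar>pmf p k - E n (deg_frac k)\<bar>) = (\<Sum>k\<in>S. c k * E n (deg_frac k)) - (\<Sum>k\<in>S. f k * pmf p k)"
    unfolding sum_subtractf[symmetric]
    by (intro sum.cong) (auto simp: c_def f_def sgn_real_def)
  also have "(\<Sum>k\<in>S. c k * E n (deg_frac k)) = E n (\<lambda>G. deg_sum f G / num_verts G)"
    unfolding sum_expectation_deg_frac[OF fin(1)] f_def[abs_def] ..
  also have "(\<Sum>k\<in>S. f k * pmf p k) = measure_pmf.expectation p f"
    by (rule integral_measure_pmf_real[symmetric]) (use fin in \<open>auto simp: f_def split: if_splits\<close>)
  also have "E n (\<lambda>G. deg_sum f G / num_verts G) - measure_pmf.expectation p f \<le>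
      (\<bar>E n (excess n f)\<bar> + 3 * E n (\<lambda>G. \<bar>dev n G\<bar>)) / (\<pi> * real n)"
    using expectation_ratio[OF n, of f] f1 by simp
  also have "\<dots> \<le> ((8 + 14 * step_const) * (real n * ?y) + 12 * (real n * ?y)) / (\<pi> * real n)"
  proof (intro divide_right_mono add_mono)
    show "\<bar>E n (excess n f)\<bar> \<le> (8 + 14 * step_const) * (real n * ?y)"
      using expectation_excess_powr[OF n tf] by (simp only: powr_conv[OF n])
    have "sqrt (real n + 1) \<le> sqrt (4 * real n)" using n1 by (intro real_sqrt_le_mono) auto
    also have "\<dots> = 2 * real n powr (1 / 2)" by (simp add: real_sqrt_mult powr_half_sqrt)
    also have "real n powr (1 / 2) \<le> real n powr (1 - conv_exp)"
      using n1 conv_exp by (intro powr_mono) auto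
    finally have "sqrt (real n + 1) \<le> 2 * (real n * ?y)" by (simp add: powr_conv[OF n])
    then show "3 * E n (\<lambda>G. \<bar>dev n G\<bar>) \<le> 12 * (real n * ?y)"
      using expectation_abs_dev[of n] by linarith
  qed (use pi_gt_half in auto)
  also have "\<dots> = (8 + 14 * step_const + 12) * ?y / \<pi>"
    using n1 pi_gt_half by (simp add: field_simps)
  also have "\<dots> \<le> (8 + 14 * step_const + 12) * ?y / (1 / 2)"
    using pi_gt_half step_const_nonneg by (intro divide_left_mono) auto
  finally have 1: "(\<Sum>k\<in>S. \<bar>pmf p k - E n (deg_frac k)\<bar>) \<le> (2 * (8 + 14 * step_const) + 24) * ?y"
    by (simp add: algebra_simps)
  have nonneg: "E n (deg_frac k) \<ge> 0" for k
    by (intro integral_nonneg_AE) (simp add: deg_frac_def)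
  have "(\<Sum>k\<in>T. \<bar>pmf p k - E n (deg_frac k)\<bar>) \<le> (\<Sum>k\<in>T. pmf p k + E n (deg_frac k))"
    using nonneg by (intro sum_mono) (simp add: abs_le_iff add_increasing add_increasing2)
  also have "\<dots> \<le> (\<Sum>k. real k * pmf p k) / ?x + 1 / ?x"
    unfolding sum.distrib using fin(2) x(1)
    by (intro add_mono tail_p tail_deg_frac) (auto simp: T_def)
  also have "\<dots> = ((\<Sum>k. real k * pmf p k) + 1) * ?y"
    unfolding x(2)[symmetric] by (simp add: add_divide_distrib)
  finally have 2: "(\<Sum>k\<in>T. \<bar>pmf p k - E n (deg_frac k)\<bar>) \<le> ((\<Sum>k. real k * pmf p k) + 1) * ?y" .
  have "{..<L} = S \<union> T" "S \<inter> T = {}" by (auto simp: S_def T_def)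
  then have "(\<Sum>k<L. \<bar>pmf p k - E n (deg_frac k)\<bar>) =
      (\<Sum>k\<in>S. \<bar>pmf p k - E n (deg_frac k)\<bar>) + (\<Sum>k\<in>T. \<bar>pmf p k - E n (deg_frac k)\<bar>)"
    using fin by (simp add: sum.union_disjoint)
  also have "\<dots> \<le> conv_const * ?y"
    using 1 2 by (simp add: conv_const_def algebra_simps)
  finally show ?thesis .
qed

lemma l1_convergence:
  assumes n: "n \<ge> 1"
  shows "summable (\<lambda>k. \<bar>pmf p k - E n (deg_frac k)\<bar>)"
    and "(\<Sum>k. \<bar>pmf p k - E n (deg_frac k)\<bar>) \<le> conv_const * real n powr (- conv_exp)"
proof -
  show s: "summable (\<lambda>k. \<bar>pmf p k - E n (deg_frac k)\<bar>)"
    by (rule summableI_nonneg_bounded[OF _ sum_abs_diff_le[OF n]]) simp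
  show "(\<Sum>k. \<bar>pmf p k - E n (deg_frac k)\<bar>) \<le> conv_const * real n powr (- conv_exp)"
    by (rule suminf_le_const[OF s sum_abs_diff_le[OF n]])
qed

lemma expectation_deg_frac_tendsto: "(\<lambda>n. E n (deg_frac k)) \<longlonglongrightarrow> pmf p k"
proof (rule Lim_transform)
  have "(\<lambda>n. conv_const * real n powr (- conv_exp)) \<longlonglongrightarrow> conv_const * 0"
    using conv_exp by (intro tendsto_mult_left tendsto_neg_powr filterlim_real_sequentially) auto
  then show "(\<lambda>n. E n (deg_frac k) - pmf p k) \<longlonglongrightarrow> 0"
  proof (rule Lim_null_comparison[rotated, OF tendsto_eq_rhs])
    show "\<forall>\<^sub>F n in sequentially. norm (E n (deg_frac k) - pmf p k) \<le> conv_const * real n powr (- conv_exp)"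
    proof (rule eventually_sequentiallyI)
      fix n :: nat assume n: "n \<ge> 1"
      have "\<bar>pmf p k - E n (deg_frac k)\<bar> \<le> (\<Sum>k<Suc k. \<bar>pmf p k - E n (deg_frac k)\<bar>)"
        by (intro member_le_sum[of k "{..<Suc k}" "\<lambda>k. \<bar>pmf p k - E n (deg_frac k)\<bar>"]) auto
      also note sum_abs_diff_le[OF n, of "Suc k"]
      finally show "norm (E n (deg_frac k) - pmf p k) \<le> conv_const * real n powr (- conv_exp)"
        by (simp add: abs_minus_commute)
    qed
  qed simp
qed simp

end

subsection \<open>Concentration\<close>

context attachment_deletion_limit
begin

lemma excess_upper_tail:
  assumes m: "m \<ge> 1" and n: "n \<ge> m" and f: "test_fun A f" and \<eta>: "\<eta> \<ge> 0" and \<epsilon>: "\<epsilon> > 0"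
    and err: "4 * real m + (real n - real m) * (step_const * (\<eta> + (1 + decay_at m n A) / real m)) \<le> \<epsilon> * real n / 8"
  shows "measure_pmf.prob (law n) {G. excess n f G > \<epsilon> * real n / 4} \<le>
    exp (- (\<epsilon>\<^sup>2 * real n / 1152)) + (\<Sum>j=m..<n. measure_pmf.prob (law j) {G. \<bar>dev j G\<bar> > \<eta> * real j})"
proof -
  \<comment> \<open>Minimises \<open>9 / 2 * l * l * n - l * \<epsilon> * n / 8\<close>; the second
    term is the threshold \<open>\<epsilon> * n / 4\<close> less the allowed error
    \<open>\<epsilon> * n / 8\<close>.\<close>
  let ?l = "\<epsilon> / 72" and ?t = "\<epsilon> * real n / 4"
  let ?err = "4 * real m + (real n - real m) * (step_const * (\<eta> + (1 + decay_at m n A) / real m))"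
  have l: "?l \<ge> 0" using \<epsilon> by simp
  have "measure_pmf.prob (law n) {G. excess n f G > ?t} \<le> E n (\<lambda>G. min 1 (exp (?l * (excess n f G - ?t))))"
    using \<epsilon> by (intro markov_law) auto
  also have "\<dots> \<le> exp (?l * (?err - ?t) + 9 / 2 * ?l\<^sup>2 * (real n - real m))
    + (\<Sum>j=m..<n. measure_pmf.prob (law j) {G. \<bar>dev j G\<bar> > \<eta> * real j})"
    by (rule expectation_exp_excess[OF m n f l \<eta>])
  also have "exp (?l * (?err - ?t) + 9 / 2 * ?l\<^sup>2 * (real n - real m)) \<le> exp (- (\<epsilon>\<^sup>2 * real n / 1152))"
  proof -
    have "?l * (?err - ?t) \<le> ?l * (\<epsilon> * real n / 8 - ?t)"
      using err l by (intro mult_left_mono) linarith+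
    moreover have "9 / 2 * ?l\<^sup>2 * (real n - real m) \<le> 9 / 2 * ?l\<^sup>2 * real n"
      by (intro mult_left_mono) auto
    moreover have "?l * (\<epsilon> * real n / 8 - ?t) + 9 / 2 * ?l\<^sup>2 * real n = - (\<epsilon>\<^sup>2 * real n / 1152)"
      by (simp add: power2_eq_square field_simps)
    ultimately have "?l * (?err - ?t) + 9 / 2 * ?l\<^sup>2 * (real n - real m) \<le> - (\<epsilon>\<^sup>2 * real n / 1152)"
      by linarith
    then show ?thesis by (simp only: exp_le_cancel_iff)
  qed
  finally show ?thesis by simp
qed

text \<open>If all three fail, the numerators deviate by at most two quarters of
  \<open>\<epsilon> * n\<close>, and the number of vertices is at least
  \<open>n / 2\<close>.\<close>

lemma deg_frac_deviation:
  assumes G: "admissible n G" and \<epsilon>: "\<bar>deg_frac k G - pmf p k\<bar> > \<epsilon>" "\<epsilon> > 0"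
  shows "excess n (indicator {k}) G > \<epsilon> * real n / 4 \<or> excess n (\<lambda>i. - indicator {k} i) G > \<epsilon> * real n / 4
    \<or> \<bar>dev n G\<bar> > \<epsilon> / 4 * real n"
proof (rule ccontr)
  assume "\<not> ?thesis"
  then have ex: "\<bar>excess n (indicator {k}) G\<bar> \<le> \<epsilon> * real n / 4" and dev: "\<bar>dev n G\<bar> \<le> \<epsilon> * real n / 4"
    unfolding excess_uminus by auto
  let ?v = "real (num_verts G)"
  have v: "?v > 0" "real n \<le> 2 * ?v" using admissible_num_verts_le[OF G] by linarith+
  have "\<bar>dev n G * pmf p k\<bar> \<le> \<bar>dev n G\<bar>"
    by (simp add: abs_mult mult_left_le pmf_le_1)
  then have half: "\<bar>excess n (indicator {k}) G - dev n G * pmf p k\<bar> \<le> \<epsilon> * real n / 2"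
    using ex dev by linarith
  have "measure_pmf.expectation p (indicator {k}) = pmf p k" by (simp add: measure_pmf_single)
  then have "deg_frac k G - pmf p k = (excess n (indicator {k}) G - dev n G * pmf p k) / ?v"
    using v deg_sum_indicator[OF admissible_pair_fin_digraph[OF G], of k]
    by (simp add: excess_def dev_def deg_frac_def field_simps)
  then have "\<bar>deg_frac k G - pmf p k\<bar> = \<bar>excess n (indicator {k}) G - dev n G * pmf p k\<bar> / ?v"
    by simp
  also have "\<dots> \<le> (\<epsilon> * real n / 2) / ?v"
    using half by (intro divide_right_mono) auto
  also have "\<dots> \<le> (\<epsilon> * (2 * ?v) / 2) / ?v"
    using v \<epsilon> by (intro divide_right_mono mult_left_mono) auto
  also have "\<dots> = \<epsilon>" using v by simp
  finally show False using \<epsilon> by simp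
qed

text \<open>\<open>k\<close> times the number of vertices of degree \<open>k\<close> is at most the
  number of edges, hence below the number of vertices; so both fractions lie between 0 and
  \<open>\<epsilon>\<close>. This makes the concentration uniform in \<open>k\<close>.\<close>

lemma deg_frac_large_degree:
  assumes G: "admissible n G" and k: "real k * \<epsilon> \<ge> 1" "pmf p k \<le> \<epsilon>" and \<epsilon>: "\<epsilon> > 0"
  shows "\<bar>deg_frac k G - pmf p k\<bar> \<le> \<epsilon>"
proof -
  have pf: "pair_fin_digraph G" using G by (rule admissible_pair_fin_digraph)
  have "real k * real (deg_count k G) = deg_sum (\<lambda>i. real k * indicator {k} i) G"
    by (simp only: deg_sum_cmult deg_sum_indicator[OF pf])
  also have "\<dots> \<le> deg_sum real G" by (intro deg_sum_mono) (auto simp: indicator_def)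
  also have "\<dots> \<le> num_verts G" using G by (simp add: deg_sum_of_nat[OF pf] admissible_def)
  finally have "real k * real (deg_count k G) \<le> real (num_verts G)" .
  then have "\<epsilon> * (real k * real (deg_count k G)) \<le> \<epsilon> * real (num_verts G)"
    using \<epsilon> by (intro mult_left_mono) auto
  moreover have "1 * real (deg_count k G) \<le> (real k * \<epsilon>) * real (deg_count k G)"
    using k(1) by (intro mult_right_mono) auto
  ultimately have "real (deg_count k G) \<le> \<epsilon> * real (num_verts G)" by (simp add: mult_ac)
  then have "deg_frac k G \<le> \<epsilon>"
    using admissible_num_verts_le[OF G] \<epsilon> by (simp add: deg_frac_def divide_le_eq)
  moreover have "deg_frac k G \<ge> 0" by (simp add: deg_frac_def)
  ultimately show ?thesis using k(2) pmf_nonneg[of p k] by linarith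
qed

lemma sum_dev_tail:
  assumes \<eta>: "\<eta> > 0" and m: "real m \<ge> \<eta>' * real n" and n: "n \<ge> 1"
  shows "(\<Sum>j=m..<n. measure_pmf.prob (law j) {G. \<bar>dev j G\<bar> > \<eta> * real j}) \<le>
    2 * exp (10 * \<eta>) * (real n)\<^sup>2 * exp (- (2 * \<eta>\<^sup>2 * \<eta>' * real n))"
proof -
  let ?b = "2 * exp (10 * \<eta>) * real n * exp (- (2 * \<eta>\<^sup>2 * \<eta>' * real n))"
  have "measure_pmf.prob (law j) {G. \<bar>dev j G\<bar> > \<eta> * real j} \<le> ?b" if "j \<in> {m..<n}" for j
  proof -
    have "measure_pmf.prob (law j) {G. \<bar>dev j G\<bar> > \<eta> * real j} \<le>
        2 * (real j + 1) * exp (10 * \<eta>) * exp (- (2 * \<eta>\<^sup>2 * real j))"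
      by (rule dev_tail[OF \<eta>])
    also have "\<dots> \<le> 2 * real n * exp (10 * \<eta>) * exp (- (2 * \<eta>\<^sup>2 * \<eta>' * real n))"
    proof (intro mult_mono)
      have "2 * \<eta>\<^sup>2 * (\<eta>' * real n) \<le> 2 * \<eta>\<^sup>2 * real j"
        using m that by (intro mult_left_mono) auto
      then show "exp (- (2 * \<eta>\<^sup>2 * real j)) \<le> exp (- (2 * \<eta>\<^sup>2 * \<eta>' * real n))" by (simp add: mult.assoc)
    qed (use that in auto)
    finally show ?thesis by (simp add: mult_ac)
  qed
  then have "(\<Sum>j=m..<n. measure_pmf.prob (law j) {G. \<bar>dev j G\<bar> > \<eta> * real j}) \<le> real (card {m..<n}) * ?b"
    by (rule sum_bounded_above)
  also have "\<dots> \<le> real n * ?b" by (intro mult_right_mono) auto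
  finally show ?thesis by (simp add: power2_eq_square mult_ac)
qed

text \<open>A horizon \<open>m\<close> proportional to \<open>n\<close> keeps \<open>n / m\<close>
  bounded, so the decay contributes only a constant. It also makes the exceptional events at all
  times from \<open>m\<close> on exponentially unlikely in \<open>n\<close>.\<close>

lemma horizon_error:
  assumes \<epsilon>: "\<epsilon> > 0" and A: "A \<ge> 0"
  obtains \<eta> \<eta>' N where "\<eta> > 0" "\<eta>' > 0"
    "\<And>n. n \<ge> N \<Longrightarrow> \<exists>m\<ge>1. m \<le> n \<and> \<eta>' * real n \<le> real m \<and>
      4 * real m + (real n - real m) * (step_const * (\<eta> + (1 + decay_at m n A) / real m)) \<le> \<epsilon> * real n / 8"
proof -
  \<comment> \<open>Budget for \<open>\<epsilon> * n / 8\<close>: a share of \<open>1 / 32\<close>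
    for the start \<open>4 * m\<close>, \<open>1 / 32\<close> for the drift error
    \<open>\<eta>\<close>, and \<open>1 / 16\<close> for the constant \<open>K\<close>, which is
    affordable from \<open>N\<close> on. The 4 in \<open>K\<close> pays for rounding
    \<open>m\<close> up.\<close>
  define \<eta>' where "\<eta>' = min 1 (\<epsilon> / 128)"
  define \<eta> where "\<eta> = \<epsilon> / (32 * (step_const + 1))"
  define K where "K = 4 + step_const * ((1 + A * (1 / \<eta>') ^ decay_exp) / \<eta>')"
  define N where "N = Suc (nat \<lceil>16 * K / \<epsilon>\<rceil>)"
  have \<eta>': "\<eta>' > 0" "\<eta>' \<le> 1" "4 * \<eta>' \<le> \<epsilon> / 32" using \<epsilon> by (auto simp: \<eta>'_def)
  have \<eta>: "\<eta> > 0" "step_const * \<eta> \<le> \<epsilon> / 32"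
    using \<epsilon> step_const_nonneg by (auto simp: \<eta>_def field_simps)
  have "\<exists>m\<ge>1. m \<le> n \<and> \<eta>' * real n \<le> real m \<and>
      4 * real m + (real n - real m) * (step_const * (\<eta> + (1 + decay_at m n A) / real m)) \<le> \<epsilon> * real n / 8"
    if n: "n \<ge> N" for n
  proof (intro exI conjI)
    let ?m = "nat \<lceil>\<eta>' * real n\<rceil>"
    have n1: "real n \<ge> 1" using n by (simp add: N_def)
    have pos: "\<eta>' * real n > 0" using \<eta>' n1 by simp
    show m1: "?m \<ge> 1" using pos by linarith
    have "\<eta>' * real n \<le> 1 * real n" using \<eta>' by (intro mult_right_mono) auto
    then show mn: "?m \<le> n" by (simp add: ceiling_le_iff nat_le_iff)
    show le: "\<eta>' * real n \<le> real ?m" by (rule real_nat_ceiling_ge)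
    have m_le: "real ?m \<le> \<eta>' * real n + 1" using pos by linarith
    have combine: "w + z \<le> t" if "K \<le> d" "z = x + y" "x \<le> a" "y \<le> r" "r = K - 4" "w \<le> b + 4" "a + b + d = t"
      for w x y z a b d r t
      using that by linarith
    have "K \<le> \<epsilon> * real n / 16"
    proof -
      have "16 * K / \<epsilon> \<le> real n" using n unfolding N_def by linarith
      then show ?thesis using \<epsilon> by (simp add: field_simps)
    qed
    moreover have nm: "real n / real ?m \<le> 1 / \<eta>'"
      using le \<eta>' m1 n1 by (simp add: divide_le_eq le_divide_eq mult.commute)
    then have decay: "decay_at ?m n A \<le> A * (1 / \<eta>') ^ decay_exp"
      unfolding decay_at_def using A by (intro mult_left_mono power_mono) auto
    have "(real n - real ?m) * (step_const * (\<eta> + (1 + decay_at ?m n A) / real ?m)) =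
        (real n - real ?m) * (step_const * \<eta>) + step_const * ((1 + decay_at ?m n A) * ((real n - real ?m) / real ?m))"
    proof -
      have "a * (s * (e + x / q)) = a * (s * e) + s * (x * (a / q))" for a s e x q :: real
        by (simp add: distrib_left)
      then show ?thesis .
    qed
    moreover have "(real n - real ?m) * (step_const * \<eta>) \<le> real n * (\<epsilon> / 32)"
      using \<eta> mn step_const_nonneg by (intro mult_mono) auto
    moreover have "step_const * ((1 + decay_at ?m n A) * ((real n - real ?m) / real ?m)) \<le>
        step_const * ((1 + A * (1 / \<eta>') ^ decay_exp) * (1 / \<eta>'))"
    proof (intro mult_left_mono mult_mono)
      have "(real n - real ?m) / real ?m \<le> real n / real ?m" by (intro divide_right_mono) auto
      from this nm show "(real n - real ?m) / real ?m \<le> 1 / \<eta>'" by (rule order.trans)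
    next
      show "0 \<le> (real n - real ?m) / real ?m"
        using of_nat_mono[OF mn, where ?'a = real] by (intro divide_nonneg_nonneg) linarith+
    qed (use decay A \<eta>' step_const_nonneg in auto)
    moreover have "step_const * ((1 + A * (1 / \<eta>') ^ decay_exp) * (1 / \<eta>')) = K - 4"
      by (simp add: K_def)
    moreover have "4 * real ?m \<le> \<epsilon> / 32 * real n + 4"
      using m_le mult_right_mono[OF \<eta>'(3), of "real n"] by simp
    moreover have "real n * (\<epsilon> / 32) + \<epsilon> / 32 * real n + \<epsilon> * real n / 16 = \<epsilon> * real n / 8" by simp
    ultimately show "4 * real ?m + (real n - real ?m) * (step_const * (\<eta> + (1 + decay_at ?m n A) / real ?m)) \<le> \<epsilon> * real n / 8"
      by (rule combine)
  qed
  then show thesis using that \<eta> \<eta>' by blast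
qed

text \<open>Degrees above a threshold depending on \<open>\<epsilon>\<close> cannot deviate at all.
  Below it all indicators share one decay constant, hence one horizon and one set of
  constants.\<close>

lemma deg_frac_tail:
  assumes \<epsilon>: "\<epsilon> > 0"
  obtains D c N where "D > 0" "c > 0"
    "\<And>n k. n \<ge> N \<Longrightarrow> measure_pmf.prob (law n) {G. \<bar>deg_frac k G - pmf p k\<bar> > \<epsilon>}
      \<le> D * (real n)\<^sup>2 * exp (- (c * real n))"
proof -
  have "eventually (\<lambda>k. pmf p k < \<epsilon>) sequentially"
  proof (rule order_tendstoD(2)[of _ 0])
    have "(\<lambda>k. real k * pmf p k) \<longlonglongrightarrow> 0" by (rule summable_LIMSEQ_zero[OF p_mean])
    moreover have "norm (pmf p k) \<le> real k * pmf p k" if "k \<ge> 1" for k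
      using that mult_right_mono[of 1 "real k" "pmf p k"] by simp
    ultimately show "pmf p \<longlonglongrightarrow> 0"
      by (intro Lim_null_comparison[of "pmf p"]) (auto simp: eventually_sequentially)
  qed (use \<epsilon> in simp)
  then obtain k0 where k0: "\<And>k. k \<ge> k0 \<Longrightarrow> pmf p k < \<epsilon>" by (auto simp: eventually_sequentially)
  define k1 where "k1 = max k0 (nat \<lceil>1 / \<epsilon>\<rceil>)"
  have large: "real k * \<epsilon> \<ge> 1" "pmf p k \<le> \<epsilon>" if "k \<ge> k1" for k
  proof -
    have "1 / \<epsilon> \<le> real k" using that unfolding k1_def by linarith
    then show "real k * \<epsilon> \<ge> 1" using \<epsilon> by (simp add: field_simps)
    show "pmf p k \<le> \<epsilon>" using k0[of k] that by (simp add: k1_def)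
  qed
  obtain \<eta> \<eta>' N0 where \<eta>: "\<eta> > 0" "\<eta>' > 0"
    and err: "\<And>n. n \<ge> N0 \<Longrightarrow> \<exists>m\<ge>1. m \<le> n \<and> \<eta>' * real n \<le> real m \<and>
      4 * real m + (real n - real m) * (step_const * (\<eta> + (1 + decay_at m n (real k1)) / real m)) \<le> \<epsilon> * real n / 8"
    by (rule horizon_error[OF \<epsilon> of_nat_0_le_iff[of k1]]) (rule that)
  define c where "c = min (\<epsilon>\<^sup>2 / 1152) (2 * \<eta>\<^sup>2 * \<eta>')"
  define D where "D = 2 + 4 * exp (10 * \<eta>) + 4 * exp (10 * (\<epsilon> / 4))"
  have c: "c > 0" "c \<le> \<epsilon>\<^sup>2 / 1152" "c \<le> 2 * \<eta>\<^sup>2 * \<eta>'" using \<epsilon> \<eta> by (auto simp: c_def)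
  have D: "D > 0" by (simp add: D_def add_pos_pos)
  have "measure_pmf.prob (law n) {G. \<bar>deg_frac k G - pmf p k\<bar> > \<epsilon>} \<le> D * (real n)\<^sup>2 * exp (- (c * real n))"
    if n: "n \<ge> max 1 N0" for n k
  proof (cases "k \<ge> k1")
    case True
    have "measure_pmf.prob (law n) {G. \<bar>deg_frac k G - pmf p k\<bar> > \<epsilon>} \<le> E n (\<lambda>_. 0)"
      using deg_frac_large_degree[OF _ large[OF True] \<epsilon>] by (intro markov_law) (auto simp: not_le[symmetric])
    then show ?thesis using D by (auto intro: order_trans)
  next
    case False
    let ?P = "measure_pmf.prob (law n)" and ?e = "exp (- (c * real n))"
    let ?f = "indicator {k} :: nat \<Rightarrow> real" and ?g = "\<lambda>i. - indicator {k} i :: real"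
    have n1: "real n \<ge> 1" using n by simp
    from n obtain m where m: "m \<ge> 1" "m \<le> n" "\<eta>' * real n \<le> real m"
      "4 * real m + (real n - real m) * (step_const * (\<eta> + (1 + decay_at m n (real k1)) / real m)) \<le> \<epsilon> * real n / 8"
      using err[of n] by auto
    \<comment> \<open>From \<open>k < k1\<close> follows \<open>1 \<le> k1 / (k + 1)\<close>, so
      \<open>k1\<close> serves as decay constant.\<close>
    have tf: "test_fun (real k1) ?f"
      using False unfolding test_fun_def by (auto simp: indicator_def le_divide_eq intro!: exI[of _ "Suc k"])
    then have tg: "test_fun (real k1) ?g" by (rule test_fun_uminus)
    let ?S = "\<Sum>j=m..<n. measure_pmf.prob (law j) {G. \<bar>dev j G\<bar> > \<eta> * real j}"
    have exp1: "exp (- (\<epsilon>\<^sup>2 * real n / 1152)) \<le> ?e"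
      using mult_right_mono[OF c(2), of "real n"] by simp
    have exp2: "exp (- (2 * \<eta>\<^sup>2 * \<eta>' * real n)) \<le> ?e"
      using mult_right_mono[OF c(3), of "real n"] by simp
    have exp3: "exp (- (2 * (\<epsilon> / 4)\<^sup>2 * real n)) \<le> ?e"
    proof -
      have "c \<le> 2 * (\<epsilon> / 4)\<^sup>2" using c(2) by (simp add: power_divide) (use zero_le_power2[of \<epsilon>] in linarith)
      from mult_right_mono[OF this, of "real n"] show ?thesis by simp
    qed
    have sq: "1 \<le> (real n)\<^sup>2" "real n + 1 \<le> 2 * (real n)\<^sup>2"
    proof -
      have "real n * 1 \<le> real n * real n" using n1 by (intro mult_left_mono) auto
      then show "1 \<le> (real n)\<^sup>2" "real n + 1 \<le> 2 * (real n)\<^sup>2" using n1 unfolding power2_eq_square by linarith+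
    qed
    have S: "?S \<le> 2 * exp (10 * \<eta>) * (real n)\<^sup>2 * ?e"
    proof -
      have "?S \<le> 2 * exp (10 * \<eta>) * (real n)\<^sup>2 * exp (- (2 * \<eta>\<^sup>2 * \<eta>' * real n))"
        using n by (intro sum_dev_tail \<eta> m) auto
      also have "\<dots> \<le> 2 * exp (10 * \<eta>) * (real n)\<^sup>2 * ?e"
        using exp2 by (intro mult_left_mono) auto
      finally show ?thesis .
    qed
    have one: "?e \<le> (real n)\<^sup>2 * ?e" using mult_right_mono[OF sq(1), of ?e] by simp
    have 1: "?P {G. excess n h G > \<epsilon> * real n / 4} \<le> (1 + 2 * exp (10 * \<eta>)) * ((real n)\<^sup>2 * ?e)"
      if "test_fun (real k1) h" for h
    proof -
      have "?P {G. excess n h G > \<epsilon> * real n / 4} \<le> exp (- (\<epsilon>\<^sup>2 * real n / 1152)) + ?S"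
        using \<eta> by (intro excess_upper_tail[OF m(1,2) that _ \<epsilon> m(4)]) auto
      also have "\<dots> \<le> (real n)\<^sup>2 * ?e + 2 * exp (10 * \<eta>) * ((real n)\<^sup>2 * ?e)"
        using order.trans[OF exp1 one] S by (intro add_mono) (simp_all only: mult.assoc)
      finally show ?thesis by (simp only: distrib_right mult_1)
    qed
    have 2: "?P {G. \<bar>dev n G\<bar> > \<epsilon> / 4 * real n} \<le> 4 * exp (10 * (\<epsilon> / 4)) * ((real n)\<^sup>2 * ?e)"
    proof -
      have "?P {G. \<bar>dev n G\<bar> > \<epsilon> / 4 * real n} \<le>
          2 * (real n + 1) * exp (10 * (\<epsilon> / 4)) * exp (- (2 * (\<epsilon> / 4)\<^sup>2 * real n))"
        using \<epsilon> by (intro dev_tail) auto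
      also have "\<dots> \<le> 2 * (2 * (real n)\<^sup>2) * exp (10 * (\<epsilon> / 4)) * ?e"
        using sq(2) exp3 by (intro mult_mono) auto
      finally show ?thesis by (simp add: mult_ac)
    qed
    have "?P {G. \<bar>deg_frac k G - pmf p k\<bar> > \<epsilon>} \<le>
        E n (\<lambda>G. indicator {G. excess n ?f G > \<epsilon> * real n / 4} G + indicator {G. excess n ?g G > \<epsilon> * real n / 4} G
          + indicator {G. \<bar>dev n G\<bar> > \<epsilon> / 4 * real n} G)"
      by (rule markov_law) (use deg_frac_deviation[OF _ _ \<epsilon>] in \<open>fastforce simp: indicator_def\<close>)+
    also have "\<dots> = ?P {G. excess n ?f G > \<epsilon> * real n / 4} + ?P {G. excess n ?g G > \<epsilon> * real n / 4}
        + ?P {G. \<bar>dev n G\<bar> > \<epsilon> / 4 * real n}"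
      by simp
    also have "\<dots> \<le> (1 + 2 * exp (10 * \<eta>)) * ((real n)\<^sup>2 * ?e) + (1 + 2 * exp (10 * \<eta>)) * ((real n)\<^sup>2 * ?e)
        + 4 * exp (10 * (\<epsilon> / 4)) * ((real n)\<^sup>2 * ?e)"
      by (intro add_mono 1 2 tf tg)
    also have "\<dots> = D * (real n)\<^sup>2 * ?e"
      by (simp add: D_def algebra_simps)
    finally show ?thesis .
  qed
  then show thesis using that[OF D c(1)] by blast
qed

text \<open>For fixed \<open>\<epsilon>\<close> the decay in \<open>deg_frac_tail\<close> is
  exponential in \<open>n\<close>, and \<open>C\<close> may depend on \<open>\<epsilon>\<close>.
  Half of the exponent absorbs the square of \<open>n\<close>; the other half dominates the claimed
  rate, as \<open>ln n \<ge> 1\<close> from \<open>n = 3\<close> on.\<close>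

lemma deg_frac_concentration:
  assumes \<epsilon>: "\<epsilon> > 0"
  shows "\<exists>C>0. \<exists>N. \<forall>n\<ge>N. \<forall>k.
    measure_pmf.prob (law n) {G. \<bar>deg_frac k G - pmf p k\<bar> > \<epsilon>}
      \<le> C * exp (- inverse C * min \<epsilon> (\<epsilon>\<^sup>2) * (real n / (ln (real n))\<^sup>2))"
proof -
  obtain D c N where D: "D > 0" and c: "c > 0"
    and tail: "\<And>n k. n \<ge> N \<Longrightarrow> measure_pmf.prob (law n) {G. \<bar>deg_frac k G - pmf p k\<bar> > \<epsilon>}
      \<le> D * (real n)\<^sup>2 * exp (- (c * real n))"
    using deg_frac_tail[OF \<epsilon>] by blast
  let ?M = "min \<epsilon> (\<epsilon>\<^sup>2)"
  \<comment> \<open>The first entry collects the prefactor after the square of \<open>n\<close> is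
    absorbed; the second gives \<open>inverse C * ?M \<le> c / 2\<close>.\<close>
  define C where "C = max (D * (8 / c\<^sup>2)) (2 * ?M / c)"
  have M: "?M > 0" using \<epsilon> by simp
  have "D * (8 / c\<^sup>2) > 0" using D c by simp
  then have C: "C > 0" "D * (8 / c\<^sup>2) \<le> C" "2 * ?M / c \<le> C" by (auto simp: C_def)
  have rate: "inverse C * ?M \<le> c / 2" using C c M by (simp add: field_simps)
  have "measure_pmf.prob (law n) {G. \<bar>deg_frac k G - pmf p k\<bar> > \<epsilon>}
      \<le> C * exp (- inverse C * ?M * (real n / (ln (real n))\<^sup>2))" if n: "n \<ge> max 3 N" for n k
  proof -
    have "exp 1 \<le> real n" using exp_le n by simp
    then have "ln (real n) \<ge> 1" using n by (subst ln_ge_iff) auto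
    then have "(ln (real n))\<^sup>2 \<ge> 1" by (simp add: one_le_power)
    then have ln: "real n / (ln (real n))\<^sup>2 \<le> real n / 1" by (intro divide_left_mono) auto
    have "1 + c / 2 * real n + (c / 2 * real n)\<^sup>2 / 2 \<le> exp (c / 2 * real n)"
      using c by (intro exp_lower_Taylor_quadratic) auto
    then have "(c / 2 * real n)\<^sup>2 / 2 \<le> exp (c / 2 * real n)"
      using mult_nonneg_nonneg[of "c / 2" "real n"] c by linarith
    then have sq: "(real n)\<^sup>2 \<le> 8 / c\<^sup>2 * exp (c / 2 * real n)"
      using c by (simp add: power_mult_distrib power_divide field_simps)
    have "measure_pmf.prob (law n) {G. \<bar>deg_frac k G - pmf p k\<bar> > \<epsilon>} \<le> D * (real n)\<^sup>2 * exp (- (c * real n))"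
      using n by (intro tail) auto
    also have "\<dots> \<le> D * (8 / c\<^sup>2 * exp (c / 2 * real n)) * exp (- (c * real n))"
      using sq D by (intro mult_right_mono mult_left_mono) auto
    also have "\<dots> = D * (8 / c\<^sup>2) * exp (- (c / 2 * real n))"
      by (simp add: exp_add[symmetric] mult.assoc)
    also have "\<dots> \<le> C * exp (- inverse C * ?M * (real n / (ln (real n))\<^sup>2))"
    proof (rule mult_mono)
      have "inverse C * ?M * (real n / (ln (real n))\<^sup>2) \<le> c / 2 * real n"
        using rate ln C M c by (intro mult_mono) auto
      then show "exp (- (c / 2 * real n)) \<le> exp (- inverse C * ?M * (real n / (ln (real n))\<^sup>2))" by simp
    qed (use C in auto)
    finally show ?thesis .
  qed
  then show ?thesis using C(1) by blast
qed

end

theorem theorem3p1: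
  fixes M :: "'a measure" and \<pi> \<delta> :: real and G :: "nat \<Rightarrow> 'a \<Rightarrow> graph"
  assumes "1 / 2 < \<pi>" and "\<pi> < 1" and "\<delta> > 0"
    and "attachment_deletion_process M \<pi> \<delta> G"
  defines "\<alpha>\<^sub>0 \<equiv> \<pi> / (2 * \<pi> - 1 + \<delta> * \<pi>)"
    and "\<beta>\<^sub>0 \<equiv> \<delta> * \<pi> / (2 * \<pi> - 1 + \<delta> * \<pi>)"
    and "\<alpha>\<^sub>1 \<equiv> - \<pi> / (2 * \<pi> - 1 + \<delta> * \<pi>) - (1 - \<pi>) / (2 * \<pi> - 1)"
    and "\<beta>\<^sub>1 \<equiv> - \<delta> * \<pi> / (2 * \<pi> - 1 + \<delta> * \<pi>) - 1"
    and "\<alpha>\<^sub>2 \<equiv> (1 - \<pi>) / (2 * \<pi> - 1)"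
    and "\<beta>\<^sub>2 \<equiv> (0 :: real)"
  shows "\<exists>p :: nat pmf.
     (\<forall>k. (\<lambda>n. prob_space.expectation M (\<lambda>\<omega>. deg_frac k (G n \<omega>))) \<longlonglongrightarrow> pmf p k) \<and>
     (\<exists>\<kappa>>0. \<exists>C>0. \<forall>n\<ge>1.
        summable (\<lambda>k. \<bar>pmf p k - prob_space.expectation M (\<lambda>\<omega>. deg_frac k (G n \<omega>))\<bar>) \<and>
        (\<Sum>k. \<bar>pmf p k - prob_space.expectation M (\<lambda>\<omega>. deg_frac k (G n \<omega>))\<bar>)
          \<le> C * real n powr (- \<kappa>)) \<and>
     (\<forall>\<epsilon>>0. \<exists>C>0. \<exists>N. \<forall>n\<ge>N. \<forall>k.
        \<P>(\<omega> in M. \<bar>deg_frac k (G n \<omega>) - pmf p k\<bar> > \<epsilon>)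
          \<le> C * exp (- inverse C * min \<epsilon> (\<epsilon>\<^sup>2) * (real n / (ln (real n))\<^sup>2))) \<and>
     (\<forall>k. (\<alpha>\<^sub>2 * (real k + 1) + \<beta>\<^sub>2) * pmf p (k + 1) + (\<alpha>\<^sub>1 * real k + \<beta>\<^sub>1) * pmf p k
          + (\<alpha>\<^sub>0 * (real k - 1) + \<beta>\<^sub>0) * (if k = 0 then 0 else pmf p (k - 1))
        = - (if k = 0 then 1 else 0))"
proof -
  interpret attachment_deletion \<pi> \<delta> by unfold_locales fact+
  obtain p :: "nat pmf" where
    p: "\<And>k. pmf p k * (1 + bd.rate k) =
      (if k = 0 then 1 else birth_coeff * (real k - 1 + \<delta>) * pmf p (k - 1)) + death_coeff * (real k + 1) * pmf p (k + 1)"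
    and mean: "summable (\<lambda>k. real k * pmf p k)"
    by (rule bd.stationary_exists) (rule that)
  interpret attachment_deletion_limit \<pi> \<delta> p by unfold_locales (fact p mean)+
  have X: "markov_chain M (step \<pi> \<delta>) initial_graph G"
    using assms(4) by (simp add: attachment_deletion_process_def)
  \<comment> \<open>All claims involve \<open>G n\<close> at one time only, so they transfer from
    \<open>M\<close> to \<open>law n\<close>.\<close>
  have expect: "prob_space.expectation M (\<lambda>\<omega>. h (G n \<omega>)) = E n h" for h n
    unfolding law_def by (rule markov_chain_expectation[OF X])
  have prob: "\<P>(\<omega> in M. P (G n \<omega>)) = measure_pmf.prob (law n) {G. P G}" for P n
    unfolding law_def by (rule markov_chain_prob[OF X])
  have rec: "(\<alpha>\<^sub>2 * (real k + 1) + \<beta>\<^sub>2) * pmf p (k + 1) + (\<alpha>\<^sub>1 * real k + \<beta>\<^sub>1) * pmf p k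
      + (\<alpha>\<^sub>0 * (real k - 1) + \<beta>\<^sub>0) * (if k = 0 then 0 else pmf p (k - 1)) = - (if k = 0 then 1 else 0)" for k
  proof -
    have coeffs: "\<alpha>\<^sub>0 = birth_coeff" "\<beta>\<^sub>0 = \<delta> * birth_coeff" "\<alpha>\<^sub>1 = - birth_coeff - death_coeff"
      "\<beta>\<^sub>1 = - \<delta> * birth_coeff - 1" "\<alpha>\<^sub>2 = death_coeff" "\<beta>\<^sub>2 = 0"
      by (simp_all add: \<alpha>\<^sub>0_def \<beta>\<^sub>0_def \<alpha>\<^sub>1_def \<beta>\<^sub>1_def \<alpha>\<^sub>2_def \<beta>\<^sub>2_def birth_coeff_def death_coeff_def growth_def)
    show ?thesis
      unfolding coeffs using p[of k] by (cases "k = 0") (simp_all add: bd.rate_def algebra_simps)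
  qed
  have l1: "\<exists>\<kappa>>0. \<exists>C>0. \<forall>n\<ge>1. summable (\<lambda>k. \<bar>pmf p k - E n (deg_frac k)\<bar>) \<and>
      (\<Sum>k. \<bar>pmf p k - E n (deg_frac k)\<bar>) \<le> C * real n powr (- \<kappa>)"
    using l1_convergence conv_const_pos conv_exp(1) by blast
  show ?thesis
    unfolding expect[where h = "deg_frac _"] prob[where P = "\<lambda>H. \<bar>deg_frac _ H - pmf _ _\<bar> > _"]
    using expectation_deg_frac_tendsto l1 deg_frac_concentration rec by (intro exI[of _ p]) blast
qed

end
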